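(* Let $(h_n)_{n\ge1}$ be a sequence in $H^\infty$ such that $\|h_n\|_{H^\infty}\le1$ for all $n$ and $\lim_{n\to\infty}h_n(0)=1$. Then, for every $b\in H^\infty$ with $\|b\|_{H^\infty}\le1$ and every $f\in\mathcal{H}(b)$, we have $T_{\overline{h}_n}f\in\mathcal{H}(b)$ for all $n$ and \[ \lim_{n\to\infty}\|T_{\overline{h}_n}f-f\|_{\mathcal{H}(b)}=0. \]
   Context: $H^2$ and $H^\infty$ are the usual Hardy spaces on the unit disk $\mathbb{D}$, and $\mathbb{T}$ is the unit circle. For $\psi\in L^\infty(\mathbb{T})$, the Toeplitz operator $T_\psi:H^2\to H^2$ is $T_\psi f:=P_+(\psi f)$, where $P_+:L^2(\mathbb{T})\to H^2$ is the orthogonal projection. For $b\in H^\infty$ with $\|b\|_{H^\infty}\le1$, the de Branges--Rovnyak space $\mathcal{H}(b)$ is the image of $H^2$ under $(I-T_bT_{\overline b})^{1/2}$, with the norm making this operator a partial isometry of $H^2$ onto $\mathcal{H}(b)$: $\|(I-T_bT_{\overline b})^{1/2}g\|_{\mathcal{H}(b)}:=\|g\|_{H^2}$ for $g\in H^2\ominus\ker(I-T_bT_{\overline b})^{1/2}$. *)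

theory Defs
  imports "HOL-Complex_Analysis.Complex_Analysis"
begin

section \<open>Lebesgue spaces on the unit circle\<close>

text \<open>Normalized arc length on the unit circle, as a probability measure on the Borel sets of the
  complex plane that is concentrated on the circle. Functions on the circle are Borel functions on
  the plane; only their values almost everywhere with respect to this measure matter.\<close>

definition circle_measure :: "complex measure" where
  "circle_measure = distr (uniform_measure lborel {0..2 * pi}) borel cis"

definition L2_circle :: "(complex \<Rightarrow> complex) set" where
  "L2_circle = {g \<in> borel_measurable circle_measure.
     integrable circle_measure (\<lambda>z. (cmod (g z))\<^sup>2)}"

definition L2_inner :: "(complex \<Rightarrow> complex) \<Rightarrow> (complex \<Rightarrow> complex) \<Rightarrow> complex" where
  "L2_inner f g = (LINT z|circle_measure. f z * cnj (g z))"


section \<open>Hardy spaces on the unit disk\<close>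

text \<open>Elements of the Hardy spaces are functions on the open unit disk. They are represented by
  total functions that vanish off the disk, so that equality of elements is equality of
  functions.\<close>

definition disk_holomorphic :: "(complex \<Rightarrow> complex) set" where
  "disk_holomorphic = {f. f holomorphic_on ball 0 1 \<and> (\<forall>z. z \<notin> ball 0 1 \<longrightarrow> f z = 0)}"

definition circle_mean2 :: "(complex \<Rightarrow> complex) \<Rightarrow> real \<Rightarrow> real" where
  "circle_mean2 f r = (LINT z|circle_measure. (cmod (f (of_real r * z)))\<^sup>2)"

definition H2 :: "(complex \<Rightarrow> complex) set" where
  "H2 = {f \<in> disk_holomorphic. bdd_above (circle_mean2 f ` {0..<1})}"

definition H2_norm :: "(complex \<Rightarrow> complex) \<Rightarrow> real" where
  "H2_norm f = sqrt (SUP r\<in>{0..<1}. circle_mean2 f r)"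

definition Hinf :: "(complex \<Rightarrow> complex) set" where
  "Hinf = {h \<in> disk_holomorphic. bounded (h ` ball 0 1)}"

definition Hinf_norm :: "(complex \<Rightarrow> complex) \<Rightarrow> real" where
  "Hinf_norm h = (SUP z\<in>ball 0 1. cmod (h z))"

text \<open>The boundary function of an element of \<^term>\<open>H2\<close> (in particular of \<^term>\<open>Hinf\<close>): the limit in
  mean square of its dilations. It is determined up to a null set of the circle.\<close>

definition boundary :: "(complex \<Rightarrow> complex) \<Rightarrow> (complex \<Rightarrow> complex)" where
  "boundary f = (SOME g. g \<in> L2_circle \<and>
     ((\<lambda>r. LINT z|circle_measure. (cmod (f (of_real r * z) - g z))\<^sup>2) \<longlongrightarrow> 0) (at_left 1))"

definition H2_inner :: "(complex \<Rightarrow> complex) \<Rightarrow> (complex \<Rightarrow> complex) \<Rightarrow> complex" where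
  "H2_inner f g = L2_inner (boundary f) (boundary g)"


section \<open>Toeplitz operators\<close>

text \<open>The orthogonal projection of the square-integrable functions on the circle onto \<^term>\<open>H2\<close>,
  the latter being embedded by \<^term>\<open>boundary\<close>.\<close>

definition riesz_proj :: "(complex \<Rightarrow> complex) \<Rightarrow> (complex \<Rightarrow> complex)" where
  "riesz_proj g = (THE f. f \<in> H2 \<and>
     (\<forall>k\<in>H2. L2_inner (\<lambda>z. g z - boundary f z) (boundary k) = 0))"

text \<open>The symbol \<open>\<psi>\<close> is meant to be essentially bounded on the circle.\<close>

definition toeplitz :: "(complex \<Rightarrow> complex) \<Rightarrow> (complex \<Rightarrow> complex) \<Rightarrow> (complex \<Rightarrow> complex)" where
  "toeplitz \<psi> f = riesz_proj (\<lambda>z. \<psi> z * boundary f z)"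

abbreviation analytic_toeplitz ::
  "(complex \<Rightarrow> complex) \<Rightarrow> (complex \<Rightarrow> complex) \<Rightarrow> (complex \<Rightarrow> complex)" where
  "analytic_toeplitz h \<equiv> toeplitz (boundary h)"

abbreviation coanalytic_toeplitz ::
  "(complex \<Rightarrow> complex) \<Rightarrow> (complex \<Rightarrow> complex) \<Rightarrow> (complex \<Rightarrow> complex)" where
  "coanalytic_toeplitz h \<equiv> toeplitz (\<lambda>z. cnj (boundary h z))"


section \<open>De Branges--Rovnyak spaces\<close>

definition H2_bounded_operator :: "((complex \<Rightarrow> complex) \<Rightarrow> (complex \<Rightarrow> complex)) \<Rightarrow> bool" where
  "H2_bounded_operator S \<longleftrightarrow>
     (\<forall>f\<in>H2. S f \<in> H2) \<and>
     (\<forall>f\<in>H2. \<forall>g\<in>H2. S (\<lambda>z. f z + g z) = (\<lambda>z. S f z + S g z)) \<and>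
     (\<forall>c. \<forall>f\<in>H2. S (\<lambda>z. c * f z) = (\<lambda>z. c * S f z)) \<and>
     (\<exists>C. \<forall>f\<in>H2. H2_norm (S f) \<le> C * H2_norm f)"

definition H2_positive_operator :: "((complex \<Rightarrow> complex) \<Rightarrow> (complex \<Rightarrow> complex)) \<Rightarrow> bool" where
  "H2_positive_operator S \<longleftrightarrow>
     H2_bounded_operator S \<and> (\<forall>f\<in>H2. H2_inner (S f) f \<in> \<real>\<^sub>\<ge>\<^sub>0)"

text \<open>The positive square root; its values on \<^term>\<open>H2\<close> are uniquely determined, and the others
  are irrelevant.\<close>

definition H2_sqrt ::
  "((complex \<Rightarrow> complex) \<Rightarrow> (complex \<Rightarrow> complex)) \<Rightarrow> ((complex \<Rightarrow> complex) \<Rightarrow> (complex \<Rightarrow> complex))" where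
  "H2_sqrt A = (SOME S. H2_positive_operator S \<and> (\<forall>f\<in>H2. S (S f) = A f))"

definition defect_operator ::
  "(complex \<Rightarrow> complex) \<Rightarrow> (complex \<Rightarrow> complex) \<Rightarrow> (complex \<Rightarrow> complex)" where
  "defect_operator b =
     H2_sqrt (\<lambda>f z. f z - analytic_toeplitz b (coanalytic_toeplitz b f) z)"

definition Hb :: "(complex \<Rightarrow> complex) \<Rightarrow> (complex \<Rightarrow> complex) set" where
  "Hb b = defect_operator b ` H2"

text \<open>Every element of \<^term>\<open>Hb b\<close> has exactly one preimage in the orthogonal complement of the
  kernel of the defect operator.\<close>

definition Hb_norm :: "(complex \<Rightarrow> complex) \<Rightarrow> (complex \<Rightarrow> complex) \<Rightarrow> real" where
  "Hb_norm b f = H2_norm (THE g. g \<in> H2 \<and>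
     (\<forall>k\<in>H2. defect_operator b k = (\<lambda>_. 0) \<longrightarrow> H2_inner g k = 0) \<and>
     defect_operator b g = f)"

end

theory Submission
  imports Defs
begin

text \<open>Write \<open>\<Delta> = sqrt (1 - \<bar>b\<bar>\<^sup>2)\<close> on the circle. The map \<open>k \<mapsto> (b k, - \<Delta> k)\<close> is an isometry of
  \<open>H\<^sup>2\<close> into \<open>H\<^sup>2 \<oplus> L\<^sup>2\<close>, and compressing the projection onto the orthogonal complement of its range to
  \<open>H\<^sup>2\<close> gives \<open>1 - T\<^sub>b T\<^sub>b\<^sup>*\<close>. Hence \<open>f\<close> lies in \<open>H(b)\<close> iff there is \<open>u\<close> in \<open>L\<^sup>2\<close> such that \<open>(f, u)\<close> is in
  this complement, and then the norm of \<open>f\<close> in \<open>H(b)\<close> is at most \<open>\<parallel>f\<parallel> + \<parallel>u\<parallel>\<close>. With \<open>(f, u)\<close> the complement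
  also contains the pair of \<open>P\<^sub>+ (cnj h f)\<close> and \<open>cnj h u\<close>, so the distance in question is at most
  \<open>\<parallel>(cnj h\<^sub>n - 1) f\<parallel> + \<parallel>(cnj h\<^sub>n - 1) u\<parallel>\<close> with norms in \<open>L\<^sup>2\<close>. This tends to zero: \<open>h\<^sub>n\<close> tends to 1 in
  \<open>L\<^sup>2\<close> because \<open>\<parallel>h\<^sub>n - 1\<parallel>\<^sup>2 \<le> 2 - 2 Re (h\<^sub>n 0)\<close>, and the \<open>h\<^sub>n\<close> are uniformly bounded.\<close>

section \<open>Square-integrable functions on the circle\<close>

text \<open>Let \<open>D\<close> be the defect operator and \<open>Tb\<close> the adjoint of
  multiplication by \<open>b\<close>. The projection of (k, 0) onto the complement is the pair of
  \<open>D (D k)\<close> and \<open>\<Delta>\<close> times \<open>Tb k\<close>, and its length is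
  the norm of \<open>D k\<close>. So \<open>D k\<close> determines this pair isometrically, which
  extends to limits of such elements, and there the norm of \<open>H(b)\<close> is measured.
  Conversely, a pair over \<open>f\<close> bounds the inner product of \<open>k\<close> with
  \<open>f\<close> by a constant times the norm of \<open>D k\<close>, which forces \<open>f\<close>
  into the range of the self-adjoint \<open>D\<close>.

  The obstacle is that the coanalytic Toeplitz operator of \<open>h\<close> does not commute with
  \<open>D\<close> in general, so nothing can be read off from a preimage of \<open>f\<close>. On
  pairs it is harmless: the range of the isometry is invariant under multiplication by
  \<open>h\<close>, so the complement is invariant under the adjoint, which on the second coordinate
  is mere multiplication by the conjugate. The second coordinate is not unique, as anything
  orthogonal to all \<open>\<Delta> k\<close> may be added; hence only an upper bound for the
  norm.\<close>

lemma sets_circle_measure [measurable_cong, simp]: "sets circle_measure = sets borel"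
  by (simp add: circle_measure_def)

lemma space_circle_measure [simp]: "space circle_measure = UNIV"
  by (simp add: circle_measure_def)

lemma borel_measurable_cis [measurable]: "cis \<in> borel_measurable borel"
  by (intro borel_measurable_continuous_onI continuous_on_cis continuous_on_id)

lemma borel_measurable_cnj [measurable]: "cnj \<in> borel_measurable borel"
  by (intro borel_measurable_continuous_onI continuous_on_cnj continuous_on_id)

lemma measurable_cis_uniform [measurable]:
  "cis \<in> borel_measurable (uniform_measure lborel {0..2 * pi})"
  using borel_measurable_cis by (simp add: measurable_def)

lemma emeasure_circle_measure_UNIV: "emeasure circle_measure UNIV = 1"
proof -
  have "emeasure circle_measure UNIV = emeasure (uniform_measure lborel {0..2 * pi}) UNIV"
    unfolding circle_measure_def by (subst emeasure_distr) auto
  also have "\<dots> = 1"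
    by (subst emeasure_uniform_measure)
       (auto simp: ennreal_divide_self)
  finally show ?thesis .
qed

interpretation circle: finite_measure circle_measure
  by (rule finite_measureI) (simp add: emeasure_circle_measure_UNIV)

lemma measure_circle_measure_UNIV [simp]: "measure circle_measure UNIV = 1"
  by (simp add: measure_def emeasure_circle_measure_UNIV)

lemma AE_circle_norm: "AE z in circle_measure. cmod z = 1"
  unfolding circle_measure_def
  by (subst AE_distr_iff) auto

section \<open>Norm and inner product in mean square\<close>

text \<open>Meaningful on \<open>L2_circle\<close> only: if the square is not integrable, the
  integral takes its default value 0. This is why comparisons such as \<open>l2norm_mono\<close> ask
  the larger function to be in \<open>L2_circle\<close>.\<close>

definition l2norm :: "(complex \<Rightarrow> complex) \<Rightarrow> real" where
  "l2norm g = sqrt (LINT z|circle_measure. (cmod (g z))\<^sup>2)"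

lemma l2norm_nonneg [simp]: "0 \<le> l2norm g"
  by (simp add: l2norm_def)

lemma l2norm_power2: "(l2norm g)\<^sup>2 = (LINT z|circle_measure. (cmod (g z))\<^sup>2)"
  by (simp add: l2norm_def)

lemma L2_circle_I:
  "g \<in> borel_measurable circle_measure \<Longrightarrow> integrable circle_measure (\<lambda>z. (cmod (g z))\<^sup>2)
    \<Longrightarrow> g \<in> L2_circle"
  by (simp add: L2_circle_def)

lemma L2_circle_measurable [measurable_dest]:
  "g \<in> L2_circle \<Longrightarrow> g \<in> borel_measurable circle_measure"
  by (simp add: L2_circle_def)

lemma L2_circle_integrable: "g \<in> L2_circle \<Longrightarrow> integrable circle_measure (\<lambda>z. (cmod (g z))\<^sup>2)"
  by (simp add: L2_circle_def)

lemma l2norm_cong: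
  assumes [measurable]: "f \<in> borel_measurable circle_measure" "g \<in> borel_measurable circle_measure"
    and "AE z in circle_measure. f z = g z"
  shows "l2norm f = l2norm g"
  unfolding l2norm_def using assms(3)
  by (intro arg_cong[where f = sqrt] integral_cong_AE) auto

lemma L2_inner_cong:
  assumes [measurable]: "f \<in> borel_measurable circle_measure" "f' \<in> borel_measurable circle_measure"
    "g \<in> borel_measurable circle_measure" "g' \<in> borel_measurable circle_measure"
    and "AE z in circle_measure. f z = f' z" "AE z in circle_measure. g z = g' z"
  shows "L2_inner f g = L2_inner f' g'"
  unfolding L2_inner_def
proof (rule integral_cong_AE)
  show "AE z in circle_measure. f z * cnj (g z) = f' z * cnj (g' z)"
    using assms(5,6) by eventually_elim simp
qed measurable

lemma l2norm_eq_0_iff: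
  assumes "g \<in> L2_circle"
  shows "l2norm g = 0 \<longleftrightarrow> (AE z in circle_measure. g z = 0)"
proof -
  have "l2norm g = 0 \<longleftrightarrow> (LINT z|circle_measure. (cmod (g z))\<^sup>2) = 0"
    by (simp add: l2norm_def)
  also have "\<dots> \<longleftrightarrow> (AE z in circle_measure. (cmod (g z))\<^sup>2 = 0)"
    by (rule integral_nonneg_eq_0_iff_AE[OF L2_circle_integrable[OF assms]]) simp
  finally show ?thesis by simp
qed

lemma L2_circle_bounded:
  assumes [measurable]: "g \<in> borel_measurable circle_measure"
    and "AE z in circle_measure. cmod (g z) \<le> C"
  shows "g \<in> L2_circle"
proof (rule L2_circle_I)
  show "integrable circle_measure (\<lambda>z. (cmod (g z))\<^sup>2)"
    by (rule circle.integrable_const_bound[where B = "C\<^sup>2"])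
       (use assms(2) in \<open>auto elim!: eventually_mono intro: power_mono\<close>)
qed fact

lemma L2_circle_mult_bounded:
  assumes \<phi> [measurable]: "\<phi> \<in> borel_measurable circle_measure"
    and b: "AE z in circle_measure. cmod (\<phi> z) \<le> C" and g: "g \<in> L2_circle"
  shows "(\<lambda>z. \<phi> z * g z) \<in> L2_circle"
proof (rule L2_circle_I)
  note [measurable] = L2_circle_measurable[OF g]
  show "(\<lambda>z. \<phi> z * g z) \<in> borel_measurable circle_measure" by measurable
  show "integrable circle_measure (\<lambda>z. (cmod (\<phi> z * g z))\<^sup>2)"
  proof (rule Bochner_Integration.integrable_bound)
    show "integrable circle_measure (\<lambda>z. C\<^sup>2 * (cmod (g z))\<^sup>2)"
      using L2_circle_integrable[OF g] by simp
    show "AE z in circle_measure. norm ((cmod (\<phi> z * g z))\<^sup>2) \<le> norm (C\<^sup>2 * (cmod (g z))\<^sup>2)"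
      using b by eventually_elim
        (auto simp: norm_mult power_mult_distrib intro!: mult_right_mono power_mono)
  qed measurable
qed

lemma L2_circle_scale: "g \<in> L2_circle \<Longrightarrow> (\<lambda>z. c * g z) \<in> L2_circle"
  by (rule L2_circle_mult_bounded[where C = "cmod c"]) auto

lemma L2_circle_zero: "(\<lambda>_. 0) \<in> L2_circle"
  by (simp add: L2_circle_def)

lemma L2_circle_const: "(\<lambda>_. c) \<in> L2_circle"
  by (simp add: L2_circle_def)

lemma L2_circle_add:
  assumes f: "f \<in> L2_circle" and g: "g \<in> L2_circle"
  shows "(\<lambda>z. f z + g z) \<in> L2_circle"
proof (rule L2_circle_I)
  note [measurable] = L2_circle_measurable[OF f] L2_circle_measurable[OF g]
  show "(\<lambda>z. f z + g z) \<in> borel_measurable circle_measure" by measurable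
  show "integrable circle_measure (\<lambda>z. (cmod (f z + g z))\<^sup>2)"
  proof (rule Bochner_Integration.integrable_bound)
    show "integrable circle_measure (\<lambda>z. 2 * (cmod (f z))\<^sup>2 + 2 * (cmod (g z))\<^sup>2)"
      using L2_circle_integrable[OF f] L2_circle_integrable[OF g] by simp
    show "AE z in circle_measure. norm ((cmod (f z + g z))\<^sup>2)
            \<le> norm (2 * (cmod (f z))\<^sup>2 + 2 * (cmod (g z))\<^sup>2)"
    proof (rule AE_I2)
      fix z
      have "(cmod (f z + g z))\<^sup>2 \<le> (cmod (f z) + cmod (g z))\<^sup>2"
        by (simp add: norm_triangle_ineq power_mono)
      also have "\<dots> \<le> 2 * (cmod (f z))\<^sup>2 + 2 * (cmod (g z))\<^sup>2"
        using sum_squares_bound[of "cmod (f z)" "cmod (g z)"] by (simp add: power2_sum)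
      finally show "norm ((cmod (f z + g z))\<^sup>2) \<le> norm (2 * (cmod (f z))\<^sup>2 + 2 * (cmod (g z))\<^sup>2)"
        by simp
    qed
  qed measurable
qed

lemma L2_circle_uminus: "g \<in> L2_circle \<Longrightarrow> (\<lambda>z. - g z) \<in> L2_circle"
  by (simp add: L2_circle_def)

lemma L2_circle_diff:
  "f \<in> L2_circle \<Longrightarrow> g \<in> L2_circle \<Longrightarrow> (\<lambda>z. f z - g z) \<in> L2_circle"
  using L2_circle_add[of f "\<lambda>z. - g z"] L2_circle_uminus[of g] by simp

lemma L2_circle_sum:
  "(\<And>i. i \<in> I \<Longrightarrow> f i \<in> L2_circle) \<Longrightarrow> (\<lambda>z. \<Sum>i\<in>I. f i z) \<in> L2_circle"
  by (induction I rule: infinite_finite_induct) (auto intro: L2_circle_add L2_circle_zero)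

lemma L2_circle_integrable_mult:
  assumes f: "f \<in> L2_circle" and g: "g \<in> L2_circle"
  shows "integrable circle_measure (\<lambda>z. f z * cnj (g z))"
proof (rule Bochner_Integration.integrable_bound)
  note [measurable] = L2_circle_measurable[OF f] L2_circle_measurable[OF g]
  show "integrable circle_measure (\<lambda>z. (cmod (f z))\<^sup>2 + (cmod (g z))\<^sup>2)"
    using L2_circle_integrable[OF f] L2_circle_integrable[OF g] by simp
  show "AE z in circle_measure. norm (f z * cnj (g z)) \<le> norm ((cmod (f z))\<^sup>2 + (cmod (g z))\<^sup>2)"
  proof (rule AE_I2)
    fix z
    have "0 \<le> cmod (f z) * cmod (g z)" by simp
    then have "cmod (f z) * cmod (g z) \<le> (cmod (f z))\<^sup>2 + (cmod (g z))\<^sup>2"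
      using sum_squares_bound[of "cmod (f z)" "cmod (g z)"] by linarith
    then show "norm (f z * cnj (g z)) \<le> norm ((cmod (f z))\<^sup>2 + (cmod (g z))\<^sup>2)"
      by (simp add: norm_mult)
  qed
qed (use f g in measurable)

lemma L2_inner_add_left:
  "f \<in> L2_circle \<Longrightarrow> g \<in> L2_circle \<Longrightarrow> k \<in> L2_circle \<Longrightarrow>
    L2_inner (\<lambda>z. f z + g z) k = L2_inner f k + L2_inner g k"
  unfolding L2_inner_def by (simp add: distrib_right L2_circle_integrable_mult)

lemma L2_inner_diff_left:
  "f \<in> L2_circle \<Longrightarrow> g \<in> L2_circle \<Longrightarrow> k \<in> L2_circle \<Longrightarrow>
    L2_inner (\<lambda>z. f z - g z) k = L2_inner f k - L2_inner g k"
  unfolding L2_inner_def by (simp add: left_diff_distrib L2_circle_integrable_mult)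

lemma L2_inner_scale_left: "L2_inner (\<lambda>z. c * f z) k = c * L2_inner f k"
  unfolding L2_inner_def by (simp add: mult.assoc)

lemma L2_inner_commute: "L2_inner g f = cnj (L2_inner f g)"
  unfolding L2_inner_def by (simp flip: Bochner_Integration.integral_cnj add: mult.commute)

lemma L2_inner_diff_right:
  "f \<in> L2_circle \<Longrightarrow> g \<in> L2_circle \<Longrightarrow> k \<in> L2_circle \<Longrightarrow>
    L2_inner k (\<lambda>z. f z - g z) = L2_inner k f - L2_inner k g"
  unfolding L2_inner_def by (simp add: right_diff_distrib L2_circle_integrable_mult)

lemma L2_inner_add_right:
  "f \<in> L2_circle \<Longrightarrow> g \<in> L2_circle \<Longrightarrow> k \<in> L2_circle \<Longrightarrow>
    L2_inner k (\<lambda>z. f z + g z) = L2_inner k f + L2_inner k g"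
  unfolding L2_inner_def by (simp add: distrib_left L2_circle_integrable_mult)

lemma L2_inner_mult_left: "L2_inner (\<lambda>z. \<phi> z * f z) g = L2_inner f (\<lambda>z. cnj (\<phi> z) * g z)"
  unfolding L2_inner_def by (simp add: mult_ac)

lemma L2_inner_self: "L2_inner f f = complex_of_real ((l2norm f)\<^sup>2)"
proof -
  have "L2_inner f f = (LINT z|circle_measure. complex_of_real ((cmod (f z))\<^sup>2))"
    unfolding L2_inner_def by (simp add: complex_norm_square[symmetric] of_real_power[symmetric] del: of_real_power)
  then show ?thesis
    by (simp only: integral_complex_of_real l2norm_power2)
qed

section \<open>Cauchy-Schwarz, triangle inequality and limits in mean square\<close>

text \<open>A weighted arithmetic-geometric mean inequality is integrated, with the norms themselves
  as weights. Adding \<open>\<epsilon>\<close> to both norms keeps the weights positive when a norm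
  vanishes; it tends to 0 at the end.\<close>

lemma L2_Cauchy_Schwarz:
  assumes f: "f \<in> L2_circle" and g: "g \<in> L2_circle"
  shows "cmod (L2_inner f g) \<le> l2norm f * l2norm g"
proof -
  have ineq: "cmod (L2_inner f g) \<le> (l2norm f + \<epsilon>) * (l2norm g + \<epsilon>)" if "\<epsilon> > 0" for \<epsilon>
  proof -
    define a b where "a = l2norm f + \<epsilon>" and "b = l2norm g + \<epsilon>"
    have ab: "a > 0" "b > 0" using that by (auto simp: a_def b_def add_nonneg_pos)
    have le: "(l2norm f)\<^sup>2 \<le> a\<^sup>2" "(l2norm g)\<^sup>2 \<le> b\<^sup>2"
      using that by (auto simp: a_def b_def intro!: power_mono)
    have "cmod (L2_inner f g) \<le> (LINT z|circle_measure. cmod (f z * cnj (g z)))"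
      unfolding L2_inner_def by (rule integral_norm_bound)
    also have "\<dots> \<le> (LINT z|circle_measure. (b / a) / 2 * (cmod (f z))\<^sup>2 + (a / b) / 2 * (cmod (g z))\<^sup>2)"
    proof (rule integral_mono)
      show "integrable circle_measure (\<lambda>z. cmod (f z * cnj (g z)))"
        using L2_circle_integrable_mult[OF f g] by (rule integrable_norm)
      show "integrable circle_measure (\<lambda>z. (b / a) / 2 * (cmod (f z))\<^sup>2 + (a / b) / 2 * (cmod (g z))\<^sup>2)"
        using L2_circle_integrable[OF f] L2_circle_integrable[OF g] by simp
      fix z
      have "0 \<le> (b * cmod (f z) - a * cmod (g z))\<^sup>2 / (2 * a * b)"
        using ab by simp
      also have "\<dots> = (b / a) / 2 * (cmod (f z))\<^sup>2 + (a / b) / 2 * (cmod (g z))\<^sup>2 - cmod (f z) * cmod (g z)"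
        using ab by (simp add: field_simps power2_eq_square)
      finally show "cmod (f z * cnj (g z)) \<le> (b / a) / 2 * (cmod (f z))\<^sup>2 + (a / b) / 2 * (cmod (g z))\<^sup>2"
        by (simp add: norm_mult)
    qed
    also have "\<dots> = (b / a) / 2 * (l2norm f)\<^sup>2 + (a / b) / 2 * (l2norm g)\<^sup>2"
      using L2_circle_integrable[OF f] L2_circle_integrable[OF g] by (simp add: l2norm_power2)
    also have "\<dots> \<le> (b / a) / 2 * a\<^sup>2 + (a / b) / 2 * b\<^sup>2"
      using le ab by (intro add_mono mult_left_mono) auto
    also have "\<dots> = a * b"
      using ab by (simp add: field_simps power2_eq_square)
    finally show ?thesis by (simp add: a_def b_def)
  qed
  have "((\<lambda>\<epsilon>. (l2norm f + \<epsilon>) * (l2norm g + \<epsilon>)) \<longlongrightarrow> (l2norm f + 0) * (l2norm g + 0)) (at_right 0)"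
    by (intro tendsto_intros)
  then have "cmod (L2_inner f g) \<le> (l2norm f + 0) * (l2norm g + 0)"
    by (rule tendsto_lowerbound) (auto simp: eventually_at_right_less ineq intro!: eventually_at_rightI[of 0 1])
  then show ?thesis by simp
qed

lemma l2norm_scale: "l2norm (\<lambda>z. c * f z) = cmod c * l2norm f"
  unfolding l2norm_def by (simp add: norm_mult power_mult_distrib real_sqrt_mult)

lemma l2norm_add_power2:
  assumes "f \<in> L2_circle" "g \<in> L2_circle"
  shows "(l2norm (\<lambda>z. f z + g z))\<^sup>2 = (l2norm f)\<^sup>2 + 2 * Re (L2_inner f g) + (l2norm g)\<^sup>2"
proof -
  have "complex_of_real ((l2norm (\<lambda>z. f z + g z))\<^sup>2)
      = L2_inner f f + L2_inner g f + (L2_inner f g + L2_inner g g)"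
    unfolding L2_inner_self[symmetric]
    using assms by (simp add: L2_inner_add_left L2_inner_add_right L2_circle_add algebra_simps)
  also have "\<dots> = complex_of_real ((l2norm f)\<^sup>2 + 2 * Re (L2_inner f g) + (l2norm g)\<^sup>2)"
    unfolding L2_inner_self L2_inner_commute[of g f]
    by (simp add: complex_eq_iff)
  finally show ?thesis by (simp only: of_real_eq_iff)
qed

lemma l2norm_triangle:
  assumes "f \<in> L2_circle" "g \<in> L2_circle"
  shows "l2norm (\<lambda>z. f z + g z) \<le> l2norm f + l2norm g"
proof (rule power2_le_imp_le)
  have "Re (L2_inner f g) \<le> l2norm f * l2norm g"
    using complex_Re_le_cmod L2_Cauchy_Schwarz[OF assms] by (rule order_trans)
  then show "(l2norm (\<lambda>z. f z + g z))\<^sup>2 \<le> (l2norm f + l2norm g)\<^sup>2"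
    unfolding l2norm_add_power2[OF assms] power2_sum by simp
qed simp

lemma l2norm_minus: "l2norm (\<lambda>z. - g z) = l2norm g"
  by (simp add: l2norm_def)

lemma l2norm_minus_commute: "l2norm (\<lambda>z. f z - g z) = l2norm (\<lambda>z. g z - f z)"
  by (simp add: l2norm_def norm_minus_commute)

lemma l2norm_triangle_diff:
  assumes "f \<in> L2_circle" "g \<in> L2_circle" "k \<in> L2_circle"
  shows "l2norm (\<lambda>z. f z - k z) \<le> l2norm (\<lambda>z. f z - g z) + l2norm (\<lambda>z. g z - k z)"
  using l2norm_triangle[OF L2_circle_diff[OF assms(1,2)] L2_circle_diff[OF assms(2,3)]] by simp

lemma l2norm_triangle_sub:
  assumes "f \<in> L2_circle" "g \<in> L2_circle"
  shows "\<bar>l2norm f - l2norm g\<bar> \<le> l2norm (\<lambda>z. f z - g z)"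
  using l2norm_triangle[OF L2_circle_diff[OF assms] assms(2)]
    l2norm_triangle[OF L2_circle_diff[OF assms(2,1)] assms(1)]
  by (simp add: l2norm_minus_commute[of g f] abs_le_iff)

lemma l2norm_tendsto:
  assumes "\<And>n. f n \<in> L2_circle" "g \<in> L2_circle" "((\<lambda>n. l2norm (\<lambda>z. f n z - g z)) \<longlongrightarrow> 0) F"
  shows "((\<lambda>n. l2norm (f n)) \<longlongrightarrow> l2norm g) F"
proof (rule LIM_zero_cancel, rule Lim_null_comparison[OF _ assms(3)])
  show "\<forall>\<^sub>F n in F. norm (l2norm (f n) - l2norm g) \<le> l2norm (\<lambda>z. f n z - g z)"
    using l2norm_triangle_sub[OF assms(1,2)] by simp
qed

lemma L2_inner_tendsto_right:
  assumes "\<And>n. f n \<in> L2_circle" "g \<in> L2_circle" "k \<in> L2_circle"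
    and "((\<lambda>n. l2norm (\<lambda>z. f n z - g z)) \<longlongrightarrow> 0) F"
  shows "((\<lambda>n. L2_inner k (f n)) \<longlongrightarrow> L2_inner k g) F"
proof (rule LIM_zero_cancel, rule Lim_null_comparison)
  show "\<forall>\<^sub>F n in F. norm (L2_inner k (f n) - L2_inner k g) \<le> l2norm k * l2norm (\<lambda>z. f n z - g z)"
    using L2_Cauchy_Schwarz[OF assms(3) L2_circle_diff[OF assms(1,2)]]
    by (simp add: L2_inner_diff_right assms)
  show "((\<lambda>n. l2norm k * l2norm (\<lambda>z. f n z - g z)) \<longlongrightarrow> 0) F"
    using assms(4) by (rule tendsto_mult_right_zero)
qed

lemma L2_inner_tendsto_left:
  assumes "\<And>n. f n \<in> L2_circle" "g \<in> L2_circle" "k \<in> L2_circle"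
    and "((\<lambda>n. l2norm (\<lambda>z. f n z - g z)) \<longlongrightarrow> 0) F"
  shows "((\<lambda>n. L2_inner (f n) k) \<longlongrightarrow> L2_inner g k) F"
  unfolding L2_inner_commute[of _ k] by (intro tendsto_cnj L2_inner_tendsto_right assms)

lemma l2norm_limit_unique:
  assumes "\<And>n. f n \<in> L2_circle" "g \<in> L2_circle" "g' \<in> L2_circle" "F \<noteq> bot"
    and "((\<lambda>n. l2norm (\<lambda>z. f n z - g z)) \<longlongrightarrow> 0) F" "((\<lambda>n. l2norm (\<lambda>z. f n z - g' z)) \<longlongrightarrow> 0) F"
  shows "AE z in circle_measure. g z = g' z"
proof -
  have "((\<lambda>n. l2norm (\<lambda>z. f n z - g z) + l2norm (\<lambda>z. f n z - g' z)) \<longlongrightarrow> 0 + 0) F"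
    by (intro tendsto_add assms)
  then have "l2norm (\<lambda>z. g z - g' z) \<le> 0 + 0"
  proof (rule tendsto_lowerbound)
    show "\<forall>\<^sub>F n in F. l2norm (\<lambda>z. g z - g' z) \<le> l2norm (\<lambda>z. f n z - g z) + l2norm (\<lambda>z. f n z - g' z)"
      using l2norm_triangle_diff[OF assms(2,1,3)] by (simp add: l2norm_minus_commute[of g])
  qed fact
  then have "l2norm (\<lambda>z. g z - g' z) = 0"
    using l2norm_nonneg[of "\<lambda>z. g z - g' z"] by linarith
  then show ?thesis
    using l2norm_eq_0_iff[OF L2_circle_diff[OF assms(2,3)]] by simp
qed

lemma l2norm_mono:
  assumes "f \<in> borel_measurable circle_measure" "g \<in> L2_circle"
    and "AE z in circle_measure. cmod (f z) \<le> cmod (g z)"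
  shows "l2norm f \<le> l2norm g"
proof -
  note [measurable] = assms(1)
  have "integrable circle_measure (\<lambda>z. (cmod (f z))\<^sup>2)"
    by (rule Bochner_Integration.integrable_bound[OF L2_circle_integrable[OF assms(2)]])
       (use assms(3) in \<open>auto elim!: eventually_mono intro: power_mono\<close>)
  then show ?thesis
    unfolding l2norm_def
    by (intro real_sqrt_le_mono integral_mono_AE L2_circle_integrable[OF assms(2)])
       (use assms(3) in \<open>auto elim!: eventually_mono intro: power_mono\<close>)
qed

lemma l2norm_mult_bounded:
  assumes "\<phi> \<in> borel_measurable circle_measure" "AE z in circle_measure. cmod (\<phi> z) \<le> C"
    "g \<in> L2_circle" "0 \<le> C"
  shows "l2norm (\<lambda>z. \<phi> z * g z) \<le> C * l2norm g"
proof -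
  note [measurable] = assms(1) L2_circle_measurable[OF assms(3)]
  have "l2norm (\<lambda>z. \<phi> z * g z) \<le> l2norm (\<lambda>z. complex_of_real C * g z)"
    by (rule l2norm_mono)
       (use assms in \<open>auto intro: L2_circle_scale mult_right_mono simp: norm_mult elim!: eventually_mono\<close>)
  then show ?thesis using assms(4) by (simp add: l2norm_scale)
qed

section \<open>Completeness, and products with bounded functions\<close>

text \<open>Cauchy-Schwarz against the constant 1, which has norm 1 because the total mass is
  1.\<close>

lemma L1_le_l2norm:
  assumes g: "g \<in> L2_circle"
  shows "integrable circle_measure (\<lambda>z. cmod (g z))" "(LINT z|circle_measure. cmod (g z)) \<le> l2norm g"
proof -
  let ?a = "\<lambda>z. complex_of_real (cmod (g z))"
  note [measurable] = L2_circle_measurable[OF g]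
  have a: "?a \<in> L2_circle"
    using L2_circle_integrable[OF g] by (intro L2_circle_I) auto
  have "integrable circle_measure (\<lambda>z. ?a z * cnj 1)"
    by (rule L2_circle_integrable_mult[OF a L2_circle_const])
  from integrable_norm[OF this] show "integrable circle_measure (\<lambda>z. cmod (g z))"
    by (simp add: norm_mult)
  have "l2norm ?a = l2norm g" "l2norm (\<lambda>_. 1) = 1"
    by (simp_all add: l2norm_def)
  then have "cmod (L2_inner ?a (\<lambda>_. 1)) \<le> l2norm g"
    using L2_Cauchy_Schwarz[OF a L2_circle_const[of 1]] by simp
  moreover have "L2_inner ?a (\<lambda>_. 1) = complex_of_real (LINT z|circle_measure. cmod (g z))"
    by (simp add: L2_inner_def)
  ultimately show "(LINT z|circle_measure. cmod (g z)) \<le> l2norm g"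
    by simp
qed

lemma L2_nn_integral:
  assumes "g \<in> L2_circle"
  shows "(\<integral>\<^sup>+ z. ennreal ((cmod (g z))\<^sup>2) \<partial>circle_measure) = ennreal ((l2norm g)\<^sup>2)"
  unfolding l2norm_power2 by (rule nn_integral_eq_integral[OF L2_circle_integrable[OF assms]]) simp

text \<open>A Cauchy sequence converges almost everywhere along a rapidly converging subsequence; by Fatou's
  lemma the pointwise limit is the limit in mean square.\<close>

theorem L2_circle_complete:
  fixes u :: "nat \<Rightarrow> complex \<Rightarrow> complex"
  assumes u: "\<And>n. u n \<in> L2_circle"
    and cauchy: "\<And>e. e > 0 \<Longrightarrow> \<exists>N. \<forall>m\<ge>N. \<forall>n\<ge>N. l2norm (\<lambda>z. u m z - u n z) < e"
  obtains g where "g \<in> L2_circle" "(\<lambda>n. l2norm (\<lambda>z. u n z - g z)) \<longlonglongrightarrow> 0"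
proof -
  note [measurable] = L2_circle_measurable[OF u]
  obtain \<nu> where \<nu>: "\<And>e m n. e > 0 \<Longrightarrow> m \<ge> \<nu> e \<Longrightarrow> n \<ge> \<nu> e \<Longrightarrow> l2norm (\<lambda>z. u m z - u n z) < e"
    using cauchy by metis
  \<comment> \<open>The sum puts \<open>r k\<close> beyond the threshold for (1/2)^k, and the extra
    summand \<open>k\<close> makes the indices strictly increasing.\<close>
  define r where "r k = k + (\<Sum>j\<le>k. \<nu> ((1 / 2) ^ j))" for k
  have r_ge: "r k \<ge> \<nu> ((1 / 2) ^ k)" for k
    by (simp add: r_def trans_le_add2 sum_nonneg lessThan_Suc_atMost[symmetric])
  have r_mono: "strict_mono r"
    by (rule strict_mono_Suc_iff[THEN iffD2]) (simp add: r_def)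
  define d where "d k z = u (r (Suc k)) z - u (r k) z" for k z
  have d: "d k \<in> L2_circle" for k
    unfolding d_def by (intro L2_circle_diff u)
  note [measurable] = L2_circle_measurable[OF d]
  have d_le: "l2norm (d k) \<le> (1 / 2) ^ k" for k
    unfolding d_def
    using \<nu>[of "(1/2)^k" "r (Suc k)" "r k"] r_ge[of k] strict_mono_less_eq[OF r_mono, of k "Suc k"]
    by (simp add: less_imp_le)
  have "(\<integral>\<^sup>+ z. (\<Sum>k. ennreal (cmod (d k z))) \<partial>circle_measure)
      = (\<Sum>k. \<integral>\<^sup>+ z. ennreal (cmod (d k z)) \<partial>circle_measure)"
    by (rule nn_integral_suminf) measurable
  also have "\<dots> \<le> (\<Sum>k. ennreal ((1 / 2) ^ k))"
  proof (intro suminf_le summableI)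
    fix k
    have "(\<integral>\<^sup>+ z. ennreal (cmod (d k z)) \<partial>circle_measure) = ennreal (LINT z|circle_measure. cmod (d k z))"
      by (rule nn_integral_eq_integral) (auto intro: L1_le_l2norm d)
    also have "\<dots> \<le> ennreal ((1 / 2) ^ k)"
      using L1_le_l2norm(2)[OF d[of k]] d_le[of k] by (intro ennreal_leI) linarith
    finally show "(\<integral>\<^sup>+ z. ennreal (cmod (d k z)) \<partial>circle_measure) \<le> ennreal ((1 / 2) ^ k)" .
  qed
  also have "\<dots> = ennreal (\<Sum>k. (1 / 2) ^ k)"
    by (rule suminf_ennreal2) (auto intro: summable_geometric)
  finally have fin: "(\<integral>\<^sup>+ z. (\<Sum>k. ennreal (cmod (d k z))) \<partial>circle_measure) \<noteq> \<infinity>"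
    by (auto simp: top_unique)
  have "AE z in circle_measure. (\<Sum>k. ennreal (cmod (d k z))) \<noteq> \<infinity>"
    by (rule nn_integral_PInf_AE[OF _ fin]) measurable
  then have conv: "AE z in circle_measure. convergent (\<lambda>k. u (r k) z)"
  proof eventually_elim
    case (elim z)
    then have "summable (\<lambda>k. cmod (d k z))"
      by (intro summable_suminf_not_top) auto
    then have "summable (\<lambda>k. d k z)"
      by (rule summable_norm_cancel)
    then have "convergent (\<lambda>n. \<Sum>k<n. d k z)"
      by (simp add: summable_iff_convergent)
    moreover have "(\<Sum>k<n. d k z) = u (r n) z - u (r 0) z" for n
      unfolding d_def by (rule sum_lessThan_telescope)
    ultimately have "convergent (\<lambda>n. u (r n) z - u (r 0) z)"
      by simp
    then have "convergent (\<lambda>n. u (r n) z - u (r 0) z + u (r 0) z)"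
      by (intro convergent_add convergent_const)
    then show ?case by simp
  qed
  define g where "g z = lim (\<lambda>k. u (r k) z)" for z
  have g_meas [measurable]: "g \<in> borel_measurable circle_measure"
    unfolding g_def by measurable
  have lim: "AE z in circle_measure. (\<lambda>k. u (r k) z) \<longlonglongrightarrow> g z"
    using conv by eventually_elim (simp add: g_def convergent_LIMSEQ_iff)
  have fatou: "(\<integral>\<^sup>+ z. ennreal ((cmod (u n z - g z))\<^sup>2) \<partial>circle_measure) \<le> ennreal (e\<^sup>2)"
    if e: "e > 0" "n \<ge> \<nu> e" for n e
  proof -
    have "(\<integral>\<^sup>+ z. ennreal ((cmod (u n z - g z))\<^sup>2) \<partial>circle_measure)
        = (\<integral>\<^sup>+ z. liminf (\<lambda>k. ennreal ((cmod (u n z - u (r k) z))\<^sup>2)) \<partial>circle_measure)"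
    proof (rule nn_integral_cong_AE)
      show "AE z in circle_measure. ennreal ((cmod (u n z - g z))\<^sup>2)
          = liminf (\<lambda>k. ennreal ((cmod (u n z - u (r k) z))\<^sup>2))"
        using lim
      proof eventually_elim
        case (elim z)
        have "(\<lambda>k. ennreal ((cmod (u n z - u (r k) z))\<^sup>2)) \<longlonglongrightarrow> ennreal ((cmod (u n z - g z))\<^sup>2)"
          by (intro tendsto_ennrealI tendsto_intros elim)
        then show ?case
          by (intro lim_imp_Liminf[symmetric]) auto
      qed
    qed
    also have "\<dots> \<le> liminf (\<lambda>k. \<integral>\<^sup>+ z. ennreal ((cmod (u n z - u (r k) z))\<^sup>2) \<partial>circle_measure)"
      by (rule nn_integral_liminf) measurable
    also have "\<dots> \<le> ennreal (e\<^sup>2)"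
    proof (rule Liminf_le)
      show "\<forall>\<^sub>F k in sequentially. (\<integral>\<^sup>+ z. ennreal ((cmod (u n z - u (r k) z))\<^sup>2) \<partial>circle_measure) \<le> ennreal (e\<^sup>2)"
        using eventually_ge_at_top[of "\<nu> e"]
      proof eventually_elim
        case (elim k)
        have "r k \<ge> \<nu> e" using elim seq_suble[OF r_mono, of k] by simp
        then have "l2norm (\<lambda>z. u n z - u (r k) z) < e" by (intro \<nu> e)
        then show ?case
          by (subst L2_nn_integral) (auto intro!: L2_circle_diff u ennreal_leI power_mono)
      qed
    qed simp
    finally show ?thesis .
  qed
  have diff: "(\<lambda>z. u n z - g z) \<in> L2_circle" if "n \<ge> \<nu> 1" for n
  proof (rule L2_circle_I)
    show "integrable circle_measure (\<lambda>z. (cmod (u n z - g z))\<^sup>2)"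
      using fatou[of 1 n] that
      by (intro integrableI_bounded) (auto simp: order_le_less_trans)
  qed measurable
  \<comment> \<open>So far only the differences with \<open>g\<close> are known to be
    square-integrable; \<open>g\<close> itself is recovered by subtracting one of them from a member
    of the sequence.\<close>
  have "(\<lambda>z. u (\<nu> 1) z - (u (\<nu> 1) z - g z)) \<in> L2_circle"
    by (intro L2_circle_diff[OF u diff]) simp
  then have g: "g \<in> L2_circle" by simp
  have le: "l2norm (\<lambda>z. u n z - g z) \<le> e" if "e > 0" "n \<ge> \<nu> e" for n e
  proof -
    have "ennreal ((l2norm (\<lambda>z. u n z - g z))\<^sup>2) \<le> ennreal (e\<^sup>2)"
      using fatou[OF that] L2_nn_integral[OF L2_circle_diff[OF u g], of n] by simp
    then show ?thesis
      using that(1) by (simp add: ennreal_le_iff power_mono_iff)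
  qed
  have "(\<lambda>n. l2norm (\<lambda>z. u n z - g z)) \<longlonglongrightarrow> 0"
  proof (rule LIMSEQ_I)
    fix e :: real assume "e > 0"
    then show "\<exists>N. \<forall>n\<ge>N. norm (l2norm (\<lambda>z. u n z - g z) - 0) < e"
      using le[of "e / 2"] by (intro exI[of _ "\<nu> (e / 2)"]) force
  qed
  with g show ?thesis by (rule that)
qed

text \<open>Split \<open>g\<close> at the level \<open>R\<close>: where \<open>\<bar>g\<bar> \<le> R\<close> the product is controlled by \<open>R\<close> times the
  norm of \<open>\<phi> n\<close>, and the remaining part of \<open>g\<close> has small norm.\<close>

lemma bounded_l2norm_tendsto_zero:
  assumes \<phi>: "\<And>n. \<phi> n \<in> borel_measurable circle_measure"
    and bd: "\<And>n. AE z in circle_measure. cmod (\<phi> n z) \<le> C"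
    and lim: "((\<lambda>n. l2norm (\<phi> n)) \<longlongrightarrow> 0) F" and g: "g \<in> L2_circle"
  shows "((\<lambda>n. l2norm (\<lambda>z. \<phi> n z * g z)) \<longlongrightarrow> 0) F"
proof -
  note [measurable] = \<phi> L2_circle_measurable[OF g]
  define C' where "C' = max C 0"
  have bd': "AE z in circle_measure. cmod (\<phi> n z) \<le> C'" for n
    using bd[of n] by eventually_elim (simp add: C'_def)
  have C': "C' \<ge> 0" by (simp add: C'_def)
  \<comment> \<open>The factors \<open>\<phi> n\<close> are known to converge in mean square only,
    and along an arbitrary filter, so dominated convergence is not applied to the products; it
    serves for the tails \<open>gl R\<close>, which converge pointwise along a sequence.\<close>
  define gs where "gs R z = (if cmod (g z) \<le> real R then g z else 0)" for R z
  define gl where "gl R z = (if cmod (g z) \<le> real R then 0 else g z)" for R z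
  have [measurable]: "gs R \<in> borel_measurable circle_measure" "gl R \<in> borel_measurable circle_measure" for R
    unfolding gs_def gl_def by measurable
  have gsL: "gs R \<in> L2_circle" for R
    by (rule L2_circle_bounded[where C = "real R"]) (auto simp: gs_def)
  have glL: "gl R \<in> L2_circle" for R
    using L2_circle_diff[OF g gsL[of R]]
    by (rule back_subst[where P = "\<lambda>x. x \<in> L2_circle"]) (auto simp: gs_def gl_def)
  have gl0: "(\<lambda>R. l2norm (gl R)) \<longlonglongrightarrow> 0"
  proof -
    have "(\<lambda>R. LINT z|circle_measure. (cmod (gl R z))\<^sup>2) \<longlonglongrightarrow> (LINT z|circle_measure. 0 :: real)"
    proof (rule integral_dominated_convergence[where w = "\<lambda>z. (cmod (g z))\<^sup>2"])
      show "AE z in circle_measure. (\<lambda>R. (cmod (gl R z))\<^sup>2) \<longlonglongrightarrow> 0"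
      proof (rule AE_I2, rule tendsto_eventually)
        fix z
        obtain N where "cmod (g z) \<le> real N" using real_arch_simple by blast
        show "\<forall>\<^sub>F R in sequentially. (cmod (gl R z))\<^sup>2 = 0"
          using eventually_ge_at_top[of N]
          proof eventually_elim
            case (elim R)
            then have "real N \<le> real R" by simp
            with \<open>cmod (g z) \<le> real N\<close> have "cmod (g z) \<le> real R" by (rule order_trans)
            then show ?case by (simp add: gl_def)
          qed
      qed
    qed (auto simp: gl_def intro: L2_circle_integrable[OF g])
    then show ?thesis
      unfolding l2norm_def using tendsto_real_sqrt by fastforce
  qed
  show ?thesis
  proof (rule tendstoI)
    fix e :: real assume e: "e > 0"
    have "(\<lambda>R. C' * l2norm (gl R)) \<longlonglongrightarrow> C' * 0"
      by (intro tendsto_intros gl0)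
    then have "\<forall>\<^sub>F R in sequentially. C' * l2norm (gl R) < e / 2"
      using e by (intro order_tendstoD) auto
    then obtain R where R: "C' * l2norm (gl R) < e / 2"
      by (auto simp: eventually_sequentially)
    have "((\<lambda>n. real R * l2norm (\<phi> n)) \<longlongrightarrow> real R * 0) F"
      by (intro tendsto_intros lim)
    then have "\<forall>\<^sub>F n in F. real R * l2norm (\<phi> n) < e / 2"
      using e by (intro order_tendstoD) auto
    then show "\<forall>\<^sub>F n in F. dist (l2norm (\<lambda>z. \<phi> n z * g z)) 0 < e"
    proof eventually_elim
      case (elim n)
      have L: "\<phi> n \<in> L2_circle" by (rule L2_circle_bounded[OF \<phi> bd])
      have "l2norm (\<lambda>z. \<phi> n z * g z) = l2norm (\<lambda>z. gs R z * \<phi> n z + \<phi> n z * gl R z)"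
        by (rule arg_cong[where f = l2norm]) (auto simp: gs_def gl_def)
      also have "\<dots> \<le> l2norm (\<lambda>z. gs R z * \<phi> n z) + l2norm (\<lambda>z. \<phi> n z * gl R z)"
      proof (rule l2norm_triangle)
        show "(\<lambda>z. gs R z * \<phi> n z) \<in> L2_circle"
          by (rule L2_circle_mult_bounded[where C = "real R"]) (auto simp: gs_def L)
        show "(\<lambda>z. \<phi> n z * gl R z) \<in> L2_circle"
          by (rule L2_circle_mult_bounded[OF \<phi> bd glL])
      qed
      also have "l2norm (\<lambda>z. gs R z * \<phi> n z) \<le> real R * l2norm (\<phi> n)"
        by (rule l2norm_mult_bounded) (auto simp: gs_def L)
      also have "l2norm (\<lambda>z. \<phi> n z * gl R z) \<le> C' * l2norm (gl R)"
        by (rule l2norm_mult_bounded[OF \<phi> bd' glL C'])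
      finally show ?case using elim R by simp
    qed
  qed
qed

section \<open>Fourier series\<close>

text \<open>Brings the fundamental theorem of calculus to bear on the inner products of
  monomials.\<close>

lemma integral_circle_measure:
  fixes f :: "complex \<Rightarrow> complex"
  assumes [measurable]: "f \<in> borel_measurable borel"
  shows "(LINT z|circle_measure. f z)
    = (LINT t|lborel. indicator {0..2 * pi} t *\<^sub>R f (cis t)) / complex_of_real (2 * pi)"
proof -
  have "uniform_measure lborel {0..2 * pi}
      = density lborel (\<lambda>t. ennreal (indicator {0..2 * pi} t / (2 * pi)))"
    unfolding uniform_measure_def
    by (intro density_cong) (auto simp: indicator_def divide_ennreal simp flip: ennreal_1)
  moreover have "(LINT z|circle_measure. f z) = (LINT t|uniform_measure lborel {0..2 * pi}. f (cis t))"
    unfolding circle_measure_def by (rule integral_distr) auto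
  ultimately have "(LINT z|circle_measure. f z)
      = (LINT t|lborel. (indicator {0..2 * pi} t / (2 * pi)) *\<^sub>R f (cis t))"
    by (simp add: integral_density)
  also have "\<dots> = (LINT t|lborel. (indicator {0..2 * pi} t *\<^sub>R f (cis t)) / complex_of_real (2 * pi))"
    by (intro Bochner_Integration.integral_cong) (auto simp: scaleR_conv_of_real)
  finally show ?thesis by simp
qed

lemma L2_circle_power: "(\<lambda>z. z ^ n) \<in> L2_circle"
  by (rule L2_circle_bounded[where C = 1])
     (use AE_circle_norm in \<open>auto elim!: eventually_mono simp: norm_power\<close>)

lemma L2_circle_poly: "(\<lambda>z. \<Sum>n\<in>I. c n * z ^ n) \<in> L2_circle"
  by (intro L2_circle_sum L2_circle_scale L2_circle_power)

text \<open>For different exponents the antiderivative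
  \<open>cis (k * t) / (\<i> * of_real k)\<close> has equal values at both ends of the interval,
  since \<open>k\<close> is an integer.\<close>

lemma L2_inner_power_power:
  "L2_inner (\<lambda>z. z ^ m) (\<lambda>z. z ^ n) = (if m = n then 1 else 0)"
proof -
  define k where "k = real m - real n"
  have cis: "cis t ^ m * cnj (cis t ^ n) = cis (k * t)" for t
    by (simp only: complex_cnj_power cis_cnj Complex.DeMoivre cis_mult k_def left_diff_distrib) simp
  have "L2_inner (\<lambda>z. z ^ m) (\<lambda>z. z ^ n)
      = (LINT t|lborel. indicator {0..2 * pi} t *\<^sub>R cis (k * t)) / complex_of_real (2 * pi)"
    unfolding L2_inner_def by (subst integral_circle_measure) (simp_all only: cis, measurable)
  also have "\<dots> = (if m = n then 1 else 0)"
  proof (cases "m = n")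
    case True
    then show ?thesis by (simp add: k_def scaleR_conv_of_real)
  next
    case False
    then have k: "k \<noteq> 0" by (simp add: k_def)
    have "(LINT t|lborel. indicator {0..2 * pi} t *\<^sub>R cis (k * t))
        = cis (k * (2 * pi)) / (\<i> * of_real k) - cis (k * 0) / (\<i> * of_real k)"
    proof (rule integral_FTC_Icc)
      fix t assume "0 \<le> t" "t \<le> 2 * pi"
      have "((\<lambda>t. exp (\<i> * of_real k * of_real t)) has_vector_derivative
          \<i> * of_real k * exp (\<i> * of_real k * of_real t)) (at t within {0..2 * pi})"
        by (rule has_vector_derivative_real_field) (auto intro!: derivative_eq_intros)
      then have "((\<lambda>t. cis (k * t)) has_vector_derivative of_real k * (\<i> * cis (k * t))) (at t within {0..2 * pi})"
        by (simp add: cis_conv_exp mult_ac)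
      from has_vector_derivative_divide[OF this, of "\<i> * of_real k"]
      show "((\<lambda>t. cis (k * t) / (\<i> * of_real k)) has_vector_derivative cis (k * t)) (at t within {0..2 * pi})"
        using k by (simp add: field_simps)
    qed (auto intro!: continuous_intros)
    also have "cis (k * (2 * pi)) = 1"
      by (simp add: k_def left_diff_distrib cis_divide[symmetric] Complex.DeMoivre[symmetric])
    finally show ?thesis using False by simp
  qed
  finally show ?thesis .
qed

lemma L2_inner_sum_left:
  "finite I \<Longrightarrow> (\<And>i. i \<in> I \<Longrightarrow> f i \<in> L2_circle) \<Longrightarrow> g \<in> L2_circle \<Longrightarrow>
    L2_inner (\<lambda>z. \<Sum>i\<in>I. f i z) g = (\<Sum>i\<in>I. L2_inner (f i) g)"
proof (induction I rule: finite_induct)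
  case empty
  then show ?case by (simp add: L2_inner_def)
next
  case (insert i I)
  then show ?case by (simp add: L2_inner_add_left L2_circle_sum)
qed

lemma L2_inner_poly_left:
  "finite I \<Longrightarrow> g \<in> L2_circle \<Longrightarrow>
    L2_inner (\<lambda>z. \<Sum>n\<in>I. c n * z ^ n) g = (\<Sum>n\<in>I. c n * L2_inner (\<lambda>z. z ^ n) g)"
  by (simp add: L2_inner_sum_left L2_circle_scale L2_circle_power L2_inner_scale_left)

lemma L2_inner_poly_power:
  "finite I \<Longrightarrow> L2_inner (\<lambda>z. \<Sum>n\<in>I. c n * z ^ n) (\<lambda>z. z ^ m) = (if m \<in> I then c m else 0)"
  by (simp add: L2_inner_poly_left L2_circle_power L2_inner_power_power if_distrib sum.delta cong: if_cong)

lemma l2norm_poly: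
  assumes "finite I"
  shows "(l2norm (\<lambda>z. \<Sum>n\<in>I. c n * z ^ n))\<^sup>2 = (\<Sum>n\<in>I. (cmod (c n))\<^sup>2)"
proof -
  let ?p = "\<lambda>z. \<Sum>n\<in>I. c n * z ^ n"
  have c: "L2_inner (\<lambda>z. z ^ n) ?p = cnj (c n)" if "n \<in> I" for n
    using L2_inner_commute[of "\<lambda>z. z ^ n" ?p] L2_inner_poly_power[OF assms, of c n] that by simp
  have "complex_of_real ((l2norm ?p)\<^sup>2) = L2_inner ?p ?p"
    by (rule L2_inner_self[symmetric])
  also have "\<dots> = (\<Sum>n\<in>I. c n * cnj (c n))"
    unfolding L2_inner_poly_left[OF assms L2_circle_poly] by (intro sum.cong refl) (simp only: c)
  also have "\<dots> = complex_of_real (\<Sum>n\<in>I. (cmod (c n))\<^sup>2)"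
    by (simp only: of_real_sum complex_norm_square)
  finally show ?thesis by (simp only: of_real_eq_iff)
qed

section \<open>One-sided Fourier series\<close>

text \<open>Only nonnegative powers occur, so these are the expansions of boundary functions of
  Hardy functions. It is a relation because \<open>g\<close> is determined almost everywhere
  only.\<close>

definition fourier_sum :: "(nat \<Rightarrow> complex) \<Rightarrow> (complex \<Rightarrow> complex) \<Rightarrow> bool" where
  "fourier_sum c g \<longleftrightarrow> g \<in> L2_circle \<and> (\<lambda>N. l2norm (\<lambda>z. (\<Sum>n<N. c n * z ^ n) - g z)) \<longlonglongrightarrow> 0"

lemma fourier_sum_coeff:
  assumes "fourier_sum c g"
  shows "L2_inner g (\<lambda>z. z ^ m) = c m"
proof (rule LIMSEQ_unique)
  show "(\<lambda>N. L2_inner (\<lambda>z. \<Sum>n<N. c n * z ^ n) (\<lambda>z. z ^ m)) \<longlonglongrightarrow> L2_inner g (\<lambda>z. z ^ m)"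
    by (rule L2_inner_tendsto_left)
       (use assms in \<open>auto simp: fourier_sum_def L2_circle_poly L2_circle_power\<close>)
  have "\<forall>\<^sub>F N in sequentially. L2_inner (\<lambda>z. \<Sum>n<N. c n * z ^ n) (\<lambda>z. z ^ m) = c m"
    using eventually_gt_at_top[of m] by eventually_elim (simp add: L2_inner_poly_power)
  then show "(\<lambda>N. L2_inner (\<lambda>z. \<Sum>n<N. c n * z ^ n) (\<lambda>z. z ^ m)) \<longlonglongrightarrow> c m"
    by (rule tendsto_eventually)
qed

text \<open>Parseval's identity, the limit of \<open>l2norm_poly\<close>.\<close>

lemma fourier_sum_norm:
  assumes "fourier_sum c g"
  shows "(\<lambda>n. (cmod (c n))\<^sup>2) sums (l2norm g)\<^sup>2"
proof -
  have "(\<lambda>N. (l2norm (\<lambda>z. \<Sum>n<N. c n * z ^ n))\<^sup>2) \<longlonglongrightarrow> (l2norm g)\<^sup>2"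
    by (intro tendsto_power l2norm_tendsto)
       (use assms in \<open>auto simp: fourier_sum_def L2_circle_poly\<close>)
  then show ?thesis by (simp add: sums_def l2norm_poly)
qed

lemma fourier_sum_diff:
  assumes "fourier_sum c f" "fourier_sum d g"
  shows "fourier_sum (\<lambda>n. c n - d n) (\<lambda>z. f z - g z)"
  unfolding fourier_sum_def
proof
  have L: "f \<in> L2_circle" "g \<in> L2_circle"
    using assms by (auto simp: fourier_sum_def)
  then show "(\<lambda>z. f z - g z) \<in> L2_circle" by (rule L2_circle_diff)
  let ?l = "\<lambda>c f N. l2norm (\<lambda>z. (\<Sum>n<N. c n * z ^ n) - f z)"
  have "(\<lambda>N. ?l c f N + ?l d g N) \<longlonglongrightarrow> 0 + 0"
    using assms unfolding fourier_sum_def by (intro tendsto_add) auto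
  then have lim: "(\<lambda>N. ?l c f N + ?l d g N) \<longlonglongrightarrow> 0" by simp
  show "?l (\<lambda>n. c n - d n) (\<lambda>z. f z - g z) \<longlonglongrightarrow> 0"
  proof (rule Lim_null_comparison[OF _ lim], rule always_eventually, rule allI)
    fix N
    have "?l (\<lambda>n. c n - d n) (\<lambda>z. f z - g z) N
        = l2norm (\<lambda>z. ((\<Sum>n<N. c n * z ^ n) - f z) + - ((\<Sum>n<N. d n * z ^ n) - g z))"
      by (simp add: left_diff_distrib sum_subtractf algebra_simps)
    also have "\<dots> \<le> ?l c f N + l2norm (\<lambda>z. - ((\<Sum>n<N. d n * z ^ n) - g z))"
      by (intro l2norm_triangle L2_circle_diff L2_circle_uminus L2_circle_poly L)
    finally show "norm (?l (\<lambda>n. c n - d n) (\<lambda>z. f z - g z) N) \<le> ?l c f N + ?l d g N"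
      unfolding l2norm_minus by simp
  qed
qed

text \<open>The Riesz-Fischer theorem: the squared distance of two partial sums is a block of the
  convergent series of squared moduli, so completeness applies.\<close>

lemma fourier_sum_exists:
  assumes "summable (\<lambda>n. (cmod (c n))\<^sup>2)"
  obtains g where "fourier_sum c g"
proof -
  let ?s = "\<lambda>N z. \<Sum>n<N. c n * z ^ n"
  have dist: "(l2norm (\<lambda>z. ?s m z - ?s n z))\<^sup>2 = (\<Sum>k=n..<m. (cmod (c k))\<^sup>2)" if "n \<le> m" for m n
  proof -
    have "?s m z - ?s n z = (\<Sum>k=n..<m. c k * z ^ k)" for z
      using sum_diff_nat_ivl[of 0 n m "\<lambda>k. c k * z ^ k"] that by (simp add: lessThan_atLeast0)
    then show ?thesis by (simp add: l2norm_poly)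
  qed
  have "\<exists>N. \<forall>m\<ge>N. \<forall>n\<ge>N. l2norm (\<lambda>z. ?s m z - ?s n z) < e" if e: "e > 0" for e
  proof -
    have "e\<^sup>2 > 0" using e by simp
    then obtain N where N: "\<And>m n. m \<ge> N \<Longrightarrow> norm (\<Sum>k=m..<n. (cmod (c k))\<^sup>2) < e\<^sup>2"
      using assms unfolding summable_Cauchy by blast
    have "l2norm (\<lambda>z. ?s m z - ?s n z) < e" if "n \<ge> N" "n \<le> m" for m n
    proof (rule power2_less_imp_less)
      show "(l2norm (\<lambda>z. ?s m z - ?s n z))\<^sup>2 < e\<^sup>2"
        using N[of n m] that dist[of n m] by (simp add: sum_nonneg)
    qed (use e in simp)
    note less = this
    show ?thesis
    proof (intro exI allI impI)
      fix m n assume "N \<le> m" "N \<le> n"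
      then show "l2norm (\<lambda>z. ?s m z - ?s n z) < e"
        using less[of n m] less[of m n] l2norm_minus_commute[of "?s m" "?s n"] by (cases "n \<le> m") auto
    qed
  qed
  then obtain g where "g \<in> L2_circle" "(\<lambda>n. l2norm (\<lambda>z. ?s n z - g z)) \<longlonglongrightarrow> 0"
    using L2_circle_complete[of ?s, OF L2_circle_poly] by blast
  then show ?thesis using that by (auto simp: fourier_sum_def)
qed

text \<open>Pairing \<open>g\<close> with its own partial Fourier sum gives the sum \<open>S\<close>
  of squared moduli, while Cauchy-Schwarz bounds this pairing by the root of \<open>S\<close> times
  the norm of \<open>g\<close>.\<close>

lemma bessel:
  assumes g: "g \<in> L2_circle"
  shows "summable (\<lambda>n. (cmod (L2_inner g (\<lambda>z. z ^ n)))\<^sup>2)"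
    and "cmod (L2_inner g (\<lambda>z. z ^ n)) \<le> l2norm g"
proof -
  define c where "c n = L2_inner g (\<lambda>z. z ^ n)" for n
  have "(\<Sum>n<N. (cmod (c n))\<^sup>2) \<le> (l2norm g)\<^sup>2" for N
  proof -
    let ?p = "\<lambda>z. \<Sum>n<N. c n * z ^ n"
    define S where "S = (\<Sum>n<N. (cmod (c n))\<^sup>2)"
    have p: "l2norm ?p = sqrt S"
      using l2norm_poly[of "{..<N}" c] by (simp add: S_def real_sqrt_unique)
    have "L2_inner ?p g = (\<Sum>n<N. c n * cnj (c n))"
      by (simp add: L2_inner_poly_left g L2_inner_commute[of "\<lambda>z. z ^ _" g] c_def)
    also have "\<dots> = of_real S"
      by (simp only: of_real_sum complex_norm_square S_def)
    finally have "S \<le> sqrt S * l2norm g"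
      using L2_Cauchy_Schwarz[OF L2_circle_poly g, of c "{..<N}"] p by simp
    then have "sqrt S * sqrt S \<le> sqrt S * l2norm g"
      by (simp add: S_def sum_nonneg)
    then have "sqrt S \<le> l2norm g"
      using mult_le_cancel_left_pos[of "sqrt S" "sqrt S" "l2norm g"] sum_nonneg[of "{..<N}" "\<lambda>n. (cmod (c n))\<^sup>2"]
      by (cases "S = 0") (auto simp: S_def)
    then have "(sqrt S)\<^sup>2 \<le> (l2norm g)\<^sup>2"
      by (rule power_mono) (simp add: S_def sum_nonneg)
    then show ?thesis by (simp add: S_def sum_nonneg)
  qed
  then show "summable (\<lambda>n. (cmod (L2_inner g (\<lambda>z. z ^ n)))\<^sup>2)"
    by (intro summableI_nonneg_bounded[where x = "(l2norm g)\<^sup>2"]) (auto simp: c_def)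
  have "l2norm (\<lambda>z. z ^ n) = 1"
    using L2_inner_self[of "\<lambda>z. z ^ n"] power2_eq_1_iff[of "l2norm (\<lambda>z. z ^ n)"] l2norm_nonneg[of "\<lambda>z. z ^ n"]
    by (simp add: L2_inner_power_power del: l2norm_nonneg flip: of_real_power)
  then show "cmod (L2_inner g (\<lambda>z. z ^ n)) \<le> l2norm g"
    using L2_Cauchy_Schwarz[OF g L2_circle_power[of n]] by simp
qed

section \<open>Boundary functions\<close>

text \<open>Continuity on the open disk together with the convention that \<open>f\<close> vanishes
  off it suffices; nothing is known about continuity at the circle.\<close>

lemma disk_holomorphic_measurable [measurable_dest]:
  assumes "f \<in> disk_holomorphic"
  shows "f \<in> borel_measurable borel"
proof -
  have "(\<lambda>z. indicator (ball 0 1) z *\<^sub>R f z) \<in> borel_measurable borel"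
    using assms by (intro borel_measurable_continuous_on_indicator)
      (auto simp: disk_holomorphic_def intro: holomorphic_on_imp_continuous_on)
  also have "(\<lambda>z. indicator (ball 0 1) z *\<^sub>R f z) = f"
    using assms by (auto simp: disk_holomorphic_def indicator_def fun_eq_iff)
  finally show ?thesis .
qed

definition dilation :: "(complex \<Rightarrow> complex) \<Rightarrow> real \<Rightarrow> complex \<Rightarrow> complex" where
  "dilation f r = (\<lambda>z. f (of_real r * z))"

lemma dilation_measurable [measurable]:
  assumes "f \<in> disk_holomorphic"
  shows "dilation f r \<in> borel_measurable circle_measure"
proof -
  note [measurable] = disk_holomorphic_measurable[OF assms]
  show ?thesis unfolding dilation_def by measurable
qed

lemma circle_mean2_dilation: "circle_mean2 f r = (l2norm (dilation f r))\<^sup>2"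
  by (simp add: circle_mean2_def l2norm_power2 dilation_def)

text \<open>Holds for every real \<open>r\<close>, so limits along \<open>at_left 1\<close> carry no
  side condition on the radius: inside, \<open>f\<close> is bounded on a compact disk; otherwise
  almost every argument lies off the disk, where \<open>f\<close> vanishes by convention.\<close>

lemma dilation_L2:
  assumes f: "f \<in> disk_holomorphic"
  shows "dilation f r \<in> L2_circle"
proof -
  have "\<exists>C. AE z in circle_measure. cmod (dilation f r z) \<le> C"
  proof (cases "\<bar>r\<bar> < 1")
    case True
    then have "cball 0 \<bar>r\<bar> \<subseteq> ball (0::complex) 1" by auto
    then have "compact (f ` cball 0 \<bar>r\<bar>)"
      using f by (intro compact_continuous_image compact_cball)
        (auto simp: disk_holomorphic_def intro: holomorphic_on_imp_continuous_on continuous_on_subset)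
    then obtain C where "\<And>w. w \<in> cball 0 \<bar>r\<bar> \<Longrightarrow> cmod (f w) \<le> C"
      using compact_imp_bounded[of "f ` cball 0 \<bar>r\<bar>"] unfolding bounded_iff by (metis imageI)
    then have "AE z in circle_measure. cmod (dilation f r z) \<le> C"
      using AE_circle_norm by (auto elim!: eventually_mono simp: dilation_def norm_mult)
    then show ?thesis ..
  next
    case False
    then have "AE z in circle_measure. cmod (dilation f r z) \<le> 0"
      using AE_circle_norm f
      by (auto elim!: eventually_mono simp: dilation_def disk_holomorphic_def norm_mult)
    then show ?thesis ..
  qed
  then show ?thesis
    using L2_circle_bounded[OF dilation_measurable[OF f]] by blast
qed

text \<open>At radius \<open>r\<close> the power series converges absolutely, so the partial sums
  and the limit are bounded by the sum \<open>A\<close> of the moduli, and dominated convergence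
  applies. The coefficients are left arbitrary so that \<open>taylor_unique\<close> can use the
  lemma too.\<close>

lemma fourier_sum_dilation:
  assumes f: "f \<in> disk_holomorphic" and pow: "\<And>w. w \<in> ball 0 1 \<Longrightarrow> (\<lambda>n. c n * w ^ n) sums f w"
    and r: "0 \<le> r" "r < 1"
  shows "fourier_sum (\<lambda>n. c n * of_real r ^ n) (dilation f r)"
  unfolding fourier_sum_def
proof
  show "dilation f r \<in> L2_circle" by (rule dilation_L2[OF f])
  note [measurable] = dilation_measurable[OF f]
  define A where "A = (\<Sum>n. cmod (c n) * r ^ n)"
  have abs: "summable (\<lambda>n. cmod (c n) * r ^ n)"
  proof -
    \<comment> \<open>Convergence at the larger radius \<open>s\<close> gives absolute convergence
      at \<open>r\<close>.\<close>
    obtain s where s: "r < s" "s < 1" using r dense by blast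
    have "summable (\<lambda>n. c n * of_real s ^ n)"
      using pow[of "of_real s"] s r by (auto intro: sums_summable)
    then have "summable (\<lambda>n. norm (c n * complex_of_real r ^ n))"
      by (rule powser_insidea) (use s r in auto)
    then show ?thesis using r by (simp add: norm_mult norm_power)
  qed
  have "(\<lambda>N. LINT z|circle_measure. (cmod ((\<Sum>n<N. c n * of_real r ^ n * z ^ n) - dilation f r z))\<^sup>2)
      \<longlonglongrightarrow> (LINT z|circle_measure. (0 :: real))"
  proof (rule integral_dominated_convergence[where w = "\<lambda>_. (2 * A)\<^sup>2"])
    show "AE z in circle_measure. (\<lambda>N. (cmod ((\<Sum>n<N. c n * of_real r ^ n * z ^ n) - dilation f r z))\<^sup>2) \<longlonglongrightarrow> 0"
      using AE_circle_norm
    proof eventually_elim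
      case (elim z)
      have "(\<lambda>n. c n * (of_real r * z) ^ n) sums dilation f r z"
        unfolding dilation_def by (rule pow) (use elim r in \<open>simp add: norm_mult\<close>)
      then have "(\<lambda>N. \<Sum>n<N. c n * of_real r ^ n * z ^ n) \<longlonglongrightarrow> dilation f r z"
        by (simp add: sums_def power_mult_distrib mult.assoc)
      then show ?case
        by (intro tendsto_eq_intros | simp)+
    qed
    show "AE z in circle_measure. norm ((cmod ((\<Sum>n<N. c n * of_real r ^ n * z ^ n) - dilation f r z))\<^sup>2) \<le> (2 * A)\<^sup>2" for N
      using AE_circle_norm
    proof eventually_elim
      case (elim z)
      have s: "(\<lambda>n. c n * of_real r ^ n * z ^ n) sums dilation f r z"
        using pow[of "of_real r * z"] elim r
        by (simp add: dilation_def norm_mult power_mult_distrib mult.assoc)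
      have nrm: "norm (c n * of_real r ^ n * z ^ n) = cmod (c n) * r ^ n" for n
        using elim r by (simp add: norm_mult norm_power)
      have "cmod (dilation f r z) \<le> A"
        unfolding A_def sums_unique[OF s] nrm[symmetric]
        by (rule summable_norm) (unfold nrm, rule abs)
      moreover have "cmod (\<Sum>n<N. c n * of_real r ^ n * z ^ n) \<le> (\<Sum>n<N. cmod (c n) * r ^ n)"
        unfolding nrm[symmetric] by (rule norm_sum)
      moreover have "(\<Sum>n<N. cmod (c n) * r ^ n) \<le> A"
        unfolding A_def by (rule sum_le_suminf[OF abs]) (use r in auto)
      ultimately have "cmod ((\<Sum>n<N. c n * of_real r ^ n * z ^ n) - dilation f r z) \<le> 2 * A"
        using norm_triangle_ineq4[of "\<Sum>n<N. c n * of_real r ^ n * z ^ n" "dilation f r z"] by linarith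
      from power_mono[OF this, of 2] show ?case by simp
    qed
  qed measurable
  from tendsto_real_sqrt[OF this]
  show "(\<lambda>N. l2norm (\<lambda>z. (\<Sum>n<N. c n * of_real r ^ n * z ^ n) - dilation f r z)) \<longlonglongrightarrow> 0"
    by (simp add: l2norm_def)
qed

section \<open>Taylor coefficients and means over circles\<close>

definition taylor :: "(complex \<Rightarrow> complex) \<Rightarrow> nat \<Rightarrow> complex" where
  "taylor f n = (deriv ^^ n) f 0 / fact n"

lemma taylor_sums:
  "f \<in> disk_holomorphic \<Longrightarrow> w \<in> ball 0 1 \<Longrightarrow> (\<lambda>n. taylor f n * w ^ n) sums f w"
  using holomorphic_power_series[of f 0 1 w] by (simp add: taylor_def disk_holomorphic_def)

lemma fourier_sum_taylor:
  "f \<in> disk_holomorphic \<Longrightarrow> 0 \<le> r \<Longrightarrow> r < 1 \<Longrightarrow>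
    fourier_sum (\<lambda>n. taylor f n * of_real r ^ n) (dilation f r)"
  by (rule fourier_sum_dilation) (auto intro: taylor_sums)

text \<open>Both sequences are read off as Fourier coefficients of one dilation; the radius 1/2 is
  an arbitrary choice between 0 and 1.\<close>

lemma taylor_unique:
  assumes "f \<in> disk_holomorphic" "\<And>w. w \<in> ball 0 1 \<Longrightarrow> (\<lambda>n. c n * w ^ n) sums f w"
  shows "taylor f = c"
proof
  fix n
  have "taylor f n * of_real (1 / 2) ^ n = c n * of_real (1 / 2) ^ n"
    using fourier_sum_coeff[OF fourier_sum_taylor[OF assms(1)], of "1/2" n]
      fourier_sum_coeff[OF fourier_sum_dilation[OF assms], of "1/2" n] by simp
  then show "taylor f n = c n" by simp
qed

lemma circle_mean2_sums:
  assumes "f \<in> disk_holomorphic" "0 \<le> r" "r < 1"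
  shows "(\<lambda>n. (cmod (taylor f n))\<^sup>2 * (r ^ n)\<^sup>2) sums circle_mean2 f r"
  using fourier_sum_norm[OF fourier_sum_taylor[OF assms]] assms(2)
  by (simp add: circle_mean2_dilation norm_mult norm_power power_mult_distrib)

lemma H2_disk_holomorphic: "f \<in> H2 \<Longrightarrow> f \<in> disk_holomorphic"
  by (simp add: H2_def)

text \<open>The mean at radius \<open>r\<close> is the sum of the squared moduli weighted by powers
  of \<open>r\<close>. Letting \<open>r\<close> tend to 1 in a partial sum gives one inclusion;
  weights at most 1 give the other.\<close>

lemma H2_eq_summable: "H2 = {f \<in> disk_holomorphic. summable (\<lambda>n. (cmod (taylor f n))\<^sup>2)}"
proof (intro set_eqI iffI)
  fix f assume "f \<in> H2"
  then have f: "f \<in> disk_holomorphic" and "bdd_above (circle_mean2 f ` {0..<1})"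
    by (auto simp: H2_def)
  then obtain M where M: "\<And>r. 0 \<le> r \<Longrightarrow> r < 1 \<Longrightarrow> circle_mean2 f r \<le> M"
    unfolding bdd_above_def by (metis atLeastLessThan_iff imageI)
  have "(\<Sum>n<N. (cmod (taylor f n))\<^sup>2) \<le> M" for N
  proof (rule tendsto_upperbound)
    have "((\<lambda>r. \<Sum>n<N. (cmod (taylor f n))\<^sup>2 * (r ^ n)\<^sup>2) \<longlongrightarrow> (\<Sum>n<N. (cmod (taylor f n))\<^sup>2 * (1 ^ n)\<^sup>2)) (at_left (1::real))"
      by (intro tendsto_intros)
    then show "((\<lambda>r. \<Sum>n<N. (cmod (taylor f n))\<^sup>2 * (r ^ n)\<^sup>2) \<longlongrightarrow> (\<Sum>n<N. (cmod (taylor f n))\<^sup>2)) (at_left (1::real))"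
      by simp
    show "\<forall>\<^sub>F r in at_left (1::real). (\<Sum>n<N. (cmod (taylor f n))\<^sup>2 * (r ^ n)\<^sup>2) \<le> M"
    proof (rule eventually_at_leftI[of 0])
      fix r :: real assume "r \<in> {0<..<1}"
      then have s: "(\<lambda>n. (cmod (taylor f n))\<^sup>2 * (r ^ n)\<^sup>2) sums circle_mean2 f r" "0 \<le> r" "r < 1"
        using circle_mean2_sums[OF f] by auto
      have "(\<Sum>n<N. (cmod (taylor f n))\<^sup>2 * (r ^ n)\<^sup>2) \<le> circle_mean2 f r"
        using sum_le_suminf[OF sums_summable[OF s(1)], of "{..<N}"] sums_unique[OF s(1)] by simp
      with M[OF s(2,3)] show "(\<Sum>n<N. (cmod (taylor f n))\<^sup>2 * (r ^ n)\<^sup>2) \<le> M" by linarith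
    qed simp
  qed simp
  then have "summable (\<lambda>n. (cmod (taylor f n))\<^sup>2)"
    by (intro summableI_nonneg_bounded) auto
  with f show "f \<in> {f \<in> disk_holomorphic. summable (\<lambda>n. (cmod (taylor f n))\<^sup>2)}" by simp
next
  fix f assume "f \<in> {f \<in> disk_holomorphic. summable (\<lambda>n. (cmod (taylor f n))\<^sup>2)}"
  then have f: "f \<in> disk_holomorphic" and s: "summable (\<lambda>n. (cmod (taylor f n))\<^sup>2)" by auto
  have "circle_mean2 f r \<le> (\<Sum>n. (cmod (taylor f n))\<^sup>2)" if "0 \<le> r" "r < 1" for r
  proof (rule sums_le[OF _ circle_mean2_sums[OF f that] summable_sums[OF s]])
    fix n show "(cmod (taylor f n))\<^sup>2 * (r ^ n)\<^sup>2 \<le> (cmod (taylor f n))\<^sup>2"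
      using that by (intro mult_left_le) (auto simp: power_le_one)
  qed
  then show "f \<in> H2"
    using f by (auto simp: H2_def intro!: bdd_aboveI)
qed

text \<open>By Parseval the squared distance is a series in \<open>n\<close> whose terms
  \<open>a n r\<close> tend to 0 and are dominated by the squared moduli of the Taylor coefficients,
  so limit and sum may be exchanged.\<close>

lemma dilation_tendsto_fourier_sum:
  assumes f: "f \<in> disk_holomorphic" and g: "fourier_sum (taylor f) g"
  shows "((\<lambda>r. l2norm (\<lambda>z. dilation f r z - g z)) \<longlongrightarrow> 0) (at_left 1)"
proof -
  define a where "a n r = (cmod (taylor f n))\<^sup>2 * (r ^ n - 1)\<^sup>2" for n and r :: real
  have bound: "\<forall>\<^sub>F (n, r) in at_top \<times>\<^sub>F at_left 1. norm (a n r) \<le> (cmod (taylor f n))\<^sup>2"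
  proof -
    have "\<forall>\<^sub>F r in at_left (1::real). 0 \<le> r \<and> r \<le> 1"
      by (rule eventually_at_leftI[of 0]) auto
    then have "\<forall>\<^sub>F x in at_top \<times>\<^sub>F at_left 1. True \<and> (0 \<le> snd x \<and> snd x \<le> (1::real))"
      by (intro eventually_prodI[where P = "\<lambda>_. True"]) auto
    then show ?thesis
    proof eventually_elim
      case (elim x)
      obtain n r where x: "x = (n, r)" by force
      have "(1 - r ^ n)\<^sup>2 \<le> 1\<^sup>2"
        using elim by (intro power_mono) (auto simp: x power_le_one)
      then have "(r ^ n - 1)\<^sup>2 \<le> 1"
        by (simp add: power2_commute)
      then show ?case
        by (simp add: x a_def mult_left_le)
    qed
  qed
  have lim: "((\<lambda>r. a n r) \<longlongrightarrow> 0) (at_left 1)" for n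
  proof -
    have "((\<lambda>r. a n r) \<longlongrightarrow> (cmod (taylor f n))\<^sup>2 * (1 ^ n - 1)\<^sup>2) (at_left 1)"
      unfolding a_def by (intro tendsto_intros)
    then show ?thesis by simp
  qed
  have "((\<lambda>r. \<Sum>n. a n r) \<longlongrightarrow> (\<Sum>n. 0)) (at_left 1)"
    using tannerys_theorem[OF lim bound sums_summable[OF fourier_sum_norm[OF g]]] by simp
  moreover have "\<forall>\<^sub>F r in at_left 1. (\<Sum>n. a n r) = (l2norm (\<lambda>z. dilation f r z - g z))\<^sup>2"
  proof (rule eventually_at_leftI[of 0])
    fix r :: real assume "r \<in> {0<..<1}"
    then have r: "0 \<le> r" "r < 1" by auto
    have "(\<lambda>n. (cmod (taylor f n * of_real r ^ n - taylor f n))\<^sup>2) sums (l2norm (\<lambda>z. dilation f r z - g z))\<^sup>2"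
      by (rule fourier_sum_norm[OF fourier_sum_diff[OF fourier_sum_taylor[OF f r] g]])
    moreover have "(cmod (taylor f n * of_real r ^ n - taylor f n))\<^sup>2 = a n r" for n
    proof -
      have "taylor f n * of_real r ^ n - taylor f n = taylor f n * of_real (r ^ n - 1)"
        by (simp add: algebra_simps)
      then show ?thesis
        by (simp only: norm_mult norm_of_real power_mult_distrib power2_abs a_def)
    qed
    ultimately show "(\<Sum>n. a n r) = (l2norm (\<lambda>z. dilation f r z - g z))\<^sup>2"
      by (simp add: sums_iff)
  qed simp
  ultimately have "((\<lambda>r. (l2norm (\<lambda>z. dilation f r z - g z))\<^sup>2) \<longlongrightarrow> 0) (at_left 1)"
    by (simp add: tendsto_cong)
  from tendsto_real_sqrt[OF this] show ?thesis by simp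
qed

section \<open>Existence and uniqueness of boundary functions\<close>

text \<open>The choice in \<open>boundary\<close> has a witness: the function whose Fourier
  coefficients are the Taylor coefficients of \<open>f\<close>.\<close>

lemma boundary_L2_tendsto:
  assumes f: "f \<in> H2"
  shows boundary_L2: "boundary f \<in> L2_circle"
    and boundary_tendsto: "((\<lambda>r. l2norm (\<lambda>z. dilation f r z - boundary f z)) \<longlongrightarrow> 0) (at_left 1)"
proof -
  have iff: "((\<lambda>r. LINT z|circle_measure. (cmod (f (of_real r * z) - g z))\<^sup>2) \<longlongrightarrow> 0) (at_left 1)
      \<longleftrightarrow> ((\<lambda>r. l2norm (\<lambda>z. dilation f r z - g z)) \<longlongrightarrow> 0) (at_left 1)" for g
    using tendsto_real_sqrt[of "\<lambda>r. LINT z|circle_measure. (cmod (f (of_real r * z) - g z))\<^sup>2" 0 "at_left 1"]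
      tendsto_power[of "\<lambda>r. l2norm (\<lambda>z. dilation f r z - g z)" 0 "at_left 1" 2]
    by (auto simp: l2norm_power2 dilation_def l2norm_def)
  obtain g where "fourier_sum (taylor f) g"
    using fourier_sum_exists f by (auto simp: H2_eq_summable)
  then have "g \<in> L2_circle \<and> ((\<lambda>r. l2norm (\<lambda>z. dilation f r z - g z)) \<longlongrightarrow> 0) (at_left 1)"
    using dilation_tendsto_fourier_sum[OF H2_disk_holomorphic[OF f]] by (auto simp: fourier_sum_def)
  then have "boundary f \<in> L2_circle \<and> ((\<lambda>r. l2norm (\<lambda>z. dilation f r z - boundary f z)) \<longlongrightarrow> 0) (at_left 1)"
    unfolding boundary_def iff by (rule someI[where P = "\<lambda>g. g \<in> L2_circle \<and> ((\<lambda>r. l2norm (\<lambda>z. dilation f r z - g z)) \<longlongrightarrow> 0) (at_left 1)"])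
  then show "boundary f \<in> L2_circle" "((\<lambda>r. l2norm (\<lambda>z. dilation f r z - boundary f z)) \<longlongrightarrow> 0) (at_left 1)"
    by auto
qed

text \<open>The means of computing boundary functions of sums, multiples and products: it suffices
  to exhibit the mean-square limit of the dilations.\<close>

lemma boundary_unique:
  assumes "f \<in> H2" "g \<in> L2_circle" "((\<lambda>r. l2norm (\<lambda>z. dilation f r z - g z)) \<longlongrightarrow> 0) (at_left 1)"
  shows "AE z in circle_measure. boundary f z = g z"
  by (rule l2norm_limit_unique[where f = "dilation f" and F = "at_left 1"])
     (simp_all add: assms dilation_L2 H2_disk_holomorphic boundary_L2 boundary_tendsto)

lemma fourier_sum_boundary:
  assumes f: "f \<in> H2"
  shows "fourier_sum (taylor f) (boundary f)"
proof -
  obtain g where g: "fourier_sum (taylor f) g"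
    using fourier_sum_exists f by (auto simp: H2_eq_summable)
  then have gL: "g \<in> L2_circle" by (simp add: fourier_sum_def)
  note [measurable] = L2_circle_measurable[OF gL] L2_circle_measurable[OF boundary_L2[OF f]]
    L2_circle_measurable[OF L2_circle_poly]
  have ae: "AE z in circle_measure. boundary f z = g z"
    by (rule boundary_unique[OF f gL dilation_tendsto_fourier_sum[OF H2_disk_holomorphic[OF f] g]])
  have "l2norm (\<lambda>z. (\<Sum>n<N. taylor f n * z ^ n) - boundary f z)
      = l2norm (\<lambda>z. (\<Sum>n<N. taylor f n * z ^ n) - g z)" for N
    by (rule l2norm_cong) (use ae in \<open>auto elim!: eventually_mono\<close>)
  then show ?thesis
    using g boundary_L2[OF f] by (simp add: fourier_sum_def)
qed

lemma circle_mean2_le_boundary: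
  assumes f: "f \<in> H2" and r: "0 \<le> r" "r < 1"
  shows "circle_mean2 f r \<le> (l2norm (boundary f))\<^sup>2"
proof (rule sums_le[OF _ circle_mean2_sums[OF H2_disk_holomorphic[OF f] r]
      fourier_sum_norm[OF fourier_sum_boundary[OF f]]])
  fix n show "(cmod (taylor f n))\<^sup>2 * (r ^ n)\<^sup>2 \<le> (cmod (taylor f n))\<^sup>2"
    using r by (intro mult_left_le) (auto simp: power_le_one)
qed

text \<open>The means are bounded by the boundary norm and tend to it as \<open>r\<close> tends to
  1. This links the norm, defined inside the disk, to the inner product, defined on the
  circle.\<close>

lemma H2_norm_boundary:
  assumes f: "f \<in> H2"
  shows "H2_norm f = l2norm (boundary f)"
proof -
  have "(SUP r\<in>{0..<1}. circle_mean2 f r) = (l2norm (boundary f))\<^sup>2"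
  proof (rule antisym)
    show "(SUP r\<in>{0..<1}. circle_mean2 f r) \<le> (l2norm (boundary f))\<^sup>2"
      by (rule cSUP_least) (auto intro: circle_mean2_le_boundary[OF f])
    have "((\<lambda>r. circle_mean2 f r) \<longlongrightarrow> (l2norm (boundary f))\<^sup>2) (at_left 1)"
      unfolding circle_mean2_dilation
      by (intro tendsto_power l2norm_tendsto dilation_L2 H2_disk_holomorphic boundary_L2 boundary_tendsto f)
    then show "(l2norm (boundary f))\<^sup>2 \<le> (SUP r\<in>{0..<1}. circle_mean2 f r)"
    proof (rule tendsto_upperbound)
      show "\<forall>\<^sub>F r in at_left 1. circle_mean2 f r \<le> (SUP r\<in>{0..<1}. circle_mean2 f r)"
        using f by (intro eventually_at_leftI[of 0] cSUP_upper) (auto simp: H2_def)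
    qed simp
  qed
  then show ?thesis by (simp add: H2_norm_def)
qed

lemma l2norm_boundary_eq_0:
  assumes f: "f \<in> H2" and "l2norm (boundary f) = 0"
  shows "f = (\<lambda>_. 0)"
proof
  fix w
  have "(\<lambda>n. (cmod (taylor f n))\<^sup>2) sums 0"
    using fourier_sum_norm[OF fourier_sum_boundary[OF f]] assms(2) by simp
  then have "\<forall>n. (cmod (taylor f n))\<^sup>2 = 0"
    by (subst suminf_eq_zero_iff[symmetric]) (auto simp: sums_iff)
  then have "taylor f = (\<lambda>_. 0)"
    by (simp add: fun_eq_iff)
  then have "f w = 0" if "w \<in> ball 0 1"
    using taylor_sums[OF H2_disk_holomorphic[OF f] that] by (simp add: sums_iff)
  then show "f w = 0"
    using H2_disk_holomorphic[OF f] by (auto simp: disk_holomorphic_def)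
qed

section \<open>The Hilbert space structure of the Hardy space\<close>

lemma boundary_measurable [measurable]: "f \<in> H2 \<Longrightarrow> boundary f \<in> borel_measurable circle_measure"
  by (rule L2_circle_measurable[OF boundary_L2])

lemma H2_I:
  assumes "f \<in> disk_holomorphic" "\<And>r. 0 \<le> r \<Longrightarrow> r < 1 \<Longrightarrow> l2norm (dilation f r) \<le> M"
  shows "f \<in> H2"
proof -
  have "circle_mean2 f r \<le> M\<^sup>2" if "0 \<le> r" "r < 1" for r
    unfolding circle_mean2_dilation using assms(2)[OF that] by (intro power_mono) auto
  then show ?thesis
    using assms(1) by (auto simp: H2_def intro!: bdd_aboveI)
qed

lemma l2norm_dilation_le:
  assumes "f \<in> H2" "0 \<le> r" "r < 1"
  shows "l2norm (dilation f r) \<le> l2norm (boundary f)"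
  using circle_mean2_le_boundary[OF assms] by (simp add: circle_mean2_dilation power2_le_iff_abs_le)

lemma H2_scale:
  assumes f: "f \<in> H2"
  shows "(\<lambda>z. c * f z) \<in> H2"
proof (rule H2_I)
  show "(\<lambda>z. c * f z) \<in> disk_holomorphic"
    using H2_disk_holomorphic[OF f] by (auto simp: disk_holomorphic_def intro!: holomorphic_intros)
  fix r :: real assume "0 \<le> r" "r < 1"
  have "dilation (\<lambda>z. c * f z) r = (\<lambda>z. c * dilation f r z)"
    by (simp add: dilation_def)
  then show "l2norm (dilation (\<lambda>z. c * f z) r) \<le> cmod c * l2norm (boundary f)"
    using l2norm_dilation_le[OF f \<open>0 \<le> r\<close> \<open>r < 1\<close>] by (simp add: l2norm_scale mult_left_mono)
qed

lemma H2_add: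
  assumes f: "f \<in> H2" and g: "g \<in> H2"
  shows "(\<lambda>z. f z + g z) \<in> H2"
proof (rule H2_I)
  show "(\<lambda>z. f z + g z) \<in> disk_holomorphic"
    using H2_disk_holomorphic[OF f] H2_disk_holomorphic[OF g]
    by (auto simp: disk_holomorphic_def intro!: holomorphic_intros)
  fix r :: real assume r: "0 \<le> r" "r < 1"
  have "l2norm (dilation (\<lambda>z. f z + g z) r) = l2norm (\<lambda>z. dilation f r z + dilation g r z)"
    by (simp add: dilation_def)
  also have "\<dots> \<le> l2norm (dilation f r) + l2norm (dilation g r)"
    by (intro l2norm_triangle dilation_L2 H2_disk_holomorphic f g)
  also have "\<dots> \<le> l2norm (boundary f) + l2norm (boundary g)"
    by (intro add_mono l2norm_dilation_le f g r)
  finally show "l2norm (dilation (\<lambda>z. f z + g z) r) \<le> l2norm (boundary f) + l2norm (boundary g)" .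
qed

lemma H2_uminus: "f \<in> H2 \<Longrightarrow> (\<lambda>z. - f z) \<in> H2"
  using H2_scale[of f "-1"] by simp

lemma H2_diff: "f \<in> H2 \<Longrightarrow> g \<in> H2 \<Longrightarrow> (\<lambda>z. f z - g z) \<in> H2"
  using H2_add[OF _ H2_uminus, of f g] by simp

lemma H2_zero: "(\<lambda>_. 0) \<in> H2"
  by (rule H2_I[where M = 0]) (auto simp: disk_holomorphic_def dilation_def l2norm_def)

lemma boundary_add:
  assumes f: "f \<in> H2" and g: "g \<in> H2"
  shows "AE z in circle_measure. boundary (\<lambda>z. f z + g z) z = boundary f z + boundary g z"
proof (rule boundary_unique[OF H2_add[OF f g] L2_circle_add[OF boundary_L2 boundary_L2, OF f g]])
  have "((\<lambda>r. l2norm (\<lambda>z. dilation f r z - boundary f z) + l2norm (\<lambda>z. dilation g r z - boundary g z)) \<longlongrightarrow> 0 + 0) (at_left 1)"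
    by (intro tendsto_add boundary_tendsto f g)
  then have lim: "((\<lambda>r. l2norm (\<lambda>z. dilation f r z - boundary f z) + l2norm (\<lambda>z. dilation g r z - boundary g z)) \<longlongrightarrow> 0) (at_left 1)"
    by simp
  show "((\<lambda>r. l2norm (\<lambda>z. dilation (\<lambda>z. f z + g z) r z - (boundary f z + boundary g z))) \<longlongrightarrow> 0) (at_left 1)"
  proof (rule Lim_null_comparison[OF _ lim], rule always_eventually, rule allI)
    fix r
    have "l2norm (\<lambda>z. dilation (\<lambda>z. f z + g z) r z - (boundary f z + boundary g z))
        = l2norm (\<lambda>z. (dilation f r z - boundary f z) + (dilation g r z - boundary g z))"
      by (simp add: dilation_def algebra_simps)
    also have "\<dots> \<le> l2norm (\<lambda>z. dilation f r z - boundary f z) + l2norm (\<lambda>z. dilation g r z - boundary g z)"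
      by (intro l2norm_triangle L2_circle_diff dilation_L2 H2_disk_holomorphic boundary_L2 f g)
    finally show "norm (l2norm (\<lambda>z. dilation (\<lambda>z. f z + g z) r z - (boundary f z + boundary g z)))
        \<le> l2norm (\<lambda>z. dilation f r z - boundary f z) + l2norm (\<lambda>z. dilation g r z - boundary g z)"
      by simp
  qed
qed

lemma boundary_scale:
  assumes f: "f \<in> H2"
  shows "AE z in circle_measure. boundary (\<lambda>z. c * f z) z = c * boundary f z"
proof (rule boundary_unique[OF H2_scale[OF f] L2_circle_scale[OF boundary_L2[OF f]]])
  have "(\<lambda>r. l2norm (\<lambda>z. dilation (\<lambda>z. c * f z) r z - c * boundary f z))
      = (\<lambda>r. cmod c * l2norm (\<lambda>z. dilation f r z - boundary f z))"
    by (simp add: dilation_def right_diff_distrib[symmetric] l2norm_scale)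
  moreover have "((\<lambda>r. cmod c * l2norm (\<lambda>z. dilation f r z - boundary f z)) \<longlongrightarrow> 0) (at_left 1)"
    by (intro tendsto_mult_right_zero boundary_tendsto f)
  ultimately show "((\<lambda>r. l2norm (\<lambda>z. dilation (\<lambda>z. c * f z) r z - c * boundary f z)) \<longlongrightarrow> 0) (at_left 1)"
    by simp
qed

lemma boundary_diff:
  assumes f: "f \<in> H2" and g: "g \<in> H2"
  shows "AE z in circle_measure. boundary (\<lambda>z. f z - g z) z = boundary f z - boundary g z"
  using boundary_add[OF f H2_uminus[OF g]] boundary_scale[OF g, of "-1"]
  by eventually_elim simp

lemma H2_inner_add_left:
  assumes "f \<in> H2" "g \<in> H2" "k \<in> H2"
  shows "H2_inner (\<lambda>z. f z + g z) k = H2_inner f k + H2_inner g k"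
proof -
  note [measurable] = boundary_measurable[OF assms(1)] boundary_measurable[OF assms(2)]
    boundary_measurable[OF assms(3)] boundary_measurable[OF H2_add[OF assms(1,2)]]
  have "H2_inner (\<lambda>z. f z + g z) k = L2_inner (\<lambda>z. boundary f z + boundary g z) (boundary k)"
    unfolding H2_inner_def by (rule L2_inner_cong) (use boundary_add[OF assms(1,2)] in auto)
  then show ?thesis
    by (simp add: H2_inner_def L2_inner_add_left boundary_L2 assms)
qed

lemma H2_inner_scale_left:
  assumes "f \<in> H2" "k \<in> H2"
  shows "H2_inner (\<lambda>z. c * f z) k = c * H2_inner f k"
proof -
  note [measurable] = boundary_measurable[OF assms(1)] boundary_measurable[OF assms(2)]
    boundary_measurable[OF H2_scale[OF assms(1)]]
  have "H2_inner (\<lambda>z. c * f z) k = L2_inner (\<lambda>z. c * boundary f z) (boundary k)"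
    unfolding H2_inner_def by (rule L2_inner_cong) (use boundary_scale[OF assms(1)] in auto)
  then show ?thesis by (simp add: H2_inner_def L2_inner_scale_left)
qed

lemma H2_inner_commute: "H2_inner g f = cnj (H2_inner f g)"
  unfolding H2_inner_def by (rule L2_inner_commute)

lemma H2_inner_diff_left:
  "f \<in> H2 \<Longrightarrow> g \<in> H2 \<Longrightarrow> k \<in> H2 \<Longrightarrow> H2_inner (\<lambda>z. f z - g z) k = H2_inner f k - H2_inner g k"
  using H2_inner_add_left[OF _ H2_uminus, of f g k] H2_inner_scale_left[of g k "-1"] by simp

lemma H2_inner_add_right:
  assumes "f \<in> H2" "g \<in> H2" "k \<in> H2"
  shows "H2_inner k (\<lambda>z. f z + g z) = H2_inner k f + H2_inner k g"
  using H2_inner_add_left[OF assms] H2_inner_commute[of k] by (metis complex_cnj_add)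

lemma H2_inner_scale_right:
  assumes "f \<in> H2" "k \<in> H2"
  shows "H2_inner k (\<lambda>z. c * f z) = cnj c * H2_inner k f"
  using H2_inner_scale_left[OF assms] H2_inner_commute[of k] by (metis complex_cnj_mult)

lemma H2_inner_diff_right:
  assumes "f \<in> H2" "g \<in> H2" "k \<in> H2"
  shows "H2_inner k (\<lambda>z. f z - g z) = H2_inner k f - H2_inner k g"
  using H2_inner_diff_left[OF assms] H2_inner_commute[of k] by (metis complex_cnj_diff)

lemma H2_inner_self: "f \<in> H2 \<Longrightarrow> H2_inner f f = complex_of_real ((H2_norm f)\<^sup>2)"
  by (simp only: H2_inner_def L2_inner_self H2_norm_boundary)

lemma H2_norm_eq_0: "f \<in> H2 \<Longrightarrow> H2_norm f = 0 \<Longrightarrow> f = (\<lambda>_. 0)"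
  by (simp add: H2_norm_boundary l2norm_boundary_eq_0)

lemma H2_norm_diff:
  assumes "f \<in> H2" "g \<in> H2"
  shows "H2_norm (\<lambda>z. f z - g z) = l2norm (\<lambda>z. boundary f z - boundary g z)"
proof -
  note [measurable] = boundary_measurable[OF assms(1)] boundary_measurable[OF assms(2)]
    boundary_measurable[OF H2_diff[OF assms]]
  show ?thesis
    unfolding H2_norm_boundary[OF H2_diff[OF assms]]
    by (rule l2norm_cong) (use boundary_diff[OF assms] in auto)
qed

lemma H2_norm_nonneg: "f \<in> H2 \<Longrightarrow> 0 \<le> H2_norm f"
  by (simp add: H2_norm_boundary)

lemma H2_Cauchy_Schwarz: "f \<in> H2 \<Longrightarrow> g \<in> H2 \<Longrightarrow> cmod (H2_inner f g) \<le> H2_norm f * H2_norm g"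
  unfolding H2_inner_def by (simp add: H2_norm_boundary L2_Cauchy_Schwarz boundary_L2)

lemma H2_inner_zero_right: "k \<in> H2 \<Longrightarrow> H2_inner k (\<lambda>_. 0) = 0"
  using H2_inner_scale_right[OF H2_zero, of k 0] by simp

lemma H2_norm_scale: "f \<in> H2 \<Longrightarrow> H2_norm (\<lambda>z. c * f z) = cmod c * H2_norm f"
proof -
  assume f: "f \<in> H2"
  have "(H2_norm (\<lambda>z. c * f z))\<^sup>2 = (cmod c * H2_norm f)\<^sup>2"
  proof -
    have "complex_of_real ((H2_norm (\<lambda>z. c * f z))\<^sup>2) = c * cnj c * complex_of_real ((H2_norm f)\<^sup>2)"
      unfolding H2_inner_self[OF H2_scale[OF f], symmetric] H2_inner_self[OF f, symmetric]
      by (simp add: H2_inner_scale_left H2_inner_scale_right H2_scale f)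
    also have "\<dots> = complex_of_real ((cmod c * H2_norm f)\<^sup>2)"
      by (simp only: complex_norm_square[symmetric] power_mult_distrib of_real_mult)
    finally show ?thesis by (simp only: of_real_eq_iff)
  qed
  then show "H2_norm (\<lambda>z. c * f z) = cmod c * H2_norm f"
    by (rule power2_eq_imp_eq) (simp_all add: H2_norm_nonneg H2_scale f)
qed

lemma H2_norm_power2_diff:
  assumes "f \<in> H2" "g \<in> H2"
  shows "(H2_norm (\<lambda>z. f z - g z))\<^sup>2 = (H2_norm f)\<^sup>2 - 2 * Re (H2_inner f g) + (H2_norm g)\<^sup>2"
proof -
  have "complex_of_real ((H2_norm (\<lambda>z. f z - g z))\<^sup>2)
      = H2_inner f f - H2_inner f g - (H2_inner g f - H2_inner g g)"
    unfolding H2_inner_self[OF H2_diff[OF assms], symmetric]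
    by (simp add: H2_inner_diff_left H2_inner_diff_right H2_diff assms)
  then have "Re (complex_of_real ((H2_norm (\<lambda>z. f z - g z))\<^sup>2))
      = Re (H2_inner f f - H2_inner f g - (H2_inner g f - H2_inner g g))" by simp
  then show ?thesis
    unfolding H2_inner_self[OF assms(1)] H2_inner_self[OF assms(2)] H2_inner_commute[of g f]
    by simp
qed

text \<open>Identities between Toeplitz operators are obtained in this way, since their values are
  known through inner products.\<close>

lemma H2_eqI:
  assumes "f \<in> H2" "g \<in> H2" "\<And>k. k \<in> H2 \<Longrightarrow> H2_inner f k = H2_inner g k"
  shows "f = g"
proof -
  let ?d = "\<lambda>z. f z - g z"
  have d: "?d \<in> H2" by (rule H2_diff[OF assms(1,2)])
  have "H2_inner ?d ?d = 0"
    using H2_inner_diff_left[OF assms(1,2) d] assms(3)[OF d] by simp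
  then have "?d = (\<lambda>_. 0)"
    using H2_inner_self[OF d] by (intro H2_norm_eq_0[OF d]) simp
  then show ?thesis by (simp add: fun_eq_iff)
qed

section \<open>The Riesz projection and completeness of the Hardy space\<close>

text \<open>Square-summable coefficients are bounded, so a geometric series dominates the power
  series at each point of the disk.\<close>

lemma H2_exists_taylor:
  assumes "summable (\<lambda>n. (cmod (c n))\<^sup>2)"
  obtains f where "f \<in> H2" "taylor f = c"
proof
  define f where "f w = (if w \<in> ball 0 1 then \<Sum>n. c n * w ^ n else 0)" for w
  have "(\<lambda>n. (cmod (c n))\<^sup>2) \<longlonglongrightarrow> 0"
    by (rule summable_LIMSEQ_zero[OF assms])
  then have "Bseq (\<lambda>n. (cmod (c n))\<^sup>2)"
    by (intro convergent_imp_Bseq convergentI)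
  then obtain B where B: "\<And>n. (cmod (c n))\<^sup>2 \<le> B"
    by (auto simp: Bseq_def)
  have c: "cmod (c n) \<le> sqrt B" for n
    using real_sqrt_le_mono[OF B[of n]] by simp
  have pow: "(\<lambda>n. c n * w ^ n) sums f w" if w: "w \<in> ball 0 1" for w
  proof -
    have "summable (\<lambda>n. c n * w ^ n)"
    proof (rule summable_comparison_test')
      show "summable (\<lambda>n. sqrt B * cmod w ^ n)"
        using w by (intro summable_mult summable_geometric) simp
      show "norm (c n * w ^ n) \<le> sqrt B * cmod w ^ n" if "n \<ge> 0" for n
        by (simp add: norm_mult norm_power mult_right_mono c)
    qed
    then show ?thesis using w by (simp add: f_def summable_sums)
  qed
  have disk: "f \<in> disk_holomorphic"
    unfolding disk_holomorphic_def
    using power_series_holomorphic[of 0 1 c f] pow by (auto simp: f_def)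
  show t: "taylor f = c" by (rule taylor_unique[OF disk pow])
  show "f \<in> H2" using disk assms by (simp add: H2_eq_summable t)
qed

text \<open>The projection keeps the Fourier coefficients of nonnegative index, which are
  square-summable by Bessel. The remainder is orthogonal to all monomials, hence to their
  mean-square limits.\<close>

lemma riesz_proj_exists:
  assumes g: "g \<in> L2_circle"
  shows "\<exists>f\<in>H2. \<forall>k\<in>H2. L2_inner (\<lambda>z. g z - boundary f z) (boundary k) = 0"
proof -
  obtain f where f: "f \<in> H2" "taylor f = (\<lambda>n. L2_inner g (\<lambda>z. z ^ n))"
    by (rule H2_exists_taylor[OF bessel(1)[OF g]])
  let ?d = "\<lambda>z. g z - boundary f z"
  have d: "?d \<in> L2_circle" by (intro L2_circle_diff g boundary_L2 f)
  have z: "L2_inner (\<lambda>z. z ^ n) ?d = 0" for n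
  proof -
    have "L2_inner ?d (\<lambda>z. z ^ n) = 0"
      using fourier_sum_coeff[OF fourier_sum_boundary[OF f(1)], of n]
      by (simp add: L2_inner_diff_left g boundary_L2 f L2_circle_power)
    then show ?thesis using L2_inner_commute[of "\<lambda>z. z ^ n" ?d] by simp
  qed
  have "L2_inner ?d (boundary k) = 0" if k: "k \<in> H2" for k
  proof -
    have "(\<lambda>N. L2_inner (\<lambda>z. \<Sum>n<N. taylor k n * z ^ n) ?d) \<longlonglongrightarrow> L2_inner (boundary k) ?d"
      by (rule L2_inner_tendsto_left)
         (use fourier_sum_boundary[OF k] d in \<open>auto simp: fourier_sum_def L2_circle_poly\<close>)
    then have "L2_inner (boundary k) ?d = 0"
      by (simp add: L2_inner_poly_left d z LIMSEQ_const_iff)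
    then show ?thesis using L2_inner_commute[of ?d "boundary k"] by simp
  qed
  with f show ?thesis by blast
qed

lemma riesz_proj:
  assumes g: "g \<in> L2_circle"
  shows riesz_proj_H2: "riesz_proj g \<in> H2"
    and riesz_proj_inner: "k \<in> H2 \<Longrightarrow> H2_inner (riesz_proj g) k = L2_inner g (boundary k)"
proof -
  have inner: "H2_inner f k = L2_inner g (boundary k)"
    if "f \<in> H2" "\<forall>k\<in>H2. L2_inner (\<lambda>z. g z - boundary f z) (boundary k) = 0" "k \<in> H2" for f k
    using that by (simp add: L2_inner_diff_left g boundary_L2 H2_inner_def)
  have "\<exists>!f. f \<in> H2 \<and> (\<forall>k\<in>H2. L2_inner (\<lambda>z. g z - boundary f z) (boundary k) = 0)"
  proof (rule ex_ex1I)
    show "\<exists>f. f \<in> H2 \<and> (\<forall>k\<in>H2. L2_inner (\<lambda>z. g z - boundary f z) (boundary k) = 0)"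
      using riesz_proj_exists[OF g] by blast
    fix f f'
    assume a: "f \<in> H2 \<and> (\<forall>k\<in>H2. L2_inner (\<lambda>z. g z - boundary f z) (boundary k) = 0)"
      "f' \<in> H2 \<and> (\<forall>k\<in>H2. L2_inner (\<lambda>z. g z - boundary f' z) (boundary k) = 0)"
    show "f = f'"
      by (rule H2_eqI) (use a inner[of f] inner[of f'] in auto)
  qed
  from theI'[OF this, folded riesz_proj_def]
  show "riesz_proj g \<in> H2" "k \<in> H2 \<Longrightarrow> H2_inner (riesz_proj g) k = L2_inner g (boundary k)"
    using inner[of "riesz_proj g" k] by auto
qed

text \<open>The projection fixes \<open>f\<close> and is a contraction; both facts are contained in
  pairing the difference with itself.\<close>

lemma riesz_proj_dist:
  assumes f: "f \<in> H2" and g: "g \<in> L2_circle"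
  shows "H2_norm (\<lambda>z. f z - riesz_proj g z) \<le> l2norm (\<lambda>z. boundary f z - g z)"
proof -
  let ?d = "\<lambda>z. f z - riesz_proj g z"
  have d: "?d \<in> H2" by (intro H2_diff f riesz_proj_H2 g)
  have "complex_of_real ((H2_norm ?d)\<^sup>2) = H2_inner f ?d - H2_inner (riesz_proj g) ?d"
    unfolding H2_inner_self[OF d, symmetric] by (rule H2_inner_diff_left[OF f riesz_proj_H2[OF g] d])
  also have "\<dots> = L2_inner (\<lambda>z. boundary f z - g z) (boundary ?d)"
    by (simp add: riesz_proj_inner[OF g d] L2_inner_diff_left boundary_L2 f g d) (simp add: H2_inner_def)
  finally have "(H2_norm ?d)\<^sup>2 = cmod (L2_inner (\<lambda>z. boundary f z - g z) (boundary ?d))"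
    by (metis abs_of_nonneg norm_of_real zero_le_power2)
  also have "\<dots> \<le> l2norm (\<lambda>z. boundary f z - g z) * H2_norm ?d"
    unfolding H2_norm_boundary[OF d] by (intro L2_Cauchy_Schwarz L2_circle_diff boundary_L2 f g d)
  finally have "H2_norm ?d * H2_norm ?d \<le> l2norm (\<lambda>z. boundary f z - g z) * H2_norm ?d"
    by (simp add: power2_eq_square)
  moreover have "H2_norm ?d \<ge> 0" by (simp add: H2_norm_boundary d)
  ultimately show ?thesis
    by (cases "H2_norm ?d = 0") (auto simp: mult_le_cancel_right)
qed

text \<open>The boundary functions have a limit \<open>u\<close> on the circle. By
  \<open>riesz_proj_dist\<close> its projection is no farther from each \<open>f n\<close> than
  \<open>u\<close> is, so it is the limit in the Hardy space.\<close>

lemma H2_complete: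
  fixes f :: "nat \<Rightarrow> complex \<Rightarrow> complex"
  assumes f: "\<And>n. f n \<in> H2"
    and cauchy: "\<And>e. e > 0 \<Longrightarrow> \<exists>N. \<forall>m\<ge>N. \<forall>n\<ge>N. H2_norm (\<lambda>z. f m z - f n z) < e"
  obtains g where "g \<in> H2" "(\<lambda>n. H2_norm (\<lambda>z. f n z - g z)) \<longlonglongrightarrow> 0"
proof -
  have B: "boundary (f n) \<in> L2_circle" for n by (rule boundary_L2[OF f])
  obtain u where u: "u \<in> L2_circle" "(\<lambda>n. l2norm (\<lambda>z. boundary (f n) z - u z)) \<longlonglongrightarrow> 0"
    using L2_circle_complete[of "\<lambda>n. boundary (f n)", OF B] cauchy by (auto simp: H2_norm_diff f)
  have "(\<lambda>n. H2_norm (\<lambda>z. f n z - riesz_proj u z)) \<longlonglongrightarrow> 0"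
    by (rule Lim_null_comparison[OF _ u(2)])
       (use riesz_proj_dist[OF f u(1)] in \<open>auto simp: H2_norm_boundary H2_diff f riesz_proj_H2 u\<close>)
  then show ?thesis using that riesz_proj_H2[OF u(1)] by blast
qed

section \<open>Toeplitz operators\<close>

lemma Hinf_disk_holomorphic: "h \<in> Hinf \<Longrightarrow> h \<in> disk_holomorphic"
  by (simp add: Hinf_def)

section \<open>Bounded holomorphic functions as multipliers\<close>

text \<open>Valid on the whole plane because \<open>h\<close> vanishes off the disk; estimates of
  dilations then need no restriction on the radius.\<close>

lemma Hinf_norm_bound:
  assumes h: "h \<in> Hinf"
  shows "cmod (h z) \<le> Hinf_norm h"
proof -
  obtain B where B: "\<And>z. z \<in> ball 0 1 \<Longrightarrow> cmod (h z) \<le> B"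
    using h unfolding Hinf_def bounded_iff by blast
  have le: "cmod (h z) \<le> Hinf_norm h" if "z \<in> ball 0 1" for z
    unfolding Hinf_norm_def by (rule cSUP_upper[OF that bdd_aboveI2[OF B]])
  have "0 \<le> Hinf_norm h"
    using le[of 0] norm_ge_zero[of "h 0"] by (simp del: norm_ge_zero)
  with le h show ?thesis
    by (cases "z \<in> ball 0 1") (auto simp: Hinf_def disk_holomorphic_def)
qed

lemma Hinf_H2:
  assumes h: "h \<in> Hinf"
  shows "h \<in> H2"
proof (rule H2_I[OF Hinf_disk_holomorphic[OF h]])
  have nn: "0 \<le> Hinf_norm h"
    using Hinf_norm_bound[OF h, of 0] norm_ge_zero order_trans by blast
  have "l2norm (\<lambda>_. complex_of_real (Hinf_norm h)) = Hinf_norm h"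
    using nn by (simp add: l2norm_def)
  then show "l2norm (dilation h r) \<le> Hinf_norm h" for r
    using l2norm_mono[OF dilation_measurable[OF Hinf_disk_holomorphic[OF h]] L2_circle_const,
        of r "complex_of_real (Hinf_norm h)"] nn Hinf_norm_bound[OF h]
    by (simp add: dilation_def)
qed

text \<open>The dilations are bounded by \<open>C\<close>, so \<open>max 0 (\<bar>boundary h\<bar> - C)\<close> is dominated by their distance
  to the boundary function, which tends to zero.\<close>

lemma boundary_Hinf_bound:
  assumes h: "h \<in> Hinf" and C: "Hinf_norm h \<le> C"
  shows "AE z in circle_measure. cmod (boundary h z) \<le> C"
proof -
  note hH = Hinf_H2[OF h] and hd = Hinf_disk_holomorphic[OF h]
  note [measurable] = boundary_measurable[OF hH]
  define e where "e z = complex_of_real (max 0 (cmod (boundary h z) - C))" for z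
  have [measurable]: "e \<in> borel_measurable circle_measure" unfolding e_def by measurable
  have le: "cmod (e z) \<le> cmod (dilation h r z - boundary h z)" for r z
    using Hinf_norm_bound[OF h, of "of_real r * z"] C norm_triangle_ineq2[of "boundary h z" "dilation h r z"]
    by (simp add: e_def dilation_def norm_minus_commute max_def)
  have dL: "(\<lambda>z. dilation h r z - boundary h z) \<in> L2_circle" for r
    by (intro L2_circle_diff dilation_L2 boundary_L2 hH hd)
  have eL: "e \<in> L2_circle"
  proof (rule L2_circle_I)
    show "integrable circle_measure (\<lambda>z. (cmod (e z))\<^sup>2)"
      by (rule Bochner_Integration.integrable_bound[OF L2_circle_integrable[OF dL[of 0]]])
         (use le in \<open>auto intro!: power_mono\<close>)
  qed measurable
  have "l2norm e \<le> 0"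
    using boundary_tendsto[OF hH]
  proof (rule tendsto_lowerbound)
    show "\<forall>\<^sub>F r in at_left 1. l2norm e \<le> l2norm (\<lambda>z. dilation h r z - boundary h z)"
      by (intro always_eventually allI l2norm_mono dL) (use le in auto)
  qed simp
  then have "l2norm e = 0" using l2norm_nonneg[of e] by linarith
  then have "AE z in circle_measure. e z = 0" by (simp add: l2norm_eq_0_iff[OF eL])
  then show ?thesis by eventually_elim (simp add: e_def)
qed

lemma H2_mult_Hinf:
  assumes h: "h \<in> Hinf" and f: "f \<in> H2"
  shows "(\<lambda>z. h z * f z) \<in> H2"
proof (rule H2_I)
  show "(\<lambda>z. h z * f z) \<in> disk_holomorphic"
    using Hinf_disk_holomorphic[OF h] H2_disk_holomorphic[OF f]
    by (auto simp: disk_holomorphic_def intro!: holomorphic_intros)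
  have nn: "0 \<le> Hinf_norm h"
    using Hinf_norm_bound[OF h, of 0] norm_ge_zero order_trans by blast
  fix r :: real assume r: "0 \<le> r" "r < 1"
  have "l2norm (dilation (\<lambda>z. h z * f z) r) = l2norm (\<lambda>z. dilation h r z * dilation f r z)"
    by (simp add: dilation_def)
  also have "\<dots> \<le> Hinf_norm h * l2norm (dilation f r)"
    using Hinf_norm_bound[OF h] nn
    by (intro l2norm_mult_bounded dilation_measurable dilation_L2 Hinf_disk_holomorphic
        H2_disk_holomorphic h f) (auto simp: dilation_def)
  also have "\<dots> \<le> Hinf_norm h * l2norm (boundary f)"
    by (intro mult_left_mono l2norm_dilation_le f r nn)
  finally show "l2norm (dilation (\<lambda>z. h z * f z) r) \<le> Hinf_norm h * l2norm (boundary f)" .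
qed

lemma boundary_mult_L2:
  assumes h: "h \<in> Hinf" and g: "g \<in> L2_circle"
  shows "(\<lambda>z. boundary h z * g z) \<in> L2_circle" "(\<lambda>z. cnj (boundary h z) * g z) \<in> L2_circle"
proof -
  note [measurable] = boundary_measurable[OF Hinf_H2[OF h]]
  show "(\<lambda>z. boundary h z * g z) \<in> L2_circle" "(\<lambda>z. cnj (boundary h z) * g z) \<in> L2_circle"
    using boundary_Hinf_bound[OF h order_refl]
    by (auto intro!: L2_circle_mult_bounded[OF _ _ g, where C = "Hinf_norm h"])
qed

text \<open>With dilations marked by a subscript \<open>r\<close>, the difference splits as h_r (f_r
  - f) + (h_r - h) f. The first part is controlled by the sup norm of \<open>h\<close>; in the
  second, h_r - h is bounded and small in mean square only, which is the situation of
  \<open>bounded_l2norm_tendsto_zero\<close>.\<close>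

lemma boundary_mult:
  assumes h: "h \<in> Hinf" and f: "f \<in> H2"
  shows "AE z in circle_measure. boundary (\<lambda>z. h z * f z) z = boundary h z * boundary f z"
proof (rule boundary_unique[OF H2_mult_Hinf[OF h f] boundary_mult_L2(1)[OF h boundary_L2[OF f]]])
  note hd = Hinf_disk_holomorphic[OF h] and fd = H2_disk_holomorphic[OF f]
  note fL = boundary_L2[OF f] and hL = boundary_L2[OF Hinf_H2[OF h]]
  note [measurable] = L2_circle_measurable[OF hL] L2_circle_measurable[OF fL]
    dilation_measurable[OF hd] dilation_measurable[OF fd]
  define C where "C = Hinf_norm h"
  have C: "0 \<le> C"
    using Hinf_norm_bound[OF h, of 0] norm_ge_zero order_trans unfolding C_def by blast
  have hr: "AE z in circle_measure. cmod (dilation h r z) \<le> C" for r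
    using Hinf_norm_bound[OF h] by (simp add: dilation_def C_def)
  have "((\<lambda>r. l2norm (\<lambda>z. (dilation h r z - boundary h z) * boundary f z)) \<longlongrightarrow> 0) (at_left 1)"
  proof (rule bounded_l2norm_tendsto_zero[OF _ _ boundary_tendsto[OF Hinf_H2[OF h]] fL])
    show "AE z in circle_measure. cmod (dilation h r z - boundary h z) \<le> C + C" for r
      using boundary_Hinf_bound[OF h order_refl] hr[of r]
      by eventually_elim (rule order_trans[OF norm_triangle_ineq4 add_mono], auto simp: C_def)
  qed measurable
  moreover have "((\<lambda>r. C * l2norm (\<lambda>z. dilation f r z - boundary f z)) \<longlongrightarrow> 0) (at_left 1)"
    by (intro tendsto_mult_right_zero boundary_tendsto f)
  ultimately have lim: "((\<lambda>r. C * l2norm (\<lambda>z. dilation f r z - boundary f z)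
      + l2norm (\<lambda>z. (dilation h r z - boundary h z) * boundary f z)) \<longlongrightarrow> 0) (at_left 1)"
    using tendsto_add_zero by blast
  show "((\<lambda>r. l2norm (\<lambda>z. dilation (\<lambda>z. h z * f z) r z - boundary h z * boundary f z)) \<longlongrightarrow> 0) (at_left 1)"
  proof (rule Lim_null_comparison[OF _ lim], rule always_eventually, rule allI)
    fix r
    have dL: "(\<lambda>z. dilation f r z - boundary f z) \<in> L2_circle"
      by (intro L2_circle_diff dilation_L2 fd fL)
    have 1: "(\<lambda>z. dilation h r z * (dilation f r z - boundary f z)) \<in> L2_circle"
      by (rule L2_circle_mult_bounded[OF _ hr dL]) measurable
    have 2: "(\<lambda>z. (dilation h r z - boundary h z) * boundary f z) \<in> L2_circle"
      using L2_circle_diff[OF L2_circle_mult_bounded[OF _ hr fL] boundary_mult_L2(1)[OF h fL], of r]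
      by (simp add: left_diff_distrib)
    have "l2norm (\<lambda>z. dilation (\<lambda>z. h z * f z) r z - boundary h z * boundary f z)
        = l2norm (\<lambda>z. dilation h r z * (dilation f r z - boundary f z)
            + (dilation h r z - boundary h z) * boundary f z)"
      by (simp add: dilation_def algebra_simps)
    also have "\<dots> \<le> l2norm (\<lambda>z. dilation h r z * (dilation f r z - boundary f z))
        + l2norm (\<lambda>z. (dilation h r z - boundary h z) * boundary f z)"
      by (rule l2norm_triangle[OF 1 2])
    also have "l2norm (\<lambda>z. dilation h r z * (dilation f r z - boundary f z))
        \<le> C * l2norm (\<lambda>z. dilation f r z - boundary f z)"
      by (rule l2norm_mult_bounded[OF _ hr dL C]) measurable
    finally show "norm (l2norm (\<lambda>z. dilation (\<lambda>z. h z * f z) r z - boundary h z * boundary f z))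
        \<le> C * l2norm (\<lambda>z. dilation f r z - boundary f z)
          + l2norm (\<lambda>z. (dilation h r z - boundary h z) * boundary f z)" by simp
  qed
qed

lemma L2_inner_boundary_mult_right:
  assumes h: "h \<in> Hinf" and f: "f \<in> H2" and u: "u \<in> L2_circle"
  shows "L2_inner u (boundary (\<lambda>z. h z * f z)) = L2_inner u (\<lambda>z. boundary h z * boundary f z)"
proof -
  note [measurable] = boundary_measurable[OF Hinf_H2[OF h]] boundary_measurable[OF f]
    L2_circle_measurable[OF u] boundary_measurable[OF H2_mult_Hinf[OF h f]]
  show ?thesis
    by (rule L2_inner_cong) (use boundary_mult[OF h f] in auto)
qed

section \<open>Analytic and coanalytic symbols\<close>

lemma coanalytic_toeplitz_H2: "h \<in> Hinf \<Longrightarrow> f \<in> H2 \<Longrightarrow> coanalytic_toeplitz h f \<in> H2"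
  unfolding toeplitz_def by (intro riesz_proj_H2 boundary_mult_L2 boundary_L2)

lemma coanalytic_toeplitz_inner:
  assumes h: "h \<in> Hinf" and f: "f \<in> H2" and k: "k \<in> H2"
  shows "H2_inner (coanalytic_toeplitz h f) k = H2_inner f (\<lambda>z. h z * k z)"
proof -
  have "H2_inner (coanalytic_toeplitz h f) k = L2_inner (\<lambda>z. cnj (boundary h z) * boundary f z) (boundary k)"
    unfolding toeplitz_def by (intro riesz_proj_inner boundary_mult_L2 boundary_L2 assms)
  also have "\<dots> = L2_inner (boundary f) (\<lambda>z. boundary h z * boundary k z)"
    by (simp add: L2_inner_mult_left)
  finally show ?thesis
    by (simp add: H2_inner_def L2_inner_boundary_mult_right h k boundary_L2 f)
qed

text \<open>The product already lies in \<open>H2\<close>, so the projection leaves it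
  alone.\<close>

lemma analytic_toeplitz_eq:
  assumes h: "h \<in> Hinf" and f: "f \<in> H2"
  shows "analytic_toeplitz h f = (\<lambda>z. h z * f z)"
proof (rule H2_eqI)
  have L: "(\<lambda>z. boundary h z * boundary f z) \<in> L2_circle"
    by (intro boundary_mult_L2 boundary_L2 h f)
  show "analytic_toeplitz h f \<in> H2"
    unfolding toeplitz_def by (rule riesz_proj_H2[OF L])
  show "(\<lambda>z. h z * f z) \<in> H2" by (rule H2_mult_Hinf[OF h f])
  fix k assume k: "k \<in> H2"
  have "H2_inner (analytic_toeplitz h f) k = L2_inner (\<lambda>z. boundary h z * boundary f z) (boundary k)"
    unfolding toeplitz_def by (rule riesz_proj_inner[OF L k])
  also have "\<dots> = L2_inner (boundary (\<lambda>z. h z * f z)) (boundary k)"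
    using L2_inner_boundary_mult_right[OF h f boundary_L2[OF k]]
      L2_inner_commute[of _ "boundary k"] by simp
  finally show "H2_inner (analytic_toeplitz h f) k = H2_inner (\<lambda>z. h z * f z) k"
    by (simp add: H2_inner_def)
qed

lemma coanalytic_toeplitz_add:
  assumes h: "h \<in> Hinf" and f: "f \<in> H2" and g: "g \<in> H2"
  shows "coanalytic_toeplitz h (\<lambda>z. f z + g z) = (\<lambda>z. coanalytic_toeplitz h f z + coanalytic_toeplitz h g z)"
  by (rule H2_eqI)
     (simp_all add: coanalytic_toeplitz_H2 coanalytic_toeplitz_inner H2_add h f g H2_inner_add_left H2_mult_Hinf)

lemma coanalytic_toeplitz_scale:
  assumes h: "h \<in> Hinf" and f: "f \<in> H2"
  shows "coanalytic_toeplitz h (\<lambda>z. c * f z) = (\<lambda>z. c * coanalytic_toeplitz h f z)"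
  by (rule H2_eqI)
     (simp_all add: coanalytic_toeplitz_H2 coanalytic_toeplitz_inner H2_scale h f H2_inner_scale_left H2_mult_Hinf)

lemma coanalytic_toeplitz_dist:
  assumes h: "h \<in> Hinf" and f: "f \<in> H2"
  shows "H2_norm (\<lambda>z. coanalytic_toeplitz h f z - f z) \<le> l2norm (\<lambda>z. (cnj (boundary h z) - 1) * boundary f z)"
proof -
  have L: "(\<lambda>z. cnj (boundary h z) * boundary f z) \<in> L2_circle"
    by (intro boundary_mult_L2 boundary_L2 h f)
  have "H2_norm (\<lambda>z. coanalytic_toeplitz h f z - f z) = H2_norm (\<lambda>z. f z - coanalytic_toeplitz h f z)"
    by (simp add: H2_norm_diff coanalytic_toeplitz_H2 h f l2norm_minus_commute[of "boundary f"])
  also have "\<dots> \<le> l2norm (\<lambda>z. boundary f z - cnj (boundary h z) * boundary f z)"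
    unfolding toeplitz_def by (rule riesz_proj_dist[OF f L])
  also have "\<dots> = l2norm (\<lambda>z. (cnj (boundary h z) - 1) * boundary f z)"
    by (subst l2norm_minus_commute) (simp add: left_diff_distrib)
  finally show ?thesis .
qed

text \<open>The inner product of the boundary function with 1 is the zeroth Taylor coefficient, that
  is, the value at the origin; expanding the square and using that the norm is at most 1 turns
  convergence at one point into mean-square convergence.\<close>

lemma boundary_Hinf_tendsto_one:
  assumes h: "\<And>n. h n \<in> Hinf" "\<And>n. Hinf_norm (h n) \<le> 1" and lim: "((\<lambda>n. h n 0) \<longlongrightarrow> 1) F"
  shows "((\<lambda>n. l2norm (\<lambda>z. boundary (h n) z - 1)) \<longlongrightarrow> 0) F"
proof -
  note hL = boundary_L2[OF Hinf_H2[OF h(1)]]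
  have one: "l2norm (\<lambda>_. 1) = 1" by (simp add: l2norm_def)
  have le: "(l2norm (\<lambda>z. boundary (h n) z - 1))\<^sup>2 \<le> 2 - 2 * Re (h n 0)" for n
  proof -
    have "taylor (h n) 0 = h n 0" by (simp add: taylor_def)
    then have "L2_inner (boundary (h n)) (\<lambda>_. 1) = h n 0"
      using fourier_sum_coeff[OF fourier_sum_boundary[OF Hinf_H2[OF h(1)]], of n 0] by simp
    moreover have "L2_inner (boundary (h n)) (\<lambda>_. -1) = - L2_inner (boundary (h n)) (\<lambda>_. 1)"
      by (simp add: L2_inner_def)
    moreover have "l2norm (boundary (h n)) \<le> 1"
      using l2norm_mono[OF L2_circle_measurable[OF hL] L2_circle_const[of 1]]
        boundary_Hinf_bound[OF h] one by simp
    then have "(l2norm (boundary (h n)))\<^sup>2 \<le> 1" by (simp add: power_le_one)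
    moreover have "l2norm (\<lambda>_. -1) = 1" by (simp add: l2norm_def)
    ultimately show ?thesis
      using l2norm_add_power2[OF hL L2_circle_const[of "-1"], of n] by simp
  qed
  have "((\<lambda>n. sqrt (2 - 2 * Re (h n 0))) \<longlongrightarrow> sqrt (2 - 2 * Re 1)) F"
    by (intro tendsto_intros lim)
  then have lim0: "((\<lambda>n. sqrt (2 - 2 * Re (h n 0))) \<longlongrightarrow> 0) F" by simp
  show ?thesis
    by (rule Lim_null_comparison[OF _ lim0]) (simp add: real_le_rsqrt[OF le])
qed

section \<open>Two facts about operators on a Hilbert space\<close>

text \<open>The Taylor coefficients of sqrt (1 - x) at 0.\<close>

definition sqrt_coeff :: "nat \<Rightarrow> real" where
  "sqrt_coeff n = ((1 / 2) gchoose n) * (- 1) ^ n"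

lemma sqrt_coeff_0 [simp]: "sqrt_coeff 0 = 1"
  by (simp add: sqrt_coeff_def)

text \<open>Apart from a negative factor these are rising factorials of 1/2, whose factors are
  positive.\<close>

lemma sqrt_coeff_Suc_nonpos: "sqrt_coeff (Suc n) \<le> 0"
proof -
  have "sqrt_coeff (Suc n) = - (1 / 2) * pochhammer (1 / 2) n / fact (Suc n)"
    by (simp add: sqrt_coeff_def gbinomial_pochhammer pochhammer_rec power_mult_distrib[symmetric] del: power_Suc fact_Suc)
  then show ?thesis
    using pochhammer_pos[of "1 / 2 :: real" n] by (simp del: fact_Suc)
qed

text \<open>Summing coefficients amounts to dividing the series by 1 - x, so the partial sums are
  the coefficients of (1 - x)^(-1/2), which are positive.\<close>

lemma sqrt_coeff_sum_nonneg: "0 \<le> (\<Sum>k\<le>n. sqrt_coeff k)"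
proof -
  have "(\<Sum>k\<le>n. sqrt_coeff k) = (- 1) ^ n * ((- 1 / 2) gchoose n)"
    unfolding sqrt_coeff_def using gbinomial_sum_lower_neg[of "1 / 2 :: real" n] by simp
  also have "\<dots> = pochhammer (1 / 2) n / fact n"
    by (simp add: gbinomial_pochhammer power_mult_distrib[symmetric])
  finally show ?thesis
    using pochhammer_pos[of "1 / 2 :: real" n] by simp
qed

text \<open>Only the zeroth coefficient, equal to 1, is positive; all others change sign under the
  modulus. Together with the nonnegative partial sums this is the origin of the bound 2.\<close>

lemma sqrt_coeff_abs_sum: "(\<Sum>k\<le>n. \<bar>sqrt_coeff k\<bar>) = 2 - (\<Sum>k\<le>n. sqrt_coeff k)"
  by (induction n) (use sqrt_coeff_Suc_nonpos in \<open>auto simp: abs_of_nonpos\<close>)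

lemma sqrt_coeff_abs_sum_le: "(\<Sum>k\<le>n. \<bar>sqrt_coeff k\<bar>) \<le> 2"
  using sqrt_coeff_sum_nonneg[of n] by (simp add: sqrt_coeff_abs_sum)

lemma summable_abs_sqrt_coeff: "summable (\<lambda>n. \<bar>sqrt_coeff n\<bar>)"
proof (rule summableI_nonneg_bounded)
  fix n
  have "(\<Sum>k<n. \<bar>sqrt_coeff k\<bar>) \<le> (\<Sum>k\<le>n. \<bar>sqrt_coeff k\<bar>)"
    by (intro sum_mono2) auto
  then show "(\<Sum>k<n. \<bar>sqrt_coeff k\<bar>) \<le> 2"
    using sqrt_coeff_abs_sum_le[of n] by linarith
qed simp

text \<open>The Cauchy square of the series is 1 - x, by Vandermonde's identity for the exponents
  1/2 and 1/2.\<close>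

lemma sqrt_coeff_convolution:
  "(\<Sum>i\<le>k. sqrt_coeff i * sqrt_coeff (k - i)) = (if k = 0 then 1 else if k = 1 then -1 else 0)"
proof -
  have "(\<Sum>i\<le>k. sqrt_coeff i * sqrt_coeff (k - i))
      = (\<Sum>i=0..k. ((1 / 2) gchoose i) * ((1 / 2) gchoose (k - i)) * (- 1) ^ k)"
    unfolding atMost_atLeast0
    by (intro sum.cong refl) (simp add: sqrt_coeff_def power_add[symmetric])
  also have "\<dots> = (1 gchoose k) * (- 1) ^ k"
    unfolding sum_distrib_right[symmetric] gbinomial_Vandermonde by simp
  also have "(1 gchoose k :: real) = of_nat (1 choose k)"
    by (simp only: binomial_gbinomial of_nat_1)
  also have "of_nat (1 choose k) * (- 1) ^ k = (if k = 0 then 1 else if k = 1 then -1 else 0 :: real)"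
    by (cases "k \<le> 1") (auto simp: le_Suc_eq binomial_eq_0)
  finally show ?thesis .
qed

text \<open>The square root of \<open>1 - T\<close> is given by the binomial series, whose coefficients are absolutely
  summable.\<close>

theorem contraction_sqrt:
  fixes T :: "'a::{real_inner, banach} \<Rightarrow> 'a"
  assumes T: "bounded_linear T" and contr: "\<And>x. norm (T x) \<le> norm x"
    and sa: "\<And>x y. inner (T x) y = inner x (T y)"
  obtains S where "bounded_linear S" "\<And>x. S (S x) = x - T x" "\<And>x. 0 \<le> inner (S x) x"
    "\<And>x y. inner (S x) y = inner x (S y)"
    "\<And>U x. bounded_linear U \<Longrightarrow> (\<And>x. U (T x) = T (U x)) \<Longrightarrow> S (U x) = U (S x)"
proof
  interpret T: bounded_linear T by (rule T)
  have lin: "bounded_linear (T ^^ n)" for n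
    by (induction n) (auto simp: id_def comp_def intro: bounded_linear_ident bounded_linear_compose[OF T])
  have pow_add: "(T ^^ n) (x + y) = (T ^^ n) x + (T ^^ n) y" for n x y
    by (rule linear_add[OF bounded_linear.linear[OF lin]])
  have pow_scale: "(T ^^ n) (c *\<^sub>R x) = c *\<^sub>R (T ^^ n) x" for n c x
    by (rule linear_scale[OF bounded_linear.linear[OF lin]])
  have nrm: "norm ((T ^^ n) x) \<le> norm x" for n x
    by (induction n) (auto intro: order_trans[OF contr])
  have sa_n: "inner ((T ^^ n) x) y = inner x ((T ^^ n) y)" for n x y
    by (induction n arbitrary: x y) (auto simp: sa funpow_swap1)
  define S where "S x = (\<Sum>n. sqrt_coeff n *\<^sub>R (T ^^ n) x)" for x
  have sn: "summable (\<lambda>n. norm (sqrt_coeff n *\<^sub>R (T ^^ n) x))" for x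
  proof (rule summable_comparison_test')
    show "summable (\<lambda>n. \<bar>sqrt_coeff n\<bar> * norm x)"
      by (rule summable_mult2[OF summable_abs_sqrt_coeff])
  qed (simp add: mult_left_mono nrm)
  then have s: "summable (\<lambda>n. sqrt_coeff n *\<^sub>R (T ^^ n) x)" for x
    by (rule summable_norm_cancel)
  have S_sums: "(\<lambda>n. sqrt_coeff n *\<^sub>R (T ^^ n) x) sums S x" for x
    unfolding S_def by (rule summable_sums[OF s])
  have partial: "(\<lambda>n. \<Sum>k\<le>n. sqrt_coeff k *\<^sub>R (T ^^ k) x) \<longlonglongrightarrow> S x" for x
    using S_sums[of x] by (simp add: sums_def_le)
  show "bounded_linear S"
  proof (rule bounded_linear_intro)
    show "S (x + y) = S x + S y" for x y
    proof -
      have "(\<lambda>n. sqrt_coeff n *\<^sub>R (T ^^ n) (x + y)) sums (S x + S y)"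
        using sums_add[OF S_sums[of x] S_sums[of y]] by (simp add: pow_add scaleR_right_distrib)
      with S_sums show ?thesis by (rule sums_unique2)
    qed
    show "S (c *\<^sub>R x) = c *\<^sub>R S x" for c x
    proof -
      have "(\<lambda>n. sqrt_coeff n *\<^sub>R (T ^^ n) (c *\<^sub>R x)) sums (c *\<^sub>R S x)"
        using sums_scaleR_right[OF S_sums[of x], of c]
        by (simp add: pow_scale mult.commute)
      with S_sums show ?thesis by (rule sums_unique2)
    qed
    show "norm (S x) \<le> norm x * 2" for x
    proof (rule tendsto_upperbound[OF tendsto_norm[OF partial]])
      show "\<forall>\<^sub>F n in sequentially. norm (\<Sum>k\<le>n. sqrt_coeff k *\<^sub>R (T ^^ k) x) \<le> norm x * 2"
      proof (rule always_eventually, rule allI)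
        fix n
        have "norm (\<Sum>k\<le>n. sqrt_coeff k *\<^sub>R (T ^^ k) x) \<le> (\<Sum>k\<le>n. \<bar>sqrt_coeff k\<bar> * norm x)"
          by (rule sum_norm_le) (simp add: mult_left_mono nrm)
        also have "\<dots> = norm x * (\<Sum>k\<le>n. \<bar>sqrt_coeff k\<bar>)"
          by (simp add: sum_distrib_left mult.commute)
        also have "\<dots> \<le> norm x * 2"
          by (intro mult_left_mono sqrt_coeff_abs_sum_le) simp
        finally show "norm (\<Sum>k\<le>n. sqrt_coeff k *\<^sub>R (T ^^ k) x) \<le> norm x * 2" .
      qed
    qed simp
  qed
  then interpret S: bounded_linear S .
  show "0 \<le> inner (S x) x" for x
  proof (rule tendsto_lowerbound[OF tendsto_inner[OF partial tendsto_const]])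
    show "\<forall>\<^sub>F n in sequentially. 0 \<le> inner (\<Sum>k\<le>n. sqrt_coeff k *\<^sub>R (T ^^ k) x) x"
    proof (rule always_eventually, rule allI)
      fix n
      \<comment> \<open>Replacing every inner product by the larger \<open>inner x x\<close> lowers
        the sum, since the coefficients beyond the zeroth are nonpositive, and the zeroth term is
        unchanged.\<close>
      have "(\<Sum>k\<le>n. sqrt_coeff k) * (inner x x) \<le> (\<Sum>k\<le>n. sqrt_coeff k * inner ((T ^^ k) x) x)"
        unfolding sum_distrib_right
      proof (rule sum_mono)
        fix k
        have "inner ((T ^^ k) x) x \<le> norm ((T ^^ k) x) * norm x"
          by (rule norm_cauchy_schwarz)
        also have "\<dots> \<le> norm x * norm x" by (intro mult_right_mono nrm) simp
        finally have le: "inner ((T ^^ k) x) x \<le> inner x x"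
          by (simp add: power2_norm_eq_inner[symmetric] power2_eq_square)
        show "sqrt_coeff k * inner x x \<le> sqrt_coeff k * inner ((T ^^ k) x) x"
          by (cases k) (use le sqrt_coeff_Suc_nonpos in \<open>auto intro: mult_left_mono_neg\<close>)
      qed
      moreover have "0 \<le> (\<Sum>k\<le>n. sqrt_coeff k) * inner x x"
        using sqrt_coeff_sum_nonneg by simp
      ultimately show "0 \<le> inner (\<Sum>k\<le>n. sqrt_coeff k *\<^sub>R (T ^^ k) x) x"
        by (simp add: inner_sum_left)
    qed
  qed simp
  show "inner (S x) y = inner x (S y)" for x y
  proof (rule LIMSEQ_unique)
    show "(\<lambda>n. inner (\<Sum>k\<le>n. sqrt_coeff k *\<^sub>R (T ^^ k) x) y) \<longlonglongrightarrow> inner (S x) y"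
      by (intro tendsto_inner partial tendsto_const)
    have "(\<lambda>n. inner x (\<Sum>k\<le>n. sqrt_coeff k *\<^sub>R (T ^^ k) y)) \<longlonglongrightarrow> inner x (S y)"
      by (intro tendsto_inner partial tendsto_const)
    then show "(\<lambda>n. inner (\<Sum>k\<le>n. sqrt_coeff k *\<^sub>R (T ^^ k) x) y) \<longlonglongrightarrow> inner x (S y)"
      by (simp add: inner_sum_left inner_sum_right sa_n)
  qed
  \<comment> \<open>With multiplication by a complex scalar as \<open>U\<close>, this later recovers
    complex linearity from the present real setting.\<close>
  show "S (U x) = U (S x)" if U: "bounded_linear U" and comm: "\<And>x. U (T x) = T (U x)" for U x
  proof -
    have "U ((T ^^ n) x) = (T ^^ n) (U x)" for n
      by (induction n) (auto simp: comm)
    then have "(\<lambda>n. sqrt_coeff n *\<^sub>R (T ^^ n) (U x)) sums U (S x)"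
      using bounded_linear.sums[OF U S_sums[of x]]
      by (simp add: linear_scale[OF bounded_linear.linear[OF U]])
    with S_sums show ?thesis by (rule sums_unique2)
  qed
  show "S (S x) = x - T x" for x
  proof -
    define F where "F = (\<lambda>(m, n). (sqrt_coeff m * sqrt_coeff n) *\<^sub>R (T ^^ (m + n)) x)"
    have has_sum_S: "((\<lambda>n. sqrt_coeff n *\<^sub>R (T ^^ n) y) has_sum S y) UNIV" for y
      by (rule norm_summable_imp_has_sum[OF sn S_sums])
    \<comment> \<open>Absolute summability of the double series, with bound 4 times the norm of
      \<open>x\<close>; it permits summing along the diagonals on which \<open>m + n\<close> is
      constant, where the convolution identity applies.\<close>
    have "(\<lambda>p. norm (F p)) summable_on UNIV \<times> UNIV"
    proof (rule nonneg_bdd_above_summable_on)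
      show "bdd_above (sum (\<lambda>p. norm (F p)) ` {A. A \<subseteq> UNIV \<times> UNIV \<and> finite A})"
      proof (rule bdd_aboveI)
        fix t assume "t \<in> sum (\<lambda>p. norm (F p)) ` {A. A \<subseteq> UNIV \<times> UNIV \<and> finite A}"
        then obtain A where A: "finite A" "t = (\<Sum>p\<in>A. norm (F p))" by auto
        have "finite (fst ` A \<union> snd ` A)" using A(1) by simp
        then obtain N where N: "\<forall>k\<in>fst ` A \<union> snd ` A. k \<le> N"
          unfolding finite_nat_set_iff_bounded_le ..
        have "A \<subseteq> {..N} \<times> {..N}"
        proof
          fix p assume "p \<in> A"
          then have "fst p \<le> N" "snd p \<le> N" using N by auto
          then show "p \<in> {..N} \<times> {..N}" by (simp add: mem_Times_iff)
        qed
        then have "t \<le> (\<Sum>p\<in>{..N} \<times> {..N}. norm (F p))"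
          unfolding A(2) by (intro sum_mono2) auto
        also have "\<dots> \<le> (\<Sum>p\<in>{..N} \<times> {..N}. \<bar>sqrt_coeff (fst p)\<bar> * \<bar>sqrt_coeff (snd p)\<bar> * norm x)"
          by (intro sum_mono) (auto simp: F_def abs_mult intro!: mult_left_mono nrm)
        also have "\<dots> = (\<Sum>m\<le>N. \<bar>sqrt_coeff m\<bar>) * (\<Sum>n\<le>N. \<bar>sqrt_coeff n\<bar>) * norm x"
          unfolding sum_product sum.cartesian_product
          by (simp add: sum_distrib_right[of _ _ "norm x"] case_prod_beta)
        also have "\<dots> \<le> 2 * 2 * norm x"
          by (intro mult_right_mono mult_mono sqrt_coeff_abs_sum_le) (auto intro: sum_nonneg)
        finally show "t \<le> 2 * 2 * norm x" .
      qed
    qed simp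
    then have F: "F summable_on UNIV \<times> UNIV"
      by (rule abs_summable_summable)
    have "S (S x) = infsum (\<lambda>m. infsum (\<lambda>n. F (m, n)) UNIV) UNIV"
    proof -
      have "((\<lambda>n. F (m, n)) has_sum sqrt_coeff m *\<^sub>R (T ^^ m) (S x)) UNIV" for m
      proof -
        have "((\<lambda>n. sqrt_coeff m *\<^sub>R (T ^^ m) (sqrt_coeff n *\<^sub>R (T ^^ n) x)) has_sum sqrt_coeff m *\<^sub>R (T ^^ m) (S x)) UNIV"
          by (intro has_sum_bounded_linear[OF _ has_sum_S, unfolded comp_def]
              bounded_linear_compose[OF bounded_linear_scaleR_right lin])
        then show ?thesis
          by (simp add: F_def pow_scale funpow_add)
      qed
      note inner = this
      show ?thesis
        unfolding infsumI[OF inner] by (rule infsumI[OF has_sum_S[of "S x"], symmetric])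
    qed
    also have "\<dots> = infsum F (UNIV \<times> UNIV)"
      using infsum_Sigma'_banach[of "\<lambda>m n. F (m, n)" UNIV "\<lambda>_. UNIV"] F by simp
    also have "\<dots> = infsum (\<lambda>(k, i). F (i, k - i)) (SIGMA k:UNIV. {..k})"
    proof -
      have "bij_betw (\<lambda>(k, i). (i, k - i)) (SIGMA k:UNIV. {..k}) (UNIV \<times> (UNIV::nat set))"
        by (rule bij_betw_byWitness[where f' = "\<lambda>(i, j). (i + j, i)"]) auto
      from infsum_reindex_bij_betw[OF this, of F]
      show ?thesis by (simp add: case_prod_unfold)
    qed
    also have "\<dots> = infsum (\<lambda>k. infsum (\<lambda>i. F (i, k - i)) {..k}) UNIV"
    proof (rule infsum_Sigma'_banach[symmetric])
      have "bij_betw (\<lambda>(k, i). (i, k - i)) (SIGMA k:UNIV. {..k}) (UNIV \<times> (UNIV::nat set))"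
        by (rule bij_betw_byWitness[where f' = "\<lambda>(i, j). (i + j, i)"]) auto
      from summable_on_reindex_bij_betw[OF this, of F] F
      show "(\<lambda>(k, i). F (i, k - i)) summable_on (SIGMA k:UNIV. {..k})"
        by (simp add: case_prod_unfold)
    qed
    also have "\<dots> = infsum (\<lambda>k. (if k = 0 then 1 else if k = 1 then -1 else 0) *\<^sub>R (T ^^ k) x) UNIV"
    proof (rule infsum_cong)
      fix k
      have "infsum (\<lambda>i. F (i, k - i)) {..k} = (\<Sum>i\<le>k. (sqrt_coeff i * sqrt_coeff (k - i)) *\<^sub>R (T ^^ k) x)"
        by (simp add: F_def)
      also have "\<dots> = (if k = 0 then 1 else if k = 1 then -1 else 0) *\<^sub>R (T ^^ k) x"
        unfolding scaleR_sum_left[symmetric] sqrt_coeff_convolution ..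
      finally show "infsum (\<lambda>i. F (i, k - i)) {..k} = (if k = 0 then 1 else if k = 1 then -1 else 0) *\<^sub>R (T ^^ k) x" .
    qed
    also have "\<dots> = infsum (\<lambda>k. (if k = 0 then 1 else if k = 1 then -1 else 0) *\<^sub>R (T ^^ k) x) {0, 1}"
      by (rule infsum_cong_neutral) auto
    also have "\<dots> = x - T x" by simp
    finally show ?thesis .
  qed
qed

text \<open>A minimizing sequence of \<open>\<parallel>S k\<parallel>\<^sup>2 - 2 \<langle>k, f\<rangle>\<close> has a convergent image under \<open>S\<close>, by the
  parallelogram law.\<close>

theorem range_criterion:
  fixes S :: "'a::{real_inner, banach} \<Rightarrow> 'a"
  assumes S: "bounded_linear S" and sa: "\<And>x y. inner (S x) y = inner x (S y)"
    and bound: "\<And>k. inner k f \<le> C * norm (S k)" and C: "0 \<le> C"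
  obtains K g where "(\<lambda>n. S (K n)) \<longlonglongrightarrow> g" "S g = f" "norm g \<le> C"
proof -
  interpret S: bounded_linear S by (rule S)
  define \<Psi> where "\<Psi> k = (norm (S k))\<^sup>2 - 2 * inner k f" for k
  define m where "m = (INF k. \<Psi> k)"
  \<comment> \<open>Completing the square: by \<open>bound\<close> the functional is at least
    \<open>s^2 - 2 * C * s\<close>, where \<open>s\<close> is the norm of
    \<open>S k\<close>.\<close>
  have "- C\<^sup>2 \<le> \<Psi> k" for k
    using bound[of k] zero_le_power2[of "norm (S k) - C"]
    by (simp add: \<Psi>_def power2_diff mult.commute)
  then have bdd: "bdd_below (range \<Psi>)" by (rule bdd_belowI2)
  have m_le: "m \<le> \<Psi> k" for k
    unfolding m_def by (rule cINF_lower[OF bdd]) simp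
  have "\<exists>k. \<Psi> k < m + 1 / real (Suc n)" for n
    using cINF_less_iff[OF _ bdd, of "m + 1 / real (Suc n)"] by (auto simp: m_def)
  then obtain K where K: "\<And>n. \<Psi> (K n) < m + 1 / real (Suc n)" by metis
  have par: "(norm (S a - S b))\<^sup>2 \<le> 2 * (\<Psi> a - m) + 2 * (\<Psi> b - m)" for a b
  proof -
    have "S ((1 / 2) *\<^sub>R (a + b)) = (1 / 2) *\<^sub>R (S a + S b)"
      by (simp only: S.scaleR S.add)
    then have "4 * \<Psi> ((1 / 2) *\<^sub>R (a + b)) = (norm (S a + S b))\<^sup>2 - 4 * inner a f - 4 * inner b f"
      by (simp add: \<Psi>_def power_divide inner_add_left add_divide_distrib)
    moreover have "(norm (S a + S b))\<^sup>2 + (norm (S a - S b))\<^sup>2 = 2 * (norm (S a))\<^sup>2 + 2 * (norm (S b))\<^sup>2"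
      by (simp add: power2_norm_eq_inner inner_add_left inner_add_right inner_diff_left inner_diff_right)
    ultimately show ?thesis
      using m_le[of "(1 / 2) *\<^sub>R (a + b)"] by (simp add: \<Psi>_def)
  qed
  have "Cauchy (\<lambda>n. S (K n))"
  proof (rule metric_CauchyI)
    fix e :: real assume e: "e > 0"
    then have "0 < e\<^sup>2 / 4" by simp
    then obtain N where N: "1 / real (Suc N) < e\<^sup>2 / 4"
      using nat_approx_posE by blast
    have lt: "\<Psi> (K n) - m < e\<^sup>2 / 4" if "n \<ge> N" for n
    proof -
      have "1 / real (Suc n) \<le> 1 / real (Suc N)" using that by (simp add: frac_le)
      then show ?thesis using K[of n] N by linarith
    qed
    show "\<exists>N. \<forall>p\<ge>N. \<forall>n\<ge>N. dist (S (K p)) (S (K n)) < e"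
    proof (intro exI allI impI)
      fix p n assume "N \<le> p" "N \<le> n"
      then have "(dist (S (K p)) (S (K n)))\<^sup>2 < e\<^sup>2"
        using par[of "K p" "K n"] lt[of p] lt[of n] by (simp add: dist_norm)
      then show "dist (S (K p)) (S (K n)) < e"
        using e by (intro power2_less_imp_less[of _ e]) auto
    qed
  qed
  then obtain g where g: "(\<lambda>n. S (K n)) \<longlonglongrightarrow> g"
    using Cauchy_convergent_iff convergent_def by blast
  have \<Psi>K: "(\<lambda>n. \<Psi> (K n)) \<longlonglongrightarrow> m"
  proof (rule tendsto_sandwich[of "\<lambda>_. m" _ _ "\<lambda>n. m + 1 / real (Suc n)"])
    show "(\<lambda>n. m + 1 / real (Suc n)) \<longlonglongrightarrow> m"
      using tendsto_add[OF tendsto_const LIMSEQ_inverse_real_of_nat, of m]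
      by (simp add: inverse_eq_divide)
  qed (simp_all only: m_le less_imp_le[OF K] eventually_True tendsto_const)
  have weak: "inner g (S k) = inner k f" for k
  proof -
    define Q where "Q = inner g (S k) - inner k f"
    \<comment> \<open>First variation at the limit: \<open>m\<close> is at most the value of
      \<open>\<Psi>\<close> at \<open>K n + t *\<^sub>R k\<close>. The sequence \<open>K n\<close>
      itself may diverge, but apart from the values \<open>\<Psi> (K n)\<close>, which tend to
      \<open>m\<close>, only the images under \<open>S\<close> enter.\<close>
    have quad: "0 \<le> 2 * t * Q + t\<^sup>2 * (norm (S k))\<^sup>2" for t
    proof -
      have "(norm (S (K n) + t *\<^sub>R S k))\<^sup>2 = (norm (S (K n)))\<^sup>2 + 2 * t * inner (S (K n)) (S k) + t\<^sup>2 * (norm (S k))\<^sup>2" for n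
        unfolding power2_norm_eq_inner inner_add_left inner_add_right inner_scaleR_left inner_scaleR_right
          inner_commute[of "S k" "S (K n)"] by (simp only: power2_eq_square) algebra
      then have expand: "\<Psi> (K n + t *\<^sub>R k) = \<Psi> (K n) + 2 * t * (inner (S (K n)) (S k) - inner k f) + t\<^sup>2 * (norm (S k))\<^sup>2" for n
        by (simp add: \<Psi>_def S.add S.scaleR inner_add_left algebra_simps)
      have "(\<lambda>n. \<Psi> (K n) + 2 * t * (inner (S (K n)) (S k) - inner k f) + t\<^sup>2 * (norm (S k))\<^sup>2)
          \<longlonglongrightarrow> m + 2 * t * Q + t\<^sup>2 * (norm (S k))\<^sup>2"
        unfolding Q_def by (intro tendsto_intros \<Psi>K g)
      then have "m \<le> m + 2 * t * Q + t\<^sup>2 * (norm (S k))\<^sup>2"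
        by (rule tendsto_lowerbound) (auto simp: expand[symmetric] m_le)
      then show ?thesis by simp
    qed
    \<comment> \<open>The quadratic is evaluated near its minimizer; the summand 1 keeps the
      denominator positive when \<open>S k\<close> vanishes.\<close>
    define N where "N = (norm (S k))\<^sup>2 + 1"
    have N: "N > 0" by (simp add: N_def add_nonneg_pos)
    have "0 \<le> 2 * (- Q / N) * Q + (- Q / N)\<^sup>2 * (N - 1)"
      using quad[of "- Q / N"] by (simp add: N_def)
    also have "\<dots> = - (Q\<^sup>2 * (N + 1) / N\<^sup>2)"
      using N by (simp add: field_simps power2_eq_square)
    finally have "Q\<^sup>2 * (N + 1) / N\<^sup>2 \<le> 0" by simp
    have "Q = 0"
    proof (rule ccontr)
      assume "Q \<noteq> 0"
      then have "0 < Q\<^sup>2 * (N + 1) / N\<^sup>2" using N by simp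
      with \<open>Q\<^sup>2 * (N + 1) / N\<^sup>2 \<le> 0\<close> show False by simp
    qed
    then show ?thesis by (simp add: Q_def)
  qed
  have "inner (S g - f) y = 0" for y
    unfolding inner_diff_left sa[of g y] weak[of y] inner_commute[of y f] by simp
  then have "S g = f"
    using inner_eq_zero_iff[of "S g - f"] by (metis eq_iff_diff_eq_0)
  moreover have "norm g \<le> C"
  proof -
    \<comment> \<open>The hypothesis \<open>bound\<close> is tested on \<open>K n\<close> itself: by
      \<open>weak\<close> its left side is the inner product of \<open>g\<close> with
      \<open>S (K n)\<close>.\<close>
    have "(\<lambda>n. inner g (S (K n))) \<longlonglongrightarrow> inner g g" "(\<lambda>n. C * norm (S (K n))) \<longlonglongrightarrow> C * norm g"
      by (intro tendsto_intros g)+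
    then have "inner g g \<le> C * norm g"
      by (rule LIMSEQ_le) (use bound in \<open>simp add: weak\<close>)
    then show ?thesis
      using C by (cases "g = 0") (auto simp: power2_norm_eq_inner[symmetric] power2_eq_square mult_le_cancel_right)
  qed
  ultimately show ?thesis using that g by blast
qed

section \<open>The Hardy space as a Hilbert space type\<close>

text \<open>A type, so that the two theorems on real Hilbert spaces apply. Its inner product is the
  real part of the complex one, with the same norm.\<close>

typedef hardy = H2
  morphisms hardy_fun Abs_hardy
  using H2_zero by blast

declare hardy_fun [simp] hardy_fun_inverse [simp] Abs_hardy_inverse [simp]

lemma hardy_eqI: "hardy_fun x = hardy_fun y \<Longrightarrow> x = y"
  by (simp add: hardy_fun_inject)

instantiation hardy :: real_inner
begin

definition zero_hardy_def: "0 = Abs_hardy (\<lambda>_. 0)"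
definition plus_hardy_def: "x + y = Abs_hardy (\<lambda>z. hardy_fun x z + hardy_fun y z)"
definition minus_hardy_def: "x - y = Abs_hardy (\<lambda>z. hardy_fun x z - hardy_fun y z)"
definition uminus_hardy_def: "- x = Abs_hardy (\<lambda>z. - hardy_fun x z)"
definition scaleR_hardy_def: "r *\<^sub>R x = Abs_hardy (\<lambda>z. complex_of_real r * hardy_fun x z)"
definition inner_hardy_def: "inner x y = Re (H2_inner (hardy_fun x) (hardy_fun y))"
definition norm_hardy_def: "norm x = sqrt (inner x (x :: hardy))"
definition sgn_hardy_def: "sgn x = inverse (norm x) *\<^sub>R (x :: hardy)"
definition dist_hardy_def: "dist x y = norm (x - y :: hardy)"
definition uniformity_hardy_def:
  "uniformity = (INF e\<in>{0<..}. principal {(x, y :: hardy). dist x y < e})"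
definition open_hardy_def:
  "open U = (\<forall>x\<in>U. \<forall>\<^sub>F (x', y) in uniformity. x' = x \<longrightarrow> (y :: hardy) \<in> U)"

lemma hardy_fun_ops [simp]:
  "hardy_fun 0 = (\<lambda>_. 0)"
  "hardy_fun (x + y) = (\<lambda>z. hardy_fun x z + hardy_fun y z)"
  "hardy_fun (x - y) = (\<lambda>z. hardy_fun x z - hardy_fun y z)"
  "hardy_fun (- x) = (\<lambda>z. - hardy_fun x z)"
  "hardy_fun (r *\<^sub>R x) = (\<lambda>z. complex_of_real r * hardy_fun x z)"
  by (simp_all add: zero_hardy_def plus_hardy_def minus_hardy_def uminus_hardy_def scaleR_hardy_def
      H2_zero H2_add H2_diff H2_uminus H2_scale)

instance
proof
  fix x y z :: hardy and r s :: real
  show "x + y + z = x + (y + z)" "x + y = y + x" "0 + x = x" "- x + x = 0" "x - y = x + - y"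
    "r *\<^sub>R (x + y) = r *\<^sub>R x + r *\<^sub>R y" "(r + s) *\<^sub>R x = r *\<^sub>R x + s *\<^sub>R x"
    "r *\<^sub>R s *\<^sub>R x = (r * s) *\<^sub>R x" "1 *\<^sub>R x = x"
    by (rule hardy_eqI, simp add: algebra_simps)+
  show "dist x y = norm (x - y)" by (rule dist_hardy_def)
  show "norm x = sqrt (inner x x)" by (rule norm_hardy_def)
  show "sgn x = inverse (norm x) *\<^sub>R x" by (rule sgn_hardy_def)
  show "uniformity = (INF e\<in>{0<..}. principal {(x, y :: hardy). dist x y < e})"
    by (rule uniformity_hardy_def)
  show "open U = (\<forall>x\<in>U. \<forall>\<^sub>F (x', y) in uniformity. x' = x \<longrightarrow> y \<in> U)" for U :: "hardy set"
    by (rule open_hardy_def)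
  show "inner x y = inner y x"
    unfolding inner_hardy_def H2_inner_commute[of "hardy_fun x" "hardy_fun y"] by simp
  show "inner (x + y) z = inner x z + inner y z"
    by (simp add: inner_hardy_def H2_inner_add_left)
  show "inner (r *\<^sub>R x) y = r * inner x y"
    by (simp add: inner_hardy_def H2_inner_scale_left)
  have self: "inner x x = (H2_norm (hardy_fun x))\<^sup>2"
    by (simp add: inner_hardy_def H2_inner_self flip: of_real_power)
  show "0 \<le> inner x x" by (simp add: self)
  show "inner x x = 0 \<longleftrightarrow> x = 0"
  proof
    assume "inner x x = 0"
    then have "hardy_fun x = (\<lambda>_. 0)"
      by (intro H2_norm_eq_0) (simp_all add: self)
    then show "x = 0" by (intro hardy_eqI) simp
  next
    assume "x = 0"
    then show "inner x x = 0"
      using H2_inner_scale_left[OF H2_zero H2_zero, of 0] by (simp add: inner_hardy_def)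
  qed
qed

end

lemma norm_hardy: "norm x = H2_norm (hardy_fun x)"
  by (simp add: norm_hardy_def inner_hardy_def H2_inner_self H2_norm_nonneg flip: of_real_power)

instance hardy :: banach
proof
  fix X :: "nat \<Rightarrow> hardy"
  assume X: "Cauchy X"
  have "\<exists>N. \<forall>m\<ge>N. \<forall>n\<ge>N. H2_norm (\<lambda>z. hardy_fun (X m) z - hardy_fun (X n) z) < e" if "e > 0" for e
    using metric_CauchyD[OF X that] by (simp add: dist_norm norm_hardy)
  then obtain g where g: "g \<in> H2" "(\<lambda>n. H2_norm (\<lambda>z. hardy_fun (X n) z - g z)) \<longlonglongrightarrow> 0"
    using H2_complete[of "\<lambda>n. hardy_fun (X n)", OF hardy_fun] by blast
  then have "(\<lambda>n. norm (X n - Abs_hardy g)) \<longlonglongrightarrow> 0"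
    by (simp add: norm_hardy)
  then have "X \<longlonglongrightarrow> Abs_hardy g"
    by (simp add: tendsto_norm_zero_iff LIM_zero_iff)
  then show "convergent X" by (rule convergentI)
qed

text \<open>Complex scalars as bounded real-linear operators: commuting with them is what complex
  linearity means on this type.\<close>

definition cscale :: "complex \<Rightarrow> hardy \<Rightarrow> hardy" where
  "cscale c x = Abs_hardy (\<lambda>z. c * hardy_fun x z)"

lemma hardy_fun_cscale [simp]: "hardy_fun (cscale c x) = (\<lambda>z. c * hardy_fun x z)"
  by (simp add: cscale_def H2_scale)

lemma bounded_linear_cscale: "bounded_linear (cscale c)"
proof (rule bounded_linear_intro)
  show "norm (cscale c x) \<le> norm x * cmod c" for x
    by (simp add: norm_hardy H2_norm_scale)
qed (rule hardy_eqI, simp add: algebra_simps)+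

section \<open>Positive operators and their ranges\<close>

text \<open>Polarization: reality of the quadratic form at the sum of \<open>f\<close> and
  \<open>g\<close> settles the imaginary parts, and with \<open>\<i>\<close> times \<open>f\<close>
  in place of \<open>f\<close> the real parts.\<close>

lemma H2_positive_operator_self_adjoint:
  assumes S: "H2_positive_operator S" and f: "f \<in> H2" and g: "g \<in> H2"
  shows "H2_inner (S f) g = H2_inner f (S g)"
proof -
  have SH: "S f \<in> H2" if "f \<in> H2" for f
    using S that by (auto simp: H2_positive_operator_def H2_bounded_operator_def)
  have add: "S (\<lambda>z. f z + g z) = (\<lambda>z. S f z + S g z)" if "f \<in> H2" "g \<in> H2" for f g
    using S that by (auto simp: H2_positive_operator_def H2_bounded_operator_def)
  have scale: "S (\<lambda>z. c * f z) = (\<lambda>z. c * S f z)" if "f \<in> H2" for c f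
    using S that by (auto simp: H2_positive_operator_def H2_bounded_operator_def)
  have real: "Im (H2_inner (S f) f) = 0" if "f \<in> H2" for f
    using S that by (auto simp: H2_positive_operator_def nonneg_Reals_def complex_is_Real_iff)
  have sum: "Im (H2_inner (S f) g) + Im (H2_inner (S g) f) = 0" if "f \<in> H2" "g \<in> H2" for f g
    using real[OF H2_add[OF that]] real[OF that(1)] real[OF that(2)]
    by (simp add: add that SH H2_inner_add_left H2_inner_add_right H2_add)
  have "Im (H2_inner (S (\<lambda>z. \<i> * f z)) g) + Im (H2_inner (S g) (\<lambda>z. \<i> * f z)) = 0"
    by (rule sum[OF H2_scale[OF f] g])
  then have "Re (H2_inner (S f) g) = Re (H2_inner (S g) f)"
    by (simp add: scale f g SH H2_inner_scale_left H2_inner_scale_right)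
  with sum[OF f g] have "H2_inner (S f) g = cnj (H2_inner (S g) f)"
    by (simp add: complex_eq_iff)
  then show ?thesis by (simp only: H2_inner_commute[of f "S g"])
qed

text \<open>Adds to \<open>range_criterion\<close> that \<open>g\<close> is orthogonal to the
  kernel: it is a limit of elements of the range, and these are orthogonal to the kernel as
  \<open>S\<close> is self-adjoint. So \<open>g\<close> is the preimage selected in
  \<open>Hb_norm\<close>.\<close>

lemma H2_range_criterion:
  assumes S: "H2_positive_operator S" and f: "f \<in> H2" and C: "0 \<le> C"
    and bound: "\<And>k. k \<in> H2 \<Longrightarrow> cmod (H2_inner k f) \<le> C * H2_norm (S k)"
  obtains K g where "\<forall>n. K n \<in> H2" "g \<in> H2" "(\<lambda>n. H2_norm (\<lambda>z. S (K n) z - g z)) \<longlonglongrightarrow> 0"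
    "S g = f" "H2_norm g \<le> C" "\<forall>k\<in>H2. S k = (\<lambda>_. 0) \<longrightarrow> H2_inner g k = 0"
proof -
  have SH [simp]: "S f \<in> H2" if "f \<in> H2" for f
    using S that by (auto simp: H2_positive_operator_def H2_bounded_operator_def)
  have add: "S (\<lambda>z. f z + g z) = (\<lambda>z. S f z + S g z)" if "f \<in> H2" "g \<in> H2" for f g
    using S that by (auto simp: H2_positive_operator_def H2_bounded_operator_def)
  have scale: "S (\<lambda>z. c * f z) = (\<lambda>z. c * S f z)" if "f \<in> H2" for c f
    using S that by (auto simp: H2_positive_operator_def H2_bounded_operator_def)
  obtain M where M: "\<And>f. f \<in> H2 \<Longrightarrow> H2_norm (S f) \<le> M * H2_norm f"
    using S unfolding H2_positive_operator_def H2_bounded_operator_def by blast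
  define S' where "S' x = Abs_hardy (S (hardy_fun x))" for x
  have S'_fun [simp]: "hardy_fun (S' x) = S (hardy_fun x)" for x
    by (simp add: S'_def)
  have lin: "bounded_linear S'"
  proof (rule bounded_linear_intro)
    show "S' (x + y) = S' x + S' y" for x y by (rule hardy_eqI) (simp add: add)
    show "S' (r *\<^sub>R x) = r *\<^sub>R S' x" for r x by (rule hardy_eqI) (simp add: scale)
    show "norm (S' x) \<le> norm x * M" for x
      using M[of "hardy_fun x"] by (simp add: norm_hardy mult.commute)
  qed
  have sa: "inner (S' x) y = inner x (S' y)" for x y
    by (simp add: inner_hardy_def H2_positive_operator_self_adjoint[OF S])
  have le: "inner k (Abs_hardy f) \<le> C * norm (S' k)" for k
    using bound[of "hardy_fun k"] complex_Re_le_cmod[of "H2_inner (hardy_fun k) f"]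
    by (simp add: inner_hardy_def norm_hardy f)
  obtain K g where Kg: "(\<lambda>n. S' (K n)) \<longlonglongrightarrow> g" "S' g = Abs_hardy f" "norm g \<le> C"
    by (rule range_criterion[OF lin sa le C])
  have lim: "(\<lambda>n. H2_norm (\<lambda>z. S (hardy_fun (K n)) z - hardy_fun g z)) \<longlonglongrightarrow> 0"
    using tendsto_norm_zero[OF LIM_zero[OF Kg(1)]] by (simp add: norm_hardy)
  have orth: "H2_inner (hardy_fun g) k = 0" if k: "k \<in> H2" and z: "S k = (\<lambda>_. 0)" for k
  proof -
    have bd: "cmod (H2_inner (hardy_fun g) k)
        \<le> H2_norm (\<lambda>z. S (hardy_fun (K n)) z - hardy_fun g z) * H2_norm k" for n
    proof -
      have "H2_inner (S (hardy_fun (K n))) k = 0"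
        by (simp add: H2_positive_operator_self_adjoint[OF S] k z H2_inner_zero_right)
      then show ?thesis
        using H2_Cauchy_Schwarz[of "\<lambda>z. S (hardy_fun (K n)) z - hardy_fun g z" k]
        by (simp add: H2_inner_diff_left H2_diff k)
    qed
    have "(\<lambda>n. H2_norm (\<lambda>z. S (hardy_fun (K n)) z - hardy_fun g z) * H2_norm k) \<longlonglongrightarrow> 0"
      by (rule tendsto_mult_left_zero[OF lim])
    then have "cmod (H2_inner (hardy_fun g) k) \<le> 0"
      by (rule tendsto_lowerbound) (simp_all add: bd)
    then show ?thesis by simp
  qed
  have "S (hardy_fun g) = f"
    using arg_cong[OF Kg(2), of hardy_fun] f by simp
  then show ?thesis
    using that[of "\<lambda>n. hardy_fun (K n)" "hardy_fun g"] lim orth Kg(3) by (simp add: norm_hardy)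
qed

section \<open>De Branges--Rovnyak spaces\<close>

locale schur_function =
  fixes b :: "complex \<Rightarrow> complex"
  assumes b: "b \<in> Hinf" and b_norm: "Hinf_norm b \<le> 1"
begin

abbreviation Tb :: "(complex \<Rightarrow> complex) \<Rightarrow> complex \<Rightarrow> complex" where
  "Tb \<equiv> coanalytic_toeplitz b"

abbreviation D :: "(complex \<Rightarrow> complex) \<Rightarrow> complex \<Rightarrow> complex" where
  "D \<equiv> defect_operator b"

section \<open>Multiplication by \<open>b\<close> and its defect function\<close>

definition \<Delta> :: "complex \<Rightarrow> complex" where
  "\<Delta> z = complex_of_real (sqrt (1 - (cmod (boundary b z))\<^sup>2))"

lemma boundary_b_measurable [measurable]: "boundary b \<in> borel_measurable circle_measure"
  by (rule boundary_measurable[OF Hinf_H2[OF b]])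

lemma \<Delta>_measurable [measurable]: "\<Delta> \<in> borel_measurable circle_measure"
  unfolding \<Delta>_def by measurable

lemma boundary_b_le: "AE z in circle_measure. cmod (boundary b z) \<le> 1"
  by (rule boundary_Hinf_bound[OF b b_norm])

lemma \<Delta>_le: "AE z in circle_measure. cmod (\<Delta> z) \<le> 1"
  using boundary_b_le
proof eventually_elim
  case (elim z)
  then have "0 \<le> 1 - (cmod (boundary b z))\<^sup>2" by (simp add: power_le_one)
  then show ?case by (simp add: \<Delta>_def real_sqrt_le_1_iff)
qed

lemma \<Delta>_L2: "u \<in> L2_circle \<Longrightarrow> (\<lambda>z. \<Delta> z * u z) \<in> L2_circle"
  by (rule L2_circle_mult_bounded[OF \<Delta>_measurable \<Delta>_le])

lemma \<Delta>_inner: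
  assumes u: "u \<in> L2_circle" and v: "v \<in> L2_circle"
  shows "L2_inner (\<lambda>z. \<Delta> z * u z) (\<lambda>z. \<Delta> z * v z)
    = L2_inner u v - L2_inner (\<lambda>z. boundary b z * u z) (\<lambda>z. boundary b z * v z)"
proof -
  note [measurable] = L2_circle_measurable[OF u] L2_circle_measurable[OF v]
  have "L2_inner u v - L2_inner (\<lambda>z. boundary b z * u z) (\<lambda>z. boundary b z * v z)
      = (LINT z|circle_measure. u z * cnj (v z) - (boundary b z * u z) * cnj (boundary b z * v z))"
    unfolding L2_inner_def
    by (intro Bochner_Integration.integral_diff[symmetric] L2_circle_integrable_mult u v boundary_mult_L2 b)
  also have "\<dots> = L2_inner (\<lambda>z. \<Delta> z * u z) (\<lambda>z. \<Delta> z * v z)"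
    unfolding L2_inner_def
  proof (rule integral_cong_AE)
    show "AE z in circle_measure. u z * cnj (v z) - boundary b z * u z * cnj (boundary b z * v z)
        = \<Delta> z * u z * cnj (\<Delta> z * v z)"
      using boundary_b_le
    proof eventually_elim
      case (elim z)
      then have "0 \<le> 1 - (cmod (boundary b z))\<^sup>2" by (simp add: power_le_one)
      then have sq: "\<Delta> z * cnj (\<Delta> z) = 1 - boundary b z * cnj (boundary b z)"
        unfolding complex_norm_square[symmetric] by (simp add: \<Delta>_def flip: of_real_mult)
      have "\<Delta> z * u z * cnj (\<Delta> z * v z) = (\<Delta> z * cnj (\<Delta> z)) * (u z * cnj (v z))"
        by simp
      also have "\<dots> = u z * cnj (v z) - boundary b z * u z * cnj (boundary b z * v z)"
        unfolding sq by (simp add: algebra_simps)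
      finally show ?case by simp
    qed
  qed measurable
  finally show ?thesis by simp
qed

lemma Tb_H2 [simp]: "f \<in> H2 \<Longrightarrow> Tb f \<in> H2"
  by (rule coanalytic_toeplitz_H2[OF b])

lemma b_mult_H2 [simp]: "f \<in> H2 \<Longrightarrow> (\<lambda>z. b z * f z) \<in> H2"
  by (rule H2_mult_Hinf[OF b])

lemma Tb_inner: "f \<in> H2 \<Longrightarrow> k \<in> H2 \<Longrightarrow> H2_inner (Tb f) k = H2_inner f (\<lambda>z. b z * k z)"
  by (rule coanalytic_toeplitz_inner[OF b])

lemma b_mult_inner:
  assumes "f \<in> H2" "k \<in> H2"
  shows "H2_inner (\<lambda>z. b z * f z) k = H2_inner f (Tb k)"
  using Tb_inner[OF assms(2,1)] H2_inner_commute[of "\<lambda>z. b z * f z" k] H2_inner_commute[of f "Tb k"]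
  by simp

lemma H2_inner_boundary_mult:
  assumes f: "f \<in> H2" and g: "g \<in> H2"
  shows "H2_inner (\<lambda>z. b z * f z) (\<lambda>z. b z * g z)
    = L2_inner (\<lambda>z. boundary b z * boundary f z) (\<lambda>z. boundary b z * boundary g z)"
proof -
  note [measurable] = boundary_measurable[OF f] boundary_measurable[OF g]
    boundary_measurable[OF b_mult_H2[OF f]] boundary_measurable[OF b_mult_H2[OF g]]
  show ?thesis
    unfolding H2_inner_def
    by (rule L2_inner_cong) (use boundary_mult[OF b f] boundary_mult[OF b g] in auto)
qed

text \<open>The isometry property of the map in the overview, in polarized form.\<close>

lemma \<Delta>_boundary_inner:
  assumes "f \<in> H2" "g \<in> H2"
  shows "L2_inner (\<lambda>z. \<Delta> z * boundary f z) (\<lambda>z. \<Delta> z * boundary g z)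
    = H2_inner f g - H2_inner (\<lambda>z. b z * f z) (\<lambda>z. b z * g z)"
  by (simp only: \<Delta>_inner[OF boundary_L2[OF assms(1)] boundary_L2[OF assms(2)]]
      H2_inner_boundary_mult[OF assms] H2_inner_def)

lemma \<Delta>_boundary_norm:
  assumes f: "f \<in> H2"
  shows "(l2norm (\<lambda>z. \<Delta> z * boundary f z))\<^sup>2 = (H2_norm f)\<^sup>2 - (H2_norm (\<lambda>z. b z * f z))\<^sup>2"
proof -
  have "complex_of_real ((l2norm (\<lambda>z. \<Delta> z * boundary f z))\<^sup>2)
      = complex_of_real ((H2_norm f)\<^sup>2 - (H2_norm (\<lambda>z. b z * f z))\<^sup>2)"
    unfolding L2_inner_self[symmetric] \<Delta>_boundary_inner[OF f f]
    by (simp only: H2_inner_self[OF f] H2_inner_self[OF b_mult_H2[OF f]] of_real_diff)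
  then show ?thesis by (simp only: of_real_eq_iff)
qed

lemma b_mult_norm: "f \<in> H2 \<Longrightarrow> H2_norm (\<lambda>z. b z * f z) \<le> H2_norm f"
  using \<Delta>_boundary_norm[of f] zero_le_power2[of "l2norm (\<lambda>z. \<Delta> z * boundary f z)"]
  by (metis H2_norm_nonneg diff_ge_0_iff_ge power2_le_imp_le)

lemma Tb_norm:
  assumes f: "f \<in> H2"
  shows "H2_norm (Tb f) \<le> H2_norm f"
proof -
  have "complex_of_real ((H2_norm (Tb f))\<^sup>2) = H2_inner f (\<lambda>z. b z * Tb f z)"
    by (simp only: H2_inner_self[OF Tb_H2[OF f], symmetric] Tb_inner[OF f Tb_H2[OF f]])
  then have "(H2_norm (Tb f))\<^sup>2 = cmod (H2_inner f (\<lambda>z. b z * Tb f z))"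
    by (metis abs_of_nonneg norm_of_real zero_le_power2)
  also have "\<dots> \<le> H2_norm f * H2_norm (\<lambda>z. b z * Tb f z)"
    by (rule H2_Cauchy_Schwarz) (simp_all add: f)
  also have "\<dots> \<le> H2_norm f * H2_norm (Tb f)"
    by (intro mult_left_mono b_mult_norm) (simp_all add: H2_norm_nonneg f)
  finally show ?thesis
    using H2_norm_nonneg[OF Tb_H2[OF f]] H2_norm_nonneg[OF f]
    by (cases "H2_norm (Tb f) = 0") (auto simp: power2_eq_square mult_le_cancel_right)
qed

section \<open>The defect operator\<close>

text \<open>The witness behind the choice in \<open>H2_sqrt\<close>: the product of the two Toeplitz
  operators is a self-adjoint contraction, so \<open>contraction_sqrt\<close> yields a root on
  \<open>hardy\<close>.\<close>

lemma defect_exists: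
  "\<exists>S. H2_positive_operator S \<and> (\<forall>f\<in>H2. S (S f) = (\<lambda>z. f z - analytic_toeplitz b (Tb f) z))"
proof -
  define T where "T x = Abs_hardy (\<lambda>z. b z * Tb (hardy_fun x) z)" for x
  have T_fun [simp]: "hardy_fun (T x) = (\<lambda>z. b z * Tb (hardy_fun x) z)" for x
    by (simp add: T_def)
  have T_norm: "norm (T x) \<le> norm x" for x
    using order_trans[OF b_mult_norm Tb_norm, of "hardy_fun x"] by (simp add: norm_hardy)
  have lin: "bounded_linear T"
  proof (rule bounded_linear_intro)
    show "T (x + y) = T x + T y" for x y
      by (rule hardy_eqI) (simp add: coanalytic_toeplitz_add[OF b] distrib_left)
    show "T (r *\<^sub>R x) = r *\<^sub>R T x" for r x
      by (rule hardy_eqI) (simp add: coanalytic_toeplitz_scale[OF b] mult.left_commute)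
    show "norm (T x) \<le> norm x * 1" for x using T_norm by simp
  qed
  have sa: "inner (T x) y = inner x (T y)" for x y
    by (simp add: inner_hardy_def b_mult_inner Tb_inner[symmetric])
  obtain S where S: "bounded_linear S" and SS: "\<And>x. S (S x) = x - T x" and pos: "\<And>x. 0 \<le> inner (S x) x"
    and S_sa: "\<And>x y. inner (S x) y = inner x (S y)"
    and comm: "\<And>U x. bounded_linear U \<Longrightarrow> (\<And>x. U (T x) = T (U x)) \<Longrightarrow> S (U x) = U (S x)"
    by (rule contraction_sqrt[OF lin T_norm sa], rule that) blast+
  have S_scale: "S (cscale c x) = cscale c (S x)" for c x
  proof (rule comm[OF bounded_linear_cscale])
    show "cscale c (T x) = T (cscale c x)" for x
      by (rule hardy_eqI) (simp add: coanalytic_toeplitz_scale[OF b] mult.left_commute)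
  qed
  have S_add: "S (x + y) = S x + S y" for x y
    by (rule linear_add[OF bounded_linear.linear[OF S]])
  define S' where "S' f = hardy_fun (S (Abs_hardy f))" for f
  have S'_H2: "S' f \<in> H2" for f by (simp add: S'_def)
  have abs_add: "Abs_hardy (\<lambda>z. f z + g z) = Abs_hardy f + Abs_hardy g" if "f \<in> H2" "g \<in> H2" for f g
    by (rule hardy_eqI) (simp add: that H2_add)
  have abs_scale: "Abs_hardy (\<lambda>z. c * f z) = cscale c (Abs_hardy f)" if "f \<in> H2" for c f
    by (rule hardy_eqI) (simp add: that H2_scale)
  have "H2_bounded_operator S'"
    unfolding H2_bounded_operator_def
  proof (intro conjI ballI allI)
    show "S' f \<in> H2" for f by (rule S'_H2)
    show "S' (\<lambda>z. f z + g z) = (\<lambda>z. S' f z + S' g z)" if "f \<in> H2" "g \<in> H2" for f g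
      by (simp add: S'_def abs_add that S_add)
    show "S' (\<lambda>z. c * f z) = (\<lambda>z. c * S' f z)" if "f \<in> H2" for c f
      by (simp add: S'_def abs_scale that S_scale)
    obtain M where M: "\<And>x. norm (S x) \<le> norm x * M"
      using bounded_linear.bounded[OF S] by blast
    have "H2_norm (S' f) \<le> M * H2_norm f" if "f \<in> H2" for f
      using M[of "Abs_hardy f"] that by (simp add: S'_def norm_hardy mult.commute)
    then show "\<exists>M. \<forall>f\<in>H2. H2_norm (S' f) \<le> M * H2_norm f" by blast
  qed
  moreover have "H2_inner (S' f) f \<in> \<real>\<^sub>\<ge>\<^sub>0" if f: "f \<in> H2" for f
  proof -
    let ?x = "Abs_hardy f"
    have "0 \<le> Re (H2_inner (S' f) f)"
      using pos[of ?x] by (simp add: inner_hardy_def S'_def f)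
    moreover have "Im (H2_inner (S' f) f) = 0"
    proof -
      \<comment> \<open>The real inner product with \<open>\<i>\<close> times a vector gives the
        imaginary part of the complex one, so real symmetry forces this part to equal its
        negative.\<close>
      have "inner (S ?x) (cscale \<i> ?x) = inner ?x (cscale \<i> (S ?x))"
        by (simp add: S_sa S_scale)
      then have "Im (H2_inner (S' f) f) = Im (H2_inner f (S' f))"
        by (simp add: inner_hardy_def S'_def f H2_inner_scale_right)
      also have "\<dots> = - Im (H2_inner (S' f) f)"
        by (subst H2_inner_commute) simp
      finally show ?thesis by simp
    qed
    ultimately show ?thesis by (simp add: complex_nonneg_Reals_iff)
  qed
  moreover have "S' (S' f) = (\<lambda>z. f z - analytic_toeplitz b (Tb f) z)" if f: "f \<in> H2" for f
    by (simp add: S'_def SS f analytic_toeplitz_eq[OF b])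
  ultimately show ?thesis
    unfolding H2_positive_operator_def by blast
qed

text \<open>Everything later about the defect operator follows from these two facts, whichever root
  the choice returns.\<close>

lemma D_positive: "H2_positive_operator D"
  and D_D: "f \<in> H2 \<Longrightarrow> D (D f) = (\<lambda>z. f z - b z * Tb f z)"
proof -
  have *: "H2_positive_operator D \<and> (\<forall>f\<in>H2. D (D f) = (\<lambda>z. f z - analytic_toeplitz b (Tb f) z))"
    unfolding defect_operator_def H2_sqrt_def by (rule someI_ex[OF defect_exists])
  then show "H2_positive_operator D" ..
  show "D (D f) = (\<lambda>z. f z - b z * Tb f z)" if "f \<in> H2"
    using * that by (simp add: analytic_toeplitz_eq[OF b])
qed

lemma D_H2 [simp]: "f \<in> H2 \<Longrightarrow> D f \<in> H2"
  and D_add: "f \<in> H2 \<Longrightarrow> g \<in> H2 \<Longrightarrow> D (\<lambda>z. f z + g z) = (\<lambda>z. D f z + D g z)"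
  and D_scale: "f \<in> H2 \<Longrightarrow> D (\<lambda>z. c * f z) = (\<lambda>z. c * D f z)"
  using D_positive by (auto simp: H2_positive_operator_def H2_bounded_operator_def)

lemma D_diff: "f \<in> H2 \<Longrightarrow> g \<in> H2 \<Longrightarrow> D (\<lambda>z. f z - g z) = (\<lambda>z. D f z - D g z)"
  using D_add[OF _ H2_uminus, of f g] D_scale[of g "-1"] by simp

lemmas D_self_adjoint = H2_positive_operator_self_adjoint[OF D_positive]

text \<open>Both sides are the squared length of the projection of (k, 0) onto the complement. Hence
  \<open>D k\<close> determines the projected pair isometrically, and each coordinate is bounded by
  the norm of \<open>D k\<close>.\<close>

lemma D_norm:
  assumes k: "k \<in> H2"
  shows "(H2_norm (D k))\<^sup>2 = (H2_norm (D (D k)))\<^sup>2 + (l2norm (\<lambda>z. \<Delta> z * boundary (Tb k) z))\<^sup>2"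
proof -
  have kb: "H2_inner k (\<lambda>z. b z * Tb k z) = complex_of_real ((H2_norm (Tb k))\<^sup>2)"
    by (simp add: Tb_inner[symmetric] k H2_inner_self)
  have "complex_of_real ((H2_norm (D k))\<^sup>2) = H2_inner (D (D k)) k"
    by (simp only: H2_inner_self[OF D_H2[OF k], symmetric] D_self_adjoint[OF D_H2[OF k] k])
  also have "\<dots> = H2_inner k k - H2_inner k (\<lambda>z. b z * Tb k z)"
    by (simp add: D_D k H2_inner_diff_left b_mult_inner kb H2_inner_self)
  also have "\<dots> = complex_of_real ((H2_norm k)\<^sup>2 - (H2_norm (Tb k))\<^sup>2)"
    by (simp add: kb H2_inner_self k)
  finally have "(H2_norm (D k))\<^sup>2 = (H2_norm k)\<^sup>2 - (H2_norm (Tb k))\<^sup>2"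
    by (simp only: of_real_eq_iff)
  moreover have "(H2_norm (D (D k)))\<^sup>2 = (H2_norm k)\<^sup>2 - 2 * (H2_norm (Tb k))\<^sup>2 + (H2_norm (\<lambda>z. b z * Tb k z))\<^sup>2"
    using H2_norm_power2_diff[OF k b_mult_H2[OF Tb_H2[OF k]]] by (simp add: D_D k kb flip: of_real_power)
  ultimately show ?thesis
    using \<Delta>_boundary_norm[OF Tb_H2[OF k]] by simp
qed

lemma D_D_norm: "k \<in> H2 \<Longrightarrow> H2_norm (D (D k)) \<le> H2_norm (D k)"
  by (rule power2_le_imp_le) (simp_all add: D_norm H2_norm_nonneg)

lemma \<Delta>_Tb_norm: "k \<in> H2 \<Longrightarrow> l2norm (\<lambda>z. \<Delta> z * boundary (Tb k) z) \<le> H2_norm (D k)"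
  by (rule power2_le_imp_le) (simp_all add: D_norm H2_norm_nonneg)

text \<open>The pairs \<open>(f, u)\<close> orthogonal to all \<open>(b k, - \<Delta> k)\<close> with \<open>k\<close> in \<^term>\<open>H2\<close>. The first
  projection maps them onto \<^term>\<open>Hb b\<close>.\<close>

definition model :: "(complex \<Rightarrow> complex) \<Rightarrow> (complex \<Rightarrow> complex) \<Rightarrow> bool" where
  "model f u \<longleftrightarrow> f \<in> H2 \<and> u \<in> L2_circle \<and>
    (\<forall>k\<in>H2. H2_inner f (\<lambda>z. b z * k z) = L2_inner u (\<lambda>z. \<Delta> z * boundary k z))"

lemma model_H2: "model f u \<Longrightarrow> f \<in> H2"
  and model_L2: "model f u \<Longrightarrow> u \<in> L2_circle"
  and model_inner: "model f u \<Longrightarrow> k \<in> H2 \<Longrightarrow>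
    H2_inner f (\<lambda>z. b z * k z) = L2_inner u (\<lambda>z. \<Delta> z * boundary k z)"
  by (auto simp: model_def)

lemma model_diff:
  assumes "model f u" "model g v"
  shows "model (\<lambda>z. f z - g z) (\<lambda>z. u z - v z)"
  using assms
  by (auto simp: model_def H2_diff L2_circle_diff H2_inner_diff_left L2_inner_diff_left \<Delta>_L2 boundary_L2)

text \<open>Testing against \<open>k\<close> is carried over to testing the old pair against the
  product of \<open>h\<close> and \<open>k\<close>, which is again in \<open>H2\<close>.\<close>

lemma model_coanalytic_toeplitz:
  assumes h: "h \<in> Hinf" and fu: "model f u"
  shows "model (coanalytic_toeplitz h f) (\<lambda>z. cnj (boundary h z) * u z)"
  unfolding model_def
proof (intro conjI ballI)
  note f = model_H2[OF fu] and u = model_L2[OF fu]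
  show "coanalytic_toeplitz h f \<in> H2" by (rule coanalytic_toeplitz_H2[OF h f])
  show "(\<lambda>z. cnj (boundary h z) * u z) \<in> L2_circle" by (rule boundary_mult_L2(2)[OF h u])
  fix k assume k: "k \<in> H2"
  note hk = H2_mult_Hinf[OF h k]
  note [measurable] = L2_circle_measurable[OF u] boundary_measurable[OF k] boundary_measurable[OF hk]
    boundary_measurable[OF Hinf_H2[OF h]]
  have "H2_inner (coanalytic_toeplitz h f) (\<lambda>z. b z * k z) = H2_inner f (\<lambda>z. b z * (h z * k z))"
    by (simp add: coanalytic_toeplitz_inner[OF h f] k mult.left_commute)
  also have "\<dots> = L2_inner u (\<lambda>z. \<Delta> z * boundary (\<lambda>z. h z * k z) z)"
    by (rule model_inner[OF fu hk])
  also have "\<dots> = L2_inner u (\<lambda>z. boundary h z * (\<Delta> z * boundary k z))"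
    by (rule L2_inner_cong) (use boundary_mult[OF h k] in auto)
  also have "\<dots> = L2_inner (\<lambda>z. cnj (boundary h z) * u z) (\<lambda>z. \<Delta> z * boundary k z)"
    by (simp add: L2_inner_mult_left)
  finally show "H2_inner (coanalytic_toeplitz h f) (\<lambda>z. b z * k z)
      = L2_inner (\<lambda>z. cnj (boundary h z) * u z) (\<lambda>z. \<Delta> z * boundary k z)" .
qed

text \<open>This pair is the projection of (k, 0): the part removed is the image of
  \<open>Tb k\<close> under the isometry.\<close>

lemma model_defect:
  assumes k: "k \<in> H2"
  shows "model (D (D k)) (\<lambda>z. \<Delta> z * boundary (Tb k) z)"
  unfolding model_def
proof (intro conjI ballI)
  show "D (D k) \<in> H2" using k by simp
  show "(\<lambda>z. \<Delta> z * boundary (Tb k) z) \<in> L2_circle"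
    by (intro \<Delta>_L2 boundary_L2 Tb_H2 k)
  fix q assume q: "q \<in> H2"
  show "H2_inner (D (D k)) (\<lambda>z. b z * q z) = L2_inner (\<lambda>z. \<Delta> z * boundary (Tb k) z) (\<lambda>z. \<Delta> z * boundary q z)"
    by (simp add: D_D k q H2_inner_diff_left Tb_inner[OF k q] \<Delta>_boundary_inner)
qed

lemma model_closed:
  assumes fu: "\<And>n. model (f n) (u n)" and g: "g \<in> H2" and v: "v \<in> L2_circle"
    and fg: "(\<lambda>n. H2_norm (\<lambda>z. f n z - g z)) \<longlonglongrightarrow> 0"
    and uv: "(\<lambda>n. l2norm (\<lambda>z. u n z - v z)) \<longlonglongrightarrow> 0"
  shows "model g v"
  unfolding model_def
proof (intro conjI ballI)
  fix k assume k: "k \<in> H2"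
  note f = model_H2[OF fu] and u = model_L2[OF fu]
  show "H2_inner g (\<lambda>z. b z * k z) = L2_inner v (\<lambda>z. \<Delta> z * boundary k z)"
  proof (rule LIMSEQ_unique)
    show "(\<lambda>n. H2_inner (f n) (\<lambda>z. b z * k z)) \<longlonglongrightarrow> H2_inner g (\<lambda>z. b z * k z)"
      unfolding H2_inner_def
      using fg by (intro L2_inner_tendsto_left boundary_L2 f g b_mult_H2 k) (simp add: H2_norm_diff f g)
    have "(\<lambda>n. L2_inner (u n) (\<lambda>z. \<Delta> z * boundary k z)) \<longlonglongrightarrow> L2_inner v (\<lambda>z. \<Delta> z * boundary k z)"
      by (intro L2_inner_tendsto_left u v \<Delta>_L2 boundary_L2 k uv)
    then show "(\<lambda>n. H2_inner (f n) (\<lambda>z. b z * k z)) \<longlonglongrightarrow> L2_inner v (\<lambda>z. \<Delta> z * boundary k z)"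
      by (simp add: model_inner[OF fu k])
  qed
qed (fact g v)+

text \<open>If \<open>g\<close> is a limit of elements \<open>D (K n)\<close>, then the pairs of
  \<open>model_defect\<close> for \<open>K n\<close> converge: the first coordinates to
  \<open>D g\<close>, the second because they are Cauchy by \<open>\<Delta>_Tb_norm\<close>.\<close>

lemma Hb_model:
  assumes "f \<in> Hb b"
  obtains u where "model f u"
proof -
  obtain g0 where g0: "g0 \<in> H2" "f = D g0" using assms by (auto simp: Hb_def)
  then have f: "f \<in> H2" by simp
  have bound: "cmod (H2_inner k f) \<le> H2_norm g0 * H2_norm (D k)" if k: "k \<in> H2" for k
    using H2_Cauchy_Schwarz[of "D k" g0] by (simp add: g0 k D_self_adjoint mult.commute)
  \<comment> \<open>The given preimage \<open>g0\<close> need not be a limit of elements of the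
    range of \<open>D\<close>, so the range criterion is applied to \<open>f\<close> again to
    replace it by one that is.\<close>
  obtain K g where K': "\<forall>n. K n \<in> H2" and g: "g \<in> H2"
    and lim: "(\<lambda>n. H2_norm (\<lambda>z. D (K n) z - g z)) \<longlonglongrightarrow> 0" and Dg: "D g = f"
    by (rule H2_range_criterion[OF D_positive f H2_norm_nonneg[OF g0(1)] bound])
  have K: "K n \<in> H2" for n using K' ..
  define u where "u n z = \<Delta> z * boundary (Tb (K n)) z" for n z
  have mod: "model (D (D (K n))) (u n)" for n
    unfolding u_def by (rule model_defect[OF K])
  note uL = model_L2[OF mod]
  obtain M where M: "\<And>f. f \<in> H2 \<Longrightarrow> H2_norm (D f) \<le> M * H2_norm f"
    using D_positive unfolding H2_positive_operator_def H2_bounded_operator_def by blast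
  have lim1: "(\<lambda>n. H2_norm (\<lambda>z. D (D (K n)) z - f z)) \<longlonglongrightarrow> 0"
  proof (rule Lim_null_comparison[OF _ tendsto_mult_right_zero[OF lim, of M]], rule always_eventually, rule allI)
    fix n
    show "norm (H2_norm (\<lambda>z. D (D (K n)) z - f z)) \<le> M * H2_norm (\<lambda>z. D (K n) z - g z)"
      using M[of "\<lambda>z. D (K n) z - g z"] by (simp add: D_diff K g H2_diff Dg H2_norm_nonneg f)
  qed
  have u_dist: "l2norm (\<lambda>z. u m z - u n z) \<le> H2_norm (\<lambda>z. D (K m) z - D (K n) z)" for m n
  proof -
    let ?d = "\<lambda>z. K m z - K n z"
    have d: "?d \<in> H2" by (intro H2_diff K)
    have Td: "Tb ?d = (\<lambda>z. Tb (K m) z - Tb (K n) z)"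
      by (rule H2_eqI) (simp_all add: d K H2_diff Tb_inner H2_inner_diff_left)
    note [measurable] = boundary_measurable[OF Tb_H2[OF d]] boundary_measurable[OF Tb_H2[OF K]]
      L2_circle_measurable[OF uL]
    have "l2norm (\<lambda>z. u m z - u n z) = l2norm (\<lambda>z. \<Delta> z * boundary (Tb ?d) z)"
    proof (rule l2norm_cong)
      show "AE z in circle_measure. u m z - u n z = \<Delta> z * boundary (Tb ?d) z"
        unfolding Td using boundary_diff[OF Tb_H2[OF K[of m]] Tb_H2[OF K[of n]]]
        by eventually_elim (simp add: u_def right_diff_distrib)
    qed measurable
    also have "\<dots> \<le> H2_norm (D ?d)" by (rule \<Delta>_Tb_norm[OF d])
    finally show ?thesis by (simp add: D_diff K)
  qed
  have "\<exists>N. \<forall>m\<ge>N. \<forall>n\<ge>N. l2norm (\<lambda>z. u m z - u n z) < e" if e: "e > 0" for e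
  proof -
    have "\<forall>\<^sub>F n in sequentially. H2_norm (\<lambda>z. D (K n) z - g z) < e / 2"
      using order_tendstoD(2)[OF lim, of "e / 2"] e by simp
    then obtain N where N: "\<And>n. n \<ge> N \<Longrightarrow> H2_norm (\<lambda>z. D (K n) z - g z) < e / 2"
      by (auto simp: eventually_sequentially)
    show ?thesis
    proof (intro exI allI impI)
      fix m n assume "N \<le> m" "N \<le> n"
      have "H2_norm (\<lambda>z. D (K m) z - D (K n) z)
          \<le> H2_norm (\<lambda>z. D (K m) z - g z) + H2_norm (\<lambda>z. D (K n) z - g z)"
        using l2norm_triangle_diff[OF boundary_L2[OF D_H2[OF K[of m]]] boundary_L2[OF g] boundary_L2[OF D_H2[OF K[of n]]]]
        by (simp add: H2_norm_diff K g l2norm_minus_commute[of "boundary g"])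
      also have "\<dots> < e" using N[OF \<open>N \<le> m\<close>] N[OF \<open>N \<le> n\<close>] by simp
      finally show "l2norm (\<lambda>z. u m z - u n z) < e" using u_dist[of m n] by simp
    qed
  qed
  then obtain v where "v \<in> L2_circle" "(\<lambda>n. l2norm (\<lambda>z. u n z - v z)) \<longlonglongrightarrow> 0"
    using L2_circle_complete[of u, OF uL] by blast
  then show ?thesis
    using that model_closed[OF mod f _ lim1] by blast
qed

text \<open>Since \<open>k\<close> is the sum of \<open>D (D k)\<close> and \<open>b\<close> times
  \<open>Tb k\<close>, orthogonality turns the inner product with \<open>f\<close> into one of
  \<open>f\<close> with \<open>D (D k)\<close> plus one of \<open>u\<close> with
  \<open>\<Delta>\<close> times \<open>Tb k\<close>. Both are controlled by the norm of
  \<open>D k\<close>, and the range criterion returns a preimage whose norm is at most the same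
  constant.\<close>

lemma model_Hb:
  assumes fu: "model f u"
  shows "f \<in> Hb b" "0 \<le> Hb_norm b f" "Hb_norm b f \<le> H2_norm f + l2norm u"
proof -
  note f = model_H2[OF fu] and u = model_L2[OF fu]
  have nn: "0 \<le> H2_norm f + l2norm u" by (simp add: H2_norm_nonneg f)
  have bound: "cmod (H2_inner k f) \<le> (H2_norm f + l2norm u) * H2_norm (D k)" if k: "k \<in> H2" for k
  proof -
    have "H2_inner f k = H2_inner f (D (D k)) + H2_inner f (\<lambda>z. b z * Tb k z)"
      by (simp add: D_D k f H2_inner_diff_right)
    then have "cmod (H2_inner f k)
        \<le> cmod (H2_inner f (D (D k))) + cmod (L2_inner u (\<lambda>z. \<Delta> z * boundary (Tb k) z))"
      using model_inner[OF fu Tb_H2[OF k]] by (simp add: norm_triangle_ineq)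
    also have "cmod (H2_inner f (D (D k))) \<le> H2_norm f * H2_norm (D (D k))"
      by (rule H2_Cauchy_Schwarz) (simp_all add: f k)
    also have "\<dots> \<le> H2_norm f * H2_norm (D k)"
      by (intro mult_left_mono D_D_norm H2_norm_nonneg k f)
    also have "cmod (L2_inner u (\<lambda>z. \<Delta> z * boundary (Tb k) z)) \<le> l2norm u * l2norm (\<lambda>z. \<Delta> z * boundary (Tb k) z)"
      by (intro L2_Cauchy_Schwarz u \<Delta>_L2 boundary_L2 Tb_H2 k)
    also have "\<dots> \<le> l2norm u * H2_norm (D k)"
      by (intro mult_left_mono \<Delta>_Tb_norm k) simp
    finally show ?thesis
      using H2_inner_commute[of k f] by (simp add: distrib_right)
  qed
  obtain K g where g: "g \<in> H2" "D g = f" "H2_norm g \<le> H2_norm f + l2norm u"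
    and orth: "\<forall>k\<in>H2. D k = (\<lambda>_. 0) \<longrightarrow> H2_inner g k = 0"
    by (rule H2_range_criterion[OF D_positive f nn bound])
  show "f \<in> Hb b" using g by (auto simp: Hb_def)
  have "(THE g. g \<in> H2 \<and> (\<forall>k\<in>H2. D k = (\<lambda>_. 0) \<longrightarrow> H2_inner g k = 0) \<and> D g = f) = g"
  proof (rule the_equality)
    show "g \<in> H2 \<and> (\<forall>k\<in>H2. D k = (\<lambda>_. 0) \<longrightarrow> H2_inner g k = 0) \<and> D g = f"
      using g orth by blast
    fix g' assume g': "g' \<in> H2 \<and> (\<forall>k\<in>H2. D k = (\<lambda>_. 0) \<longrightarrow> H2_inner g' k = 0) \<and> D g' = f"
    let ?d = "\<lambda>z. g' z - g z"
    have d: "?d \<in> H2" "D ?d = (\<lambda>_. 0)" using g g' by (simp_all add: H2_diff D_diff)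
    then have "H2_inner ?d ?d = 0"
      using g(1) g' orth by (simp add: H2_inner_diff_left)
    then have "?d = (\<lambda>_. 0)"
      using H2_inner_self[OF d(1)] by (intro H2_norm_eq_0[OF d(1)]) simp
    then show "g' = g" by (simp add: fun_eq_iff)
  qed
  then have "Hb_norm b f = H2_norm g"
    unfolding Hb_norm_def by simp
  then show "0 \<le> Hb_norm b f" "Hb_norm b f \<le> H2_norm f + l2norm u"
    using g by (simp_all add: H2_norm_nonneg)
qed

lemma Hb_coanalytic_toeplitz_tendsto:
  fixes h :: "nat \<Rightarrow> complex \<Rightarrow> complex"
  assumes h: "\<And>n. h n \<in> Hinf" "\<And>n. Hinf_norm (h n) \<le> 1" and lim: "(\<lambda>n. h n 0) \<longlonglongrightarrow> 1"
    and f: "f \<in> Hb b"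
  shows "coanalytic_toeplitz (h n) f \<in> Hb b"
    and "(\<lambda>n. Hb_norm b (\<lambda>z. coanalytic_toeplitz (h n) f z - f z)) \<longlonglongrightarrow> 0"
proof -
  obtain u where fu: "model f u" by (rule Hb_model[OF f])
  note fH = model_H2[OF fu] and u = model_L2[OF fu]
  show "coanalytic_toeplitz (h n) f \<in> Hb b"
    by (rule model_Hb(1)[OF model_coanalytic_toeplitz[OF h(1) fu]])
  define \<phi> where "\<phi> n z = cnj (boundary (h n) z) - 1" for n z
  note [measurable] = boundary_measurable[OF Hinf_H2[OF h(1)]]
  have \<phi>0: "(\<lambda>n. l2norm (\<lambda>z. \<phi> n z * g z)) \<longlonglongrightarrow> 0" if g: "g \<in> L2_circle" for g
  proof (rule bounded_l2norm_tendsto_zero[OF _ _ _ g])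
    show "\<phi> n \<in> borel_measurable circle_measure" for n unfolding \<phi>_def by measurable
    show "AE z in circle_measure. cmod (\<phi> n z) \<le> 1 + 1" for n
      using boundary_Hinf_bound[OF h(1,2), of n]
    proof eventually_elim
      case (elim z)
      then show ?case
        using norm_triangle_ineq4[of "cnj (boundary (h n) z)" 1] by (simp add: \<phi>_def)
    qed
    have "l2norm (\<phi> n) = l2norm (\<lambda>z. boundary (h n) z - 1)" for n
      unfolding l2norm_def \<phi>_def by (metis complex_cnj_diff complex_cnj_one complex_mod_cnj)
    then show "(\<lambda>n. l2norm (\<phi> n)) \<longlonglongrightarrow> 0"
      using boundary_Hinf_tendsto_one[OF h lim] by simp
  qed
  let ?d = "\<lambda>n z. coanalytic_toeplitz (h n) f z - f z"
  \<comment> \<open>The difference carries a pair of its own, so the norm estimate applies to it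
    directly and the description inside \<open>Hb_norm\<close> is never manipulated.\<close>
  have mod: "model (?d n) (\<lambda>z. \<phi> n z * u z)" for n
    using model_diff[OF model_coanalytic_toeplitz[OF h(1) fu] fu, of n]
    by (simp add: \<phi>_def left_diff_distrib)
  have lim0: "(\<lambda>n. l2norm (\<lambda>z. \<phi> n z * boundary f z) + l2norm (\<lambda>z. \<phi> n z * u z)) \<longlonglongrightarrow> 0"
    using tendsto_add[OF \<phi>0[OF boundary_L2[OF fH]] \<phi>0[OF u]] by simp
  show "(\<lambda>n. Hb_norm b (?d n)) \<longlonglongrightarrow> 0"
  proof (rule Lim_null_comparison[OF _ lim0], rule always_eventually, rule allI)
    fix n
    have "Hb_norm b (?d n) \<le> H2_norm (?d n) + l2norm (\<lambda>z. \<phi> n z * u z)"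
      by (rule model_Hb(3)[OF mod])
    also have "H2_norm (?d n) \<le> l2norm (\<lambda>z. \<phi> n z * boundary f z)"
      unfolding \<phi>_def by (rule coanalytic_toeplitz_dist[OF h(1) fH])
    finally show "norm (Hb_norm b (?d n)) \<le> l2norm (\<lambda>z. \<phi> n z * boundary f z) + l2norm (\<lambda>z. \<phi> n z * u z)"
      using model_Hb(2)[OF mod, of n] by simp
  qed
qed

end

theorem theorem5p1:
  fixes h :: "nat \<Rightarrow> complex \<Rightarrow> complex"
  assumes "\<And>n. n \<ge> 1 \<Longrightarrow> h n \<in> Hinf"
    and "\<And>n. n \<ge> 1 \<Longrightarrow> Hinf_norm (h n) \<le> 1"
    and "(\<lambda>n. h n 0) \<longlonglongrightarrow> 1"
  shows "\<forall>b\<in>Hinf. Hinf_norm b \<le> 1 \<longrightarrow> (\<forall>f\<in>Hb b.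
           (\<forall>n\<ge>1. coanalytic_toeplitz (h n) f \<in> Hb b) \<and>
           (\<lambda>n. Hb_norm b (\<lambda>z. coanalytic_toeplitz (h n) f z - f z)) \<longlonglongrightarrow> 0)"
proof (intro ballI impI)
  fix b f assume "b \<in> Hinf" "Hinf_norm b \<le> 1" and f: "f \<in> Hb b"
  then interpret schur_function b by unfold_locales
  \<comment> \<open>Nothing but the index is assumed about \<open>h 0\<close>, while the lemma asks
    for all indices; the shift drops this term and leaves the limits unchanged.\<close>
  define h' where "h' n = h (Suc n)" for n
  have h': "\<And>n. h' n \<in> Hinf" "\<And>n. Hinf_norm (h' n) \<le> 1" "(\<lambda>n. h' n 0) \<longlonglongrightarrow> 1"
    using assms LIMSEQ_Suc[OF assms(3)] by (simp_all add: h'_def)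
  note result = Hb_coanalytic_toeplitz_tendsto[OF h' f]
  have "coanalytic_toeplitz (h n) f \<in> Hb b" if "n \<ge> 1" for n
    using result(1)[of "n - 1"] that by (simp add: h'_def)
  moreover have "(\<lambda>n. Hb_norm b (\<lambda>z. coanalytic_toeplitz (h n) f z - f z)) \<longlonglongrightarrow> 0"
    by (rule LIMSEQ_imp_Suc) (use result(2) in \<open>simp add: h'_def\<close>)
  ultimately show "(\<forall>n\<ge>1. coanalytic_toeplitz (h n) f \<in> Hb b) \<and>
      (\<lambda>n. Hb_norm b (\<lambda>z. coanalytic_toeplitz (h n) f z - f z)) \<longlonglongrightarrow> 0" by blast
qed

end
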